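(* Let $p\geq 2$ and $n\geq 2$, and let $G=\mathrm{GL}_p(\mathbb{C})$ act on $\mathcal{V}=\mathcal{M}_p^n$ by simultaneous conjugation. Then $(\pi,\sigma)\mapsto\overline{G^2\cdot\mathcal{C}_{\pi,\sigma}}$ defines a one-to-one correspondence between the maximal elements of the poset $\mathcal{P}_{p,n}$ and the irreducible components of the separating variety $\mathcal{S}_{G,\mathcal{V}}$.
   Context: $\mathcal{M}_p$ is the space of complex $p\times p$ matrices; $g\cdot(A_1,\dots,A_n)=(gA_1g^{-1},\dots,gA_ng^{-1})$. The separating variety is $\mathcal{S}_{G,\mathcal{V}}=\{(v,w)\in\mathcal{V}^2: f(v)=f(w)\ \forall f\in\mathbb{C}[\mathcal{V}]^G\}$. $\Pi(p,k)$ is the set of ordered partitions (compositions) $\pi=(p_1,\dots,p_k)$ of $p$ into $k$ positive parts. For $\sigma\in S_k$, $\sigma(\pi)=(p_{\sigma(1)},\dots,p_{\sigma(k)})$. For $\pi\in\Pi(p,k)$, $\mathcal{V}_\pi\subseteq\mathcal{V}$ is the subspace of tuples all of whose entries are block upper triangular with respect to the block sizes $\pi$. For $\sigma\in S_k$, $\mathcal{C}_{\pi,\sigma}\subseteq\mathcal{V}^2$ is the subspace of pairs $(\mathbf{A},\mathbf{A}')$ with $\mathbf{A}\in\mathcal{V}_\pi$, $\mathbf{A}'\in\mathcal{V}_{\sigma(\pi)}$ and $\mathbf{B}'_{i,i}=\mathbf{B}_{\sigma(i),\sigma(i)}$ for $i=1,\dots,k$, where $\mathbf{B}_{i,i}$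 (resp. $\mathbf{B}'_{i,i}$) is the tuple of $i$-th diagonal $\pi$-blocks of $\mathbf{A}$ (resp. $i$-th diagonal $\sigma(\pi)$-blocks of $\mathbf{A}'$). $G^2$ acts componentwise on $\mathcal{V}^2$ and closures are Zariski closures. $\mathcal{P}_{p,n}=\bigsqcup_{k=1}^p(\Pi(p,k)\times S_k)$, ordered by $(\pi,\sigma)\preceq(\hat\pi,\hat\sigma)$ iff $\overline{G^2\cdot\mathcal{C}_{\pi,\sigma}}\subseteq\overline{G^2\cdot\mathcal{C}_{\hat\pi,\hat\sigma}}$. *)

theory Defs
  imports
    "HOL-Analysis.Abstract_Topology"
    "HOL-Combinatorics.Permutations"
    "Jordan_Normal_Form.Matrix"
begin

section \<open>Polynomial functions and the Zariski topology\<close>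

text \<open>The algebra of functions generated over the complex numbers by a set \<open>\<Gamma>\<close> of coordinate
  functions. Since the field is infinite, polynomials on an affine space are identified
  with the functions they induce.\<close>

inductive_set polynomial_functions :: "('a \<Rightarrow> complex) set \<Rightarrow> ('a \<Rightarrow> complex) set"
  for \<Gamma> :: "('a \<Rightarrow> complex) set" where
  const: "(\<lambda>_. c) \<in> polynomial_functions \<Gamma>"
| coord: "f \<in> \<Gamma> \<Longrightarrow> f \<in> polynomial_functions \<Gamma>"
| add: "f \<in> polynomial_functions \<Gamma> \<Longrightarrow> g \<in> polynomial_functions \<Gamma> \<Longrightarrow>
    (\<lambda>x. f x + g x) \<in> polynomial_functions \<Gamma>"
| mult: "f \<in> polynomial_functions \<Gamma> \<Longrightarrow> g \<in> polynomial_functions \<Gamma> \<Longrightarrow>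
    (\<lambda>x. f x * g x) \<in> polynomial_functions \<Gamma>"

definition zariski_open :: "'a set \<Rightarrow> ('a \<Rightarrow> complex) set \<Rightarrow> 'a set \<Rightarrow> bool" where
  "zariski_open X \<Gamma> U \<longleftrightarrow>
    (\<exists>F \<subseteq> polynomial_functions \<Gamma>. U = X - {x \<in> X. \<forall>f \<in> F. f x = 0})"

definition zariski :: "'a set \<Rightarrow> ('a \<Rightarrow> complex) set \<Rightarrow> 'a topology" where
  "zariski X \<Gamma> = topology (zariski_open X \<Gamma>)"

lemma istopology_zariski_open: "istopology (zariski_open X \<Gamma>)"
  unfolding istopology_def
proof (intro conjI allI impI)
  fix S T assume "zariski_open X \<Gamma> S" "zariski_open X \<Gamma> T"
  then obtain F H where FH: "F \<subseteq> polynomial_functions \<Gamma>" "H \<subseteq> polynomial_functions \<Gamma>"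
    "S = X - {x \<in> X. \<forall>f \<in> F. f x = 0}" "T = X - {x \<in> X. \<forall>f \<in> H. f x = 0}"
    unfolding zariski_open_def by blast
  let ?K = "(\<lambda>(f, h) x. f x * h x) ` (F \<times> H)"
  have "?K \<subseteq> polynomial_functions \<Gamma>"
    using FH(1,2) by (auto intro!: polynomial_functions.mult)
  moreover have "S \<inter> T = X - {x \<in> X. \<forall>f \<in> ?K. f x = 0}"
    unfolding FH(3,4) by auto
  ultimately show "zariski_open X \<Gamma> (S \<inter> T)"
    unfolding zariski_open_def by blast
next
  fix \<K> assume "\<forall>K\<in>\<K>. zariski_open X \<Gamma> K"
  then have "\<forall>K\<in>\<K>. \<exists>F. F \<subseteq> polynomial_functions \<Gamma> \<and> K = X - {x \<in> X. \<forall>f \<in> F. f x = 0}"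
    unfolding zariski_open_def .
  from bchoice[OF this] obtain F where F: "\<forall>K\<in>\<K>. F K \<subseteq> polynomial_functions \<Gamma> \<and>
      K = X - {x \<in> X. \<forall>f \<in> F K. f x = 0}" ..
  have "(\<Union>K\<in>\<K>. F K) \<subseteq> polynomial_functions \<Gamma>"
    using F by blast
  moreover have "\<Union>\<K> = (\<Union>K\<in>\<K>. X - {x \<in> X. \<forall>f \<in> F K. f x = 0})"
  proof -
    have "(\<Union>K\<in>\<K>. X - {x \<in> X. \<forall>f \<in> F K. f x = 0}) = (\<Union>K\<in>\<K>. K)"
      by (rule SUP_cong) (use F in blast)+
    then show ?thesis by simp
  qed
  then have "\<Union>\<K> = X - {x \<in> X. \<forall>f \<in> (\<Union>K\<in>\<K>. F K). f x = 0}"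
    by auto
  ultimately show "zariski_open X \<Gamma> (\<Union>\<K>)"
    unfolding zariski_open_def by blast
qed

lemma openin_zariski: "openin (zariski X \<Gamma>) U \<longleftrightarrow> zariski_open X \<Gamma> U"
  by (simp add: zariski_def istopology_zariski_open topology_inverse')

lemma topspace_zariski [simp]: "topspace (zariski X \<Gamma>) = X"
proof
  show "topspace (zariski X \<Gamma>) \<subseteq> X"
    unfolding topspace_def openin_zariski zariski_open_def by blast
  have "{\<lambda>_. 1} \<subseteq> polynomial_functions \<Gamma>"
    by (simp add: polynomial_functions.const)
  moreover have "X = X - {x \<in> X. \<forall>f \<in> {\<lambda>_. 1 :: complex}. f x = 0}"
    by simp
  ultimately have "zariski_open X \<Gamma> X"
    unfolding zariski_open_def by blast
  then show "X \<subseteq> topspace (zariski X \<Gamma>)"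
    by (simp add: openin_subset openin_zariski)
qed

lemma closedin_zariski:
  "closedin (zariski X \<Gamma>) C \<longleftrightarrow>
    (\<exists>F \<subseteq> polynomial_functions \<Gamma>. C = {x \<in> X. \<forall>f \<in> F. f x = 0})"
proof
  assume "closedin (zariski X \<Gamma>) C"
  then have "C \<subseteq> X" "zariski_open X \<Gamma> (X - C)"
    by (simp_all add: closedin_def openin_zariski)
  then obtain F where "C \<subseteq> X" "F \<subseteq> polynomial_functions \<Gamma>"
    "X - C = X - {x \<in> X. \<forall>f \<in> F. f x = 0}"
    unfolding zariski_open_def by blast
  then show "\<exists>F \<subseteq> polynomial_functions \<Gamma>. C = {x \<in> X. \<forall>f \<in> F. f x = 0}"
    by blast
next
  assume "\<exists>F \<subseteq> polynomial_functions \<Gamma>. C = {x \<in> X. \<forall>f \<in> F. f x = 0}"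
  then have "C \<subseteq> X" "zariski_open X \<Gamma> (X - C)"
    unfolding zariski_open_def by blast+
  then show "closedin (zariski X \<Gamma>) C"
    by (simp add: closedin_def openin_zariski)
qed

definition irreducible_in :: "'a topology \<Rightarrow> 'a set \<Rightarrow> bool" where
  "irreducible_in T Z \<longleftrightarrow> Z \<subseteq> topspace T \<and> Z \<noteq> {} \<and>
    (\<forall>C D. closedin T C \<and> closedin T D \<and> Z \<subseteq> C \<union> D \<longrightarrow> Z \<subseteq> C \<or> Z \<subseteq> D)"

definition irreducible_components :: "'a topology \<Rightarrow> 'a set \<Rightarrow> 'a set set" where
  "irreducible_components T S = {Z. Z \<subseteq> S \<and> irreducible_in T Z \<and>
    (\<forall>Y. Y \<subseteq> S \<and> irreducible_in T Y \<and> Z \<subseteq> Y \<longrightarrow> Y = Z)}"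

section \<open>Simultaneous conjugation and the separating variety\<close>

definition mat_tuples :: "nat \<Rightarrow> nat \<Rightarrow> complex mat list set" where
  "mat_tuples p n = {A. length A = n \<and> set A \<subseteq> carrier_mat p p}"

abbreviation mat_alg :: "nat \<Rightarrow> (complex mat, unit) ring_scheme" where
  "mat_alg p \<equiv> ring_mat TYPE(complex) p ()"

definition GL :: "nat \<Rightarrow> complex mat set" where
  "GL p = Units (mat_alg p)"

definition conj_act :: "nat \<Rightarrow> complex mat \<Rightarrow> complex mat list \<Rightarrow> complex mat list" where
  "conj_act p g A = map (\<lambda>M. g * M * inv\<^bsub>mat_alg p\<^esub> g) A"

definition coords :: "nat \<Rightarrow> nat \<Rightarrow> (complex mat list \<Rightarrow> complex) set" where
  "coords p n = {\<lambda>A. (A ! l) $$ (i, j) | l i j. l < n \<and> i < p \<and> j < p}"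

definition coords2 :: "nat \<Rightarrow> nat \<Rightarrow> (complex mat list \<times> complex mat list \<Rightarrow> complex) set" where
  "coords2 p n = (\<lambda>f. f \<circ> fst) ` coords p n \<union> (\<lambda>f. f \<circ> snd) ` coords p n"

abbreviation zariski2 :: "nat \<Rightarrow> nat \<Rightarrow> (complex mat list \<times> complex mat list) topology" where
  "zariski2 p n \<equiv> zariski (mat_tuples p n \<times> mat_tuples p n) (coords2 p n)"

definition invariants :: "nat \<Rightarrow> nat \<Rightarrow> (complex mat list \<Rightarrow> complex) set" where
  "invariants p n = {f \<in> polynomial_functions (coords p n).
    \<forall>g \<in> GL p. \<forall>A \<in> mat_tuples p n. f (conj_act p g A) = f A}"

definition separating_variety :: "nat \<Rightarrow> nat \<Rightarrow> (complex mat list \<times> complex mat list) set" where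
  "separating_variety p n = {(v, w) \<in> mat_tuples p n \<times> mat_tuples p n.
    \<forall>f \<in> invariants p n. f v = f w}"

section \<open>The subspaces indexed by compositions and permutations\<close>

definition compositions :: "nat \<Rightarrow> nat \<Rightarrow> nat list set" where
  "compositions p k = {\<pi>. length \<pi> = k \<and> (\<forall>m \<in> set \<pi>. 0 < m) \<and> sum_list \<pi> = p}"

text \<open>Blocks are numbered from 0; accordingly \<open>S\<^sub>k\<close> is the set of permutations of \<open>{..<k}\<close>,
  and \<open>permute_list \<sigma> \<pi>\<close> is the list with \<open>i\<close>-th entry \<open>\<pi> ! \<sigma> i\<close>.\<close>

definition block :: "nat list \<Rightarrow> nat \<Rightarrow> nat \<Rightarrow> complex mat \<Rightarrow> complex mat" where
  "block \<pi> a b M = mat (\<pi> ! a) (\<pi> ! b)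
    (\<lambda>(i, j). M $$ (sum_list (take a \<pi>) + i, sum_list (take b \<pi>) + j))"

definition upper_tuples :: "nat \<Rightarrow> nat \<Rightarrow> nat list \<Rightarrow> complex mat list set" where
  "upper_tuples p n \<pi> = {A \<in> mat_tuples p n.
    \<forall>M \<in> set A. \<forall>a < length \<pi>. \<forall>b < a. block \<pi> a b M = 0\<^sub>m (\<pi> ! a) (\<pi> ! b)}"

definition diag_blocks :: "nat list \<Rightarrow> nat \<Rightarrow> complex mat list \<Rightarrow> complex mat list" where
  "diag_blocks \<pi> i A = map (block \<pi> i i) A"

definition C_space ::
  "nat \<Rightarrow> nat \<Rightarrow> nat list \<Rightarrow> (nat \<Rightarrow> nat) \<Rightarrow> (complex mat list \<times> complex mat list) set" where
  "C_space p n \<pi> \<sigma> =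
    {(A, A'). A \<in> upper_tuples p n \<pi> \<and> A' \<in> upper_tuples p n (permute_list \<sigma> \<pi>) \<and>
      (\<forall>i < length \<pi>. diag_blocks (permute_list \<sigma> \<pi>) i A' = diag_blocks \<pi> (\<sigma> i) A)}"

definition orbit2 :: "nat \<Rightarrow> (complex mat list \<times> complex mat list) set
    \<Rightarrow> (complex mat list \<times> complex mat list) set" where
  "orbit2 p Z = {(conj_act p g A, conj_act p h A') | g h A A'.
    g \<in> GL p \<and> h \<in> GL p \<and> (A, A') \<in> Z}"

definition orbit_closure ::
  "nat \<Rightarrow> nat \<Rightarrow> nat list \<times> (nat \<Rightarrow> nat) \<Rightarrow> (complex mat list \<times> complex mat list) set" where
  "orbit_closure p n = (\<lambda>(\<pi>, \<sigma>).
    Abstract_Topology.closure_of (zariski2 p n) (orbit2 p (C_space p n \<pi> \<sigma>)))"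

text \<open>The union over \<open>k\<close> is disjoint because \<open>k\<close> is the length of \<open>\<pi>\<close>. The parameter \<open>n\<close> only
  enters through the order.\<close>

definition P_set :: "nat \<Rightarrow> (nat list \<times> (nat \<Rightarrow> nat)) set" where
  "P_set p = (\<Union>k \<in> {1..p}. compositions p k \<times> {\<sigma>. \<sigma> permutes {..<k}})"

definition P_le ::
  "nat \<Rightarrow> nat \<Rightarrow> nat list \<times> (nat \<Rightarrow> nat) \<Rightarrow> nat list \<times> (nat \<Rightarrow> nat) \<Rightarrow> bool" where
  "P_le p n x y \<longleftrightarrow> orbit_closure p n x \<subseteq> orbit_closure p n y"

definition maximal_elements :: "'a set \<Rightarrow> ('a \<Rightarrow> 'a \<Rightarrow> bool) \<Rightarrow> 'a set" where
  "maximal_elements P r = {x \<in> P. \<forall>y \<in> P. r x y \<longrightarrow> y = x}"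

end

(* By the trace invariants and linear independence of irreducible characters, (v,w) lies in the
   separating variety iff v and w have the same composition factors as representations of the free
   algebra, i.e. iff (v,w) lies in the orbit of some C_{pi,sigma}.  Each such orbit is irreducible,
   since two of its points are joined by a rational curve in it.  So the separating variety is a
   finite union of irreducible closed sets, whose maximal members are its components.

   What is left is that different (pi,sigma) have different orbit closures.  A point of the orbit of
   C_{pi,sigma} has an invariant flag of type pi whose factors, taken in the order sigma, occur in a
   flag of the other tuple.  With t the eigenvalues of the first matrix, arranged along the flag, this
   gives polynomial equations in the point and t; eliminating t gives an equation f = 0 on the orbit
   closure.  At the pair whose first matrices are diagonal with eigenvalues 0, ..., p - 1 and whose
   second matrices have 1 at all positions allowed by the blocks, f detects (pi,sigma). *)

theory Submission
  imports Defs "Jordan_Normal_Form.Schur_Decomposition"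
begin

section \<open>Topology of a finite cover by irreducible closed sets\<close>

section \<open>Irreducible components of a finite union\<close>

text \<open>The delicate point is to distinguish closures rather than orbits: membership in an orbit
  is an existence statement about flags and bases, which does not pass to limits by itself. The list
  t of eigenvalues stands in for the flag. Each entry of t is a root of a monic polynomial whose
  coefficients depend polynomially on the point, so eliminating t loses nothing: the resulting
  equation holds exactly when some admissible t exists. This plays the part that completeness of the
  flag variety would play in a geometric argument.

  Two matrices are needed for this: the first labels the steps of a flag by eigenvalues, the second
  tests which of these steps are invariant. With a single matrix a general point of each orbit is a
  pair of diagonalizable matrices with the same distinct eigenvalues, so all closures would
  coincide.\<close>

lemma irreducible_in_closure_of:
  assumes "irreducible_in T Z"
  shows "irreducible_in T (Abstract_Topology.closure_of T Z)"
proof -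
  have Z: "Z \<subseteq> topspace T" "Z \<noteq> {}"
    and split: "\<And>C D. closedin T C \<Longrightarrow> closedin T D \<Longrightarrow> Z \<subseteq> C \<union> D \<Longrightarrow> Z \<subseteq> C \<or> Z \<subseteq> D"
    using assms unfolding irreducible_in_def by auto
  have sub: "Z \<subseteq> Abstract_Topology.closure_of T Z"
    using Z(1) by (rule closure_of_subset)
  show ?thesis
    unfolding irreducible_in_def
  proof (intro conjI allI)
    show "Abstract_Topology.closure_of T Z \<subseteq> topspace T"
      by (rule closure_of_subset_topspace)
    show "Abstract_Topology.closure_of T Z \<noteq> {}"
      using sub Z(2) by auto
  next
    fix C D
    show "closedin T C \<and> closedin T D \<and> Abstract_Topology.closure_of T Z \<subseteq> C \<union> D \<longrightarrow>
      Abstract_Topology.closure_of T Z \<subseteq> C \<or> Abstract_Topology.closure_of T Z \<subseteq> D"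
    proof
    assume a: "closedin T C \<and> closedin T D \<and> Abstract_Topology.closure_of T Z \<subseteq> C \<union> D"
    then have "Z \<subseteq> C \<or> Z \<subseteq> D"
      using split[of C D] sub by blast
    then show "Abstract_Topology.closure_of T Z \<subseteq> C \<or> Abstract_Topology.closure_of T Z \<subseteq> D"
      using a closure_of_minimal[of Z C T] closure_of_minimal[of Z D T] by blast
    qed
  qed
qed

lemma irreducible_in_subset_Union:
  assumes "irreducible_in T Z" "finite I" "\<And>i. i \<in> I \<Longrightarrow> closedin T (K i)" "Z \<subseteq> (\<Union>i\<in>I. K i)"
  shows "\<exists>i\<in>I. Z \<subseteq> K i"
  using assms(2-4)
proof (induction I rule: finite_induct)
  case empty
  then show ?case using assms(1) unfolding irreducible_in_def by auto
next
  case (insert x I)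
  have "closedin T (\<Union>i\<in>I. K i)"
    using insert by (intro closedin_Union) auto
  moreover have "Z \<subseteq> K x \<union> (\<Union>i\<in>I. K i)" "closedin T (K x)"
    using insert by auto
  ultimately have "Z \<subseteq> K x \<or> Z \<subseteq> (\<Union>i\<in>I. K i)"
    using assms(1) unfolding irreducible_in_def by meson
  then show ?case using insert by auto
qed

text \<open>Injectivity of \<open>K\<close> on all of \<open>P\<close> is used for surjectivity as
  well: two indices with the same closure would lie below each other, so neither would be maximal in
  the sense of \<open>maximal_elements\<close>, and their common component would be missed.\<close>

lemma bij_betw_maximal_elements_irreducible_components:
  assumes "finite P"
    and closed: "\<And>x. x \<in> P \<Longrightarrow> closedin T (K x)"
    and irr: "\<And>x. x \<in> P \<Longrightarrow> irreducible_in T (K x)"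
    and union: "S = (\<Union>x\<in>P. K x)"
    and inj: "\<And>x y. x \<in> P \<Longrightarrow> y \<in> P \<Longrightarrow> K x = K y \<Longrightarrow> x = y"
  shows "bij_betw K (maximal_elements P (\<lambda>x y. K x \<subseteq> K y)) (irreducible_components T S)"
proof -
  have below: "\<exists>x\<in>P. Z \<subseteq> K x" if "Z \<subseteq> S" "irreducible_in T Z" for Z
    using irreducible_in_subset_Union[OF that(2) \<open>finite P\<close>, of K] closed that(1) union by auto
  have comp: "K x \<in> irreducible_components T S"
    if x: "x \<in> maximal_elements P (\<lambda>x y. K x \<subseteq> K y)" for x
  proof -
    have xP: "x \<in> P" and mx: "\<And>y. y \<in> P \<Longrightarrow> K x \<subseteq> K y \<Longrightarrow> y = x"
      using x unfolding maximal_elements_def by auto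
    have "Y = K x" if Y: "Y \<subseteq> S" "irreducible_in T Y" "K x \<subseteq> Y" for Y
    proof -
      obtain y where y: "y \<in> P" "Y \<subseteq> K y"
        using below[OF Y(1,2)] by auto
      then have "y = x" using mx[of y] Y(3) by auto
      then show ?thesis using y Y(3) by auto
    qed
    then show ?thesis
      using xP irr union unfolding irreducible_components_def by auto
  qed
  have surj: "Z \<in> K ` maximal_elements P (\<lambda>x y. K x \<subseteq> K y)"
    if Z: "Z \<in> irreducible_components T S" for Z
  proof -
    have Z': "Z \<subseteq> S" "irreducible_in T Z"
      "\<And>Y. Y \<subseteq> S \<Longrightarrow> irreducible_in T Y \<Longrightarrow> Z \<subseteq> Y \<Longrightarrow> Y = Z"
      using Z unfolding irreducible_components_def by auto
    obtain x where x: "x \<in> P" "Z \<subseteq> K x"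
      using below Z' by blast
    have KZ: "K y = Z" if "y \<in> P" "Z \<subseteq> K y" for y
      using Z'(3)[of "K y"] irr union that by auto
    have "x \<in> maximal_elements P (\<lambda>x y. K x \<subseteq> K y)"
    proof -
      have "y = x" if "y \<in> P" "K x \<subseteq> K y" for y
        using inj[OF that(1) x(1)] KZ[OF x] KZ[OF that(1)] x(2) that(2) by auto
      then show ?thesis unfolding maximal_elements_def using x(1) by auto
    qed
    then show ?thesis using KZ[OF x] by auto
  qed
  have "inj_on K (maximal_elements P (\<lambda>x y. K x \<subseteq> K y))"
    by (rule inj_onI) (auto simp: maximal_elements_def intro: inj)
  moreover have "K ` maximal_elements P (\<lambda>x y. K x \<subseteq> K y) = irreducible_components T S"
    using comp surj by (intro subset_antisym subsetI) auto
  ultimately show ?thesis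
    unfolding bij_betw_def by simp
qed

section \<open>Polynomial maps, conjugation and block matrices\<close>

section \<open>Closure properties of polynomial functions\<close>

lemma polynomial_functions_sum:
  assumes "\<And>i. i \<in> I \<Longrightarrow> (\<lambda>x. f i x) \<in> polynomial_functions \<Gamma>"
  shows "(\<lambda>x. \<Sum>i\<in>I. f i x) \<in> polynomial_functions \<Gamma>"
  using assms
  by (induction I rule: infinite_finite_induct)
    (auto intro: polynomial_functions.const polynomial_functions.add)

lemma polynomial_functions_prod:
  assumes "\<And>i. i \<in> I \<Longrightarrow> (\<lambda>x. f i x) \<in> polynomial_functions \<Gamma>"
  shows "(\<lambda>x. \<Prod>i\<in>I. f i x) \<in> polynomial_functions \<Gamma>"
  using assms
  by (induction I rule: infinite_finite_induct)
    (auto intro: polynomial_functions.const polynomial_functions.mult)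

lemma polynomial_functions_diff:
  assumes "f \<in> polynomial_functions \<Gamma>" "g \<in> polynomial_functions \<Gamma>"
  shows "(\<lambda>x. f x - g x) \<in> polynomial_functions \<Gamma>"
  using polynomial_functions.add[OF assms(1) polynomial_functions.mult[OF polynomial_functions.const[of "-1"] assms(2)]]
  by simp

lemma polynomial_functions_power:
  assumes "f \<in> polynomial_functions \<Gamma>"
  shows "(\<lambda>x. f x ^ k) \<in> polynomial_functions \<Gamma>"
  using assms by (induction k) (auto intro: polynomial_functions.const polynomial_functions.mult)

text \<open>The format is required at every point of the type, not only on matrix tuples, so that
  products, determinants and adjugates can be expanded into entries without a side condition on the
  point.\<close>

definition polynomial_mats :: "('a \<Rightarrow> complex) set \<Rightarrow> nat \<Rightarrow> nat \<Rightarrow> ('a \<Rightarrow> complex mat) set" where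
  "polynomial_mats \<Gamma> r c = {M. (\<forall>x. M x \<in> carrier_mat r c) \<and>
     (\<forall>i<r. \<forall>j<c. (\<lambda>x. M x $$ (i,j)) \<in> polynomial_functions \<Gamma>)}"

lemma polynomial_matsI:
  assumes "\<And>x. M x \<in> carrier_mat r c"
    "\<And>i j. i < r \<Longrightarrow> j < c \<Longrightarrow> (\<lambda>x. M x $$ (i,j)) \<in> polynomial_functions \<Gamma>"
  shows "M \<in> polynomial_mats \<Gamma> r c"
  using assms unfolding polynomial_mats_def by auto

lemma polynomial_matsD:
  assumes "M \<in> polynomial_mats \<Gamma> r c"
  shows "M x \<in> carrier_mat r c" "dim_row (M x) = r" "dim_col (M x) = c"
    "i < r \<Longrightarrow> j < c \<Longrightarrow> (\<lambda>x. M x $$ (i,j)) \<in> polynomial_functions \<Gamma>"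
proof -
  show "M x \<in> carrier_mat r c" using assms unfolding polynomial_mats_def by auto
  then show "dim_row (M x) = r" "dim_col (M x) = c" by auto
  show "i < r \<Longrightarrow> j < c \<Longrightarrow> (\<lambda>x. M x $$ (i,j)) \<in> polynomial_functions \<Gamma>"
    using assms unfolding polynomial_mats_def by auto
qed

lemma index_mult_mat_sum:
  assumes "A \<in> carrier_mat r m" "B \<in> carrier_mat m c" "i < r" "j < c"
  shows "(A * B) $$ (i,j) = (\<Sum>k<m. A $$ (i,k) * B $$ (k,j))"
  using assms by (auto simp: scalar_prod_def atLeast0LessThan intro!: sum.cong)

lemma polynomial_mats_const:
  assumes "M \<in> carrier_mat r c"
  shows "(\<lambda>x. M) \<in> polynomial_mats \<Gamma> r c"
  using assms by (intro polynomial_matsI polynomial_functions.const)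

lemma polynomial_mats_mult:
  assumes M: "M \<in> polynomial_mats \<Gamma> r m" and N: "N \<in> polynomial_mats \<Gamma> m c"
  shows "(\<lambda>x. M x * N x) \<in> polynomial_mats \<Gamma> r c"
proof (rule polynomial_matsI)
  show "M x * N x \<in> carrier_mat r c" for x
    by (rule mult_carrier_mat[OF polynomial_matsD(1)[OF M] polynomial_matsD(1)[OF N]])
next
  fix i j assume "i < r" "j < c"
  then have "(\<lambda>x. (M x * N x) $$ (i,j)) = (\<lambda>x. \<Sum>k<m. M x $$ (i,k) * N x $$ (k,j))"
    using index_mult_mat_sum[OF polynomial_matsD(1)[OF M] polynomial_matsD(1)[OF N]] by auto
  also have "\<dots> \<in> polynomial_functions \<Gamma>"
    using \<open>i < r\<close> \<open>j < c\<close> polynomial_matsD(4)[OF M] polynomial_matsD(4)[OF N]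
    by (intro polynomial_functions_sum polynomial_functions.mult) auto
  finally show "(\<lambda>x. (M x * N x) $$ (i,j)) \<in> polynomial_functions \<Gamma>" .
qed

lemma polynomial_mats_add:
  assumes M: "M \<in> polynomial_mats \<Gamma> r c" and N: "N \<in> polynomial_mats \<Gamma> r c"
  shows "(\<lambda>x. M x + N x) \<in> polynomial_mats \<Gamma> r c"
  using polynomial_matsD[OF M] polynomial_matsD[OF N]
  by (intro polynomial_matsI) (auto intro!: polynomial_functions.add)

lemma polynomial_mats_smult:
  assumes f: "f \<in> polynomial_functions \<Gamma>" and N: "N \<in> polynomial_mats \<Gamma> r c"
  shows "(\<lambda>x. f x \<cdot>\<^sub>m N x) \<in> polynomial_mats \<Gamma> r c"
  using f polynomial_matsD[OF N]
  by (intro polynomial_matsI) (auto intro!: polynomial_functions.mult)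

lemma polynomial_functions_det:
  assumes M: "M \<in> polynomial_mats \<Gamma> r r"
  shows "(\<lambda>x. det (M x)) \<in> polynomial_functions \<Gamma>"
proof -
  have "(\<lambda>x. det (M x)) =
      (\<lambda>x. \<Sum>p | p permutes {0..<r}. signof p * (\<Prod>i = 0..<r. M x $$ (i, p i)))"
    using det_def'[OF polynomial_matsD(1)[OF M]] by auto
  also have "\<dots> \<in> polynomial_functions \<Gamma>"
    using polynomial_matsD(4)[OF M]
    by (intro polynomial_functions_sum polynomial_functions.mult polynomial_functions.const
        polynomial_functions_prod) (auto dest: permutes_in_image)
  finally show ?thesis .
qed

lemma polynomial_mats_adj_mat:
  assumes M: "M \<in> polynomial_mats \<Gamma> r r"
  shows "(\<lambda>x. adj_mat (M x)) \<in> polynomial_mats \<Gamma> r r"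
proof (rule polynomial_matsI)
  show "adj_mat (M x) \<in> carrier_mat r r" for x
    by (rule adj_mat(1)[OF polynomial_matsD(1)[OF M]])
next
  fix i j assume ij: "i < r" "j < r"
  have del: "(\<lambda>x. mat_delete (M x) j i) \<in> polynomial_mats \<Gamma> (r - 1) (r - 1)"
  proof (rule polynomial_matsI)
    show "mat_delete (M x) j i \<in> carrier_mat (r - 1) (r - 1)" for x
      by (rule mat_delete_carrier[OF polynomial_matsD(1)[OF M]])
  next
    fix a b assume ab: "a < r - 1" "b < r - 1"
    then have "(\<lambda>x. mat_delete (M x) j i $$ (a,b)) =
      (\<lambda>x. M x $$ (if a < j then a else Suc a, if b < i then b else Suc b))"
      using polynomial_matsD(2,3)[OF M] by (auto simp: mat_delete_def)
    also have "\<dots> \<in> polynomial_functions \<Gamma>"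
      using ab by (intro polynomial_matsD(4)[OF M]) auto
    finally show "(\<lambda>x. mat_delete (M x) j i $$ (a,b)) \<in> polynomial_functions \<Gamma>" .
  qed
  have "(\<lambda>x. adj_mat (M x) $$ (i,j)) = (\<lambda>x. (-1)^(j + i) * det (mat_delete (M x) j i))"
    using ij polynomial_matsD(2,3)[OF M] by (auto simp: adj_mat_def cofactor_def)
  also have "\<dots> \<in> polynomial_functions \<Gamma>"
    by (intro polynomial_functions.mult polynomial_functions.const polynomial_functions_det[OF del])
  finally show "(\<lambda>x. adj_mat (M x) $$ (i,j)) \<in> polynomial_functions \<Gamma>" .
qed

text \<open>Arguments along a curve with parameter t end here: for \<open>poly\<close> it is known
  that nonzero polynomials have finitely many roots and nonzero products.\<close>

lemma polynomial_functions_id_poly: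
  assumes "f \<in> polynomial_functions {\<lambda>t. t}"
  shows "\<exists>q. f = poly q"
  using assms
proof induction
  case (const c)
  show ?case by (rule exI[of _ "[:c:]"]) auto
next
  case (coord f)
  then show ?case by (intro exI[of _ "[:0,1:]"]) auto
next
  case (add f g)
  then obtain q r where "f = poly q" "g = poly r" by auto
  then show ?case by (intro exI[of _ "q + r"]) auto
next
  case (mult f g)
  then obtain q r where "f = poly q" "g = poly r" by auto
  then show ?case by (intro exI[of _ "q * r"]) auto
qed

section \<open>Simultaneous conjugation\<close>

abbreviation minv :: "nat \<Rightarrow> complex mat \<Rightarrow> complex mat" where
  "minv p g \<equiv> inv\<^bsub>mat_alg p\<^esub> g"

lemma GL_carrier: "g \<in> GL p \<Longrightarrow> g \<in> carrier_mat p p"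
  unfolding GL_def Units_def by (auto simp: ring_mat_simps)

text \<open>A right inverse of a square matrix over a field is two-sided, so a single equation
  yields invertibility of both factors and identifies the inverse.\<close>

lemma GL_I:
  assumes g: "g \<in> carrier_mat p p" and h: "h \<in> carrier_mat p p" and gh: "g * h = 1\<^sub>m p"
  shows "g \<in> GL p" "h \<in> GL p" "minv p g = h"
proof -
  have hg: "h * g = 1\<^sub>m p"
    by (rule mat_mult_left_right_inverse[OF g h gh])
  then show "g \<in> GL p" "h \<in> GL p"
    using assms unfolding GL_def Units_def by (auto simp: ring_mat_simps)
  interpret ring "mat_alg p" by (rule ring_mat)
  show "minv p g = h"
    using assms hg by (intro inv_unique'[symmetric]) (auto simp: ring_mat_simps)
qed

lemma GL_minv:
  assumes "g \<in> GL p"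
  shows "minv p g \<in> carrier_mat p p" "g * minv p g = 1\<^sub>m p" "minv p g * g = 1\<^sub>m p" "minv p g \<in> GL p"
proof -
  interpret ring "mat_alg p" by (rule ring_mat)
  have u: "g \<in> Units (mat_alg p)" using assms unfolding GL_def .
  show "minv p g \<in> carrier_mat p p" using Units_inv_closed[OF u] by (simp add: ring_mat_simps)
  show "g * minv p g = 1\<^sub>m p" using Units_r_inv[OF u] by (simp add: ring_mat_simps)
  show "minv p g * g = 1\<^sub>m p" using Units_l_inv[OF u] by (simp add: ring_mat_simps)
  show "minv p g \<in> GL p" using Units_inv_Units[OF u] unfolding GL_def .
qed

lemma GL_det: "g \<in> GL p \<longleftrightarrow> g \<in> carrier_mat p p \<and> det g \<noteq> 0"
  using unit_imp_det_non_zero[of g p "()"] det_non_zero_imp_unit[of g p "()"] GL_carrier[of g p]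
  unfolding GL_def by auto

lemma minv_minv: "g \<in> GL p \<Longrightarrow> minv p (minv p g) = g"
  using GL_I(3)[OF GL_minv(1) GL_carrier GL_minv(3)] by blast

text \<open>Cramer's rule. It exhibits the inverse as a polynomial matrix over the determinant,
  which makes conjugation along a polynomial curve of matrices rational in the parameter.\<close>

lemma minv_adj_mat:
  assumes "g \<in> GL p"
  shows "minv p g = inverse (det g) \<cdot>\<^sub>m adj_mat g"
proof (rule GL_I(3))
  have g: "g \<in> carrier_mat p p" and d: "det g \<noteq> 0" using assms GL_det by auto
  show "g \<in> carrier_mat p p" "inverse (det g) \<cdot>\<^sub>m adj_mat g \<in> carrier_mat p p"
    using g adj_mat(1)[OF g] by auto
  show "g * (inverse (det g) \<cdot>\<^sub>m adj_mat g) = 1\<^sub>m p"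
    using g adj_mat(1,2)[OF g] d by (simp add: mult_smult_distrib[OF g]) (auto intro: eq_matI)
qed

lemma mult3_carrier: fixes A B C :: "complex mat" shows
  "A \<in> carrier_mat a b \<Longrightarrow> B \<in> carrier_mat b c \<Longrightarrow> C \<in> carrier_mat c d \<Longrightarrow> A * B * C \<in> carrier_mat a d"
  by (meson mult_carrier_mat)

lemma conj_mult:
  fixes g h A B :: "complex mat"
  assumes g: "g \<in> carrier_mat p p" and h: "h \<in> carrier_mat p p" and hg: "h * g = 1\<^sub>m p"
    and A: "A \<in> carrier_mat p p" and B: "B \<in> carrier_mat p p"
  shows "(g * A * h) * (g * B * h) = g * (A * B) * h"
proof -
  have "(g * A * h) * (g * B * h) = g * A * (h * (g * B * h))"
    using g h A B by (intro assoc_mult_mat) (auto intro!: mult_carrier_mat)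
  also have "h * (g * B * h) = (h * g) * B * h"
    using g h A B by (simp add: assoc_mult_mat[of _ p p _ p _ p])
  also have "\<dots> = B * h" using hg left_mult_one_mat[OF B] by simp
  also have "g * A * (B * h) = g * (A * B) * h"
    using g h A B by (simp add: assoc_mult_mat[of _ p p _ p _ p])
  finally show ?thesis .
qed

lemma GL_mult:
  assumes g: "g \<in> GL p" and h: "h \<in> GL p"
  shows "g * h \<in> GL p" "minv p (g * h) = minv p h * minv p g"
proof -
  note c = GL_carrier[OF g] GL_carrier[OF h] GL_minv(1)[OF g] GL_minv(1)[OF h]
  have "g * h * (minv p h * minv p g) = g * (h * minv p h) * minv p g"
    using c by (simp add: assoc_mult_mat[of _ p p _ p _ p])
  also have "\<dots> = 1\<^sub>m p" using c by (simp add: GL_minv(2)[OF h] GL_minv(2)[OF g])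
  finally have e: "g * h * (minv p h * minv p g) = 1\<^sub>m p" .
  show "g * h \<in> GL p" "minv p (g * h) = minv p h * minv p g"
    using GL_I[OF _ _ e] c by auto
qed

lemma mat_tuplesD:
  assumes "A \<in> mat_tuples p n"
  shows "length A = n" "l < n \<Longrightarrow> A ! l \<in> carrier_mat p p"
  using assms unfolding mat_tuples_def by (auto dest: nth_mem)

lemma mat_tuplesI:
  assumes "length A = n" "\<And>l. l < n \<Longrightarrow> A ! l \<in> carrier_mat p p"
  shows "A \<in> mat_tuples p n"
  using assms unfolding mat_tuples_def by (auto simp: in_set_conv_nth)

lemma conj_act_nth:
  "l < length A \<Longrightarrow> conj_act p g A ! l = g * (A ! l) * minv p g"
  unfolding conj_act_def by simp

lemma length_conj_act [simp]: "length (conj_act p g A) = length A"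
  unfolding conj_act_def by simp

lemma conj_act_closed:
  assumes "g \<in> GL p" "A \<in> mat_tuples p n"
  shows "conj_act p g A \<in> mat_tuples p n"
  using mat_tuplesD[OF assms(2)] GL_carrier[OF assms(1)] GL_minv(1)[OF assms(1)]
  by (intro mat_tuplesI) (auto simp: conj_act_nth intro!: mult3_carrier)

lemma conj_act_conj_act:
  assumes g: "g \<in> GL p" and h: "h \<in> GL p" and A: "A \<in> mat_tuples p n"
  shows "conj_act p g (conj_act p h A) = conj_act p (g * h) A"
proof (rule nth_equalityI)
  fix l assume "l < length (conj_act p g (conj_act p h A))"
  then have l: "l < length A" "l < n" using mat_tuplesD(1)[OF A] by auto
  note c = GL_carrier[OF g] GL_carrier[OF h] GL_minv(1)[OF g] GL_minv(1)[OF h] mat_tuplesD(2)[OF A l(2)]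
  show "conj_act p g (conj_act p h A) ! l = conj_act p (g * h) A ! l"
    using l c by (simp add: conj_act_nth GL_mult(2)[OF g h] assoc_mult_mat[of _ p p _ p _ p])
qed simp

lemma conj_act_one:
  assumes A: "A \<in> mat_tuples p n"
  shows "conj_act p (1\<^sub>m p) A = A" "1\<^sub>m p \<in> GL p"
proof -
  have i: "1\<^sub>m p \<in> GL p" "minv p (1\<^sub>m p) = 1\<^sub>m p"
    using GL_I[of "1\<^sub>m p" p "1\<^sub>m p"] by auto
  then show "1\<^sub>m p \<in> GL p" by simp
  show "conj_act p (1\<^sub>m p) A = A"
  proof (rule nth_equalityI)
    fix l assume "l < length (conj_act p (1\<^sub>m p) A)"
    then show "conj_act p (1\<^sub>m p) A ! l = A ! l"
      using mat_tuplesD[OF A] i by (simp add: conj_act_nth left_mult_one_mat[of _ p p] right_mult_one_mat[of _ p p])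
  qed simp
qed

lemma conj_act_minv:
  assumes g: "g \<in> GL p" and A: "A \<in> mat_tuples p n"
  shows "conj_act p (minv p g) (conj_act p g A) = A" "conj_act p g (conj_act p (minv p g) A) = A"
  using conj_act_conj_act[OF GL_minv(4)[OF g] g A] conj_act_conj_act[OF g GL_minv(4)[OF g] A]
    GL_minv(2,3)[OF g] conj_act_one[OF A] by auto

section \<open>Block positions\<close>

definition start :: "nat list \<Rightarrow> nat \<Rightarrow> nat" where
  "start \<pi> a = sum_list (take a \<pi>)"

text \<open>The number of the block that contains position \<open>i\<close>. It is unspecified for
  \<open>i\<close> at least \<open>sum_list \<pi>\<close>, where no partial sum exceeds
  \<open>i\<close>.\<close>

definition blk :: "nat list \<Rightarrow> nat \<Rightarrow> nat" where
  "blk \<pi> i = (LEAST a. i < start \<pi> (Suc a))"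

lemma start_0 [simp]: "start \<pi> 0 = 0"
  unfolding start_def by simp

lemma start_Suc: "a < length \<pi> \<Longrightarrow> start \<pi> (Suc a) = start \<pi> a + \<pi> ! a"
  unfolding start_def by (simp add: take_Suc_conv_app_nth)

lemma start_length [simp]: "start \<pi> (length \<pi>) = sum_list \<pi>"
  unfolding start_def by simp

lemma start_mono: "a \<le> b \<Longrightarrow> start \<pi> a \<le> start \<pi> b"
proof -
  assume "a \<le> b"
  then have "take b \<pi> = take a \<pi> @ take (b - a) (drop a \<pi>)"
    by (metis le_add_diff_inverse take_add)
  then show ?thesis unfolding start_def by simp
qed

lemma blk_props:
  assumes "i < sum_list \<pi>"
  shows "blk \<pi> i < length \<pi>" "start \<pi> (blk \<pi> i) \<le> i" "i < start \<pi> (Suc (blk \<pi> i))"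
proof -
  have ne: "length \<pi> \<noteq> 0" using assms by auto
  have ex: "i < start \<pi> (Suc (length \<pi> - 1))" using assms ne by simp
  show 1: "i < start \<pi> (Suc (blk \<pi> i))"
    unfolding blk_def by (rule LeastI[of "\<lambda>a. i < start \<pi> (Suc a)", OF ex])
  have "blk \<pi> i \<le> length \<pi> - 1"
    unfolding blk_def by (rule Least_le[of "\<lambda>a. i < start \<pi> (Suc a)", OF ex])
  then show "blk \<pi> i < length \<pi>" using ne by linarith
  show "start \<pi> (blk \<pi> i) \<le> i"
  proof (cases "blk \<pi> i")
    case (Suc b)
    then have "b < blk \<pi> i" by simp
    then have "\<not> i < start \<pi> (Suc b)" unfolding blk_def by (rule not_less_Least)
    then show ?thesis using Suc by simp
  qed simp
qed

lemma blk_eqI: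
  assumes "start \<pi> a \<le> i" "i < start \<pi> (Suc a)"
  shows "blk \<pi> i = a"
  unfolding blk_def
proof (rule Least_equality)
  show "i < start \<pi> (Suc a)" by fact
  fix b assume "i < start \<pi> (Suc b)"
  then show "a \<le> b"
    using start_mono[of "Suc b" a \<pi>] assms(1) by (meson leD not_less_eq_eq order_trans)
qed

lemma blk_start:
  assumes "a < length \<pi>" "s < \<pi> ! a"
  shows "blk \<pi> (start \<pi> a + s) = a" "start \<pi> a + s < sum_list \<pi>"
proof -
  show "blk \<pi> (start \<pi> a + s) = a"
    using assms start_Suc[of a \<pi>] by (intro blk_eqI) auto
  show "start \<pi> a + s < sum_list \<pi>"
    using assms start_Suc[of a \<pi>] start_mono[of "Suc a" "length \<pi>" \<pi>] by auto
qed

lemma blk_offset: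
  assumes "i < sum_list \<pi>"
  shows "i - start \<pi> (blk \<pi> i) < \<pi> ! blk \<pi> i" "start \<pi> (blk \<pi> i) + (i - start \<pi> (blk \<pi> i)) = i"
  using blk_props[OF assms] start_Suc[of "blk \<pi> i" \<pi>] by auto

lemma blk_mono:
  assumes "i \<le> j" "j < sum_list \<pi>"
  shows "blk \<pi> i \<le> blk \<pi> j"
  unfolding blk_def[of \<pi> i]
  by (rule Least_le) (use assms blk_props(3)[of j \<pi>] in auto)

lemma sum_over_block:
  assumes "a < length \<pi>"
  shows "(\<Sum>r | r < sum_list \<pi> \<and> blk \<pi> r = a. f r) = (\<Sum>s<\<pi> ! a. f (start \<pi> a + s))"
proof (rule sum.reindex_bij_witness[of _ "\<lambda>s. start \<pi> a + s" "\<lambda>r. r - start \<pi> a"])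
  fix r assume "r \<in> {r. r < sum_list \<pi> \<and> blk \<pi> r = a}"
  then show "start \<pi> a + (r - start \<pi> a) = r" "r - start \<pi> a \<in> {..<\<pi> ! a}"
    "f (start \<pi> a + (r - start \<pi> a)) = f r"
    using blk_offset[of r \<pi>] by auto
qed (use blk_start[OF assms] in auto)

lemma sum_over_blocks:
  "(\<Sum>r<sum_list \<pi>. f r) = (\<Sum>a<length \<pi>. \<Sum>s<\<pi> ! a. f (start \<pi> a + s))"
proof -
  have "(\<Sum>r<sum_list \<pi>. f r) = (\<Sum>a<length \<pi>. \<Sum>r | r \<in> {..<sum_list \<pi>} \<and> blk \<pi> r = a. f r)"
    by (rule sum.group[symmetric]) (auto simp: blk_props)
  also have "\<dots> = (\<Sum>a<length \<pi>. \<Sum>s<\<pi> ! a. f (start \<pi> a + s))"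
    using sum_over_block[of _ \<pi> f] by (auto intro!: sum.cong[OF refl])
  finally show ?thesis .
qed

lemma block_carrier [simp]: "block \<pi> a b M \<in> carrier_mat (\<pi> ! a) (\<pi> ! b)"
  unfolding block_def by simp

lemma block_dims [simp]: "dim_row (block \<pi> a b M) = \<pi> ! a" "dim_col (block \<pi> a b M) = \<pi> ! b"
  unfolding block_def by simp_all

lemma index_block:
  "i < \<pi> ! a \<Longrightarrow> j < \<pi> ! b \<Longrightarrow> block \<pi> a b M $$ (i,j) = M $$ (start \<pi> a + i, start \<pi> b + j)"
  unfolding block_def start_def by simp

definition block_upper :: "nat list \<Rightarrow> complex mat \<Rightarrow> bool" where
  "block_upper \<pi> M \<longleftrightarrow> (\<forall>i<sum_list \<pi>. \<forall>j<sum_list \<pi>. blk \<pi> j < blk \<pi> i \<longrightarrow> M $$ (i,j) = 0)"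

lemma block_upper_iff:
  "block_upper \<pi> M \<longleftrightarrow> (\<forall>a < length \<pi>. \<forall>b < a. block \<pi> a b M = 0\<^sub>m (\<pi> ! a) (\<pi> ! b))"
proof
  assume u: "block_upper \<pi> M"
  show "\<forall>a < length \<pi>. \<forall>b < a. block \<pi> a b M = 0\<^sub>m (\<pi> ! a) (\<pi> ! b)"
  proof (intro allI impI eq_matI)
    fix a b i j assume "a < length \<pi>" "b < a" "i < dim_row (0\<^sub>m (\<pi> ! a) (\<pi> ! b))" "j < dim_col (0\<^sub>m (\<pi> ! a) (\<pi> ! b))"
    then show "block \<pi> a b M $$ (i,j) = 0\<^sub>m (\<pi> ! a) (\<pi> ! b) $$ (i,j)"
      using blk_start[of a \<pi> i] blk_start[of b \<pi> j] u unfolding block_upper_def by (simp add: index_block)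
  qed simp_all
next
  assume z: "\<forall>a < length \<pi>. \<forall>b < a. block \<pi> a b M = 0\<^sub>m (\<pi> ! a) (\<pi> ! b)"
  show "block_upper \<pi> M"
    unfolding block_upper_def
  proof (intro allI impI)
    fix i j assume ij: "i < sum_list \<pi>" "j < sum_list \<pi>" "blk \<pi> j < blk \<pi> i"
    have "block \<pi> (blk \<pi> i) (blk \<pi> j) M $$ (i - start \<pi> (blk \<pi> i), j - start \<pi> (blk \<pi> j)) = 0"
      using z ij blk_props(1)[OF ij(1)] blk_offset[OF ij(1)] blk_offset[OF ij(2)] by simp
    then show "M $$ (i,j) = 0"
      using blk_offset[OF ij(1)] blk_offset[OF ij(2)] by (simp add: index_block)
  qed
qed

lemma upper_tuples_iff:
  "A \<in> upper_tuples p n \<pi> \<longleftrightarrow> A \<in> mat_tuples p n \<and> (\<forall>l<n. block_upper \<pi> (A ! l))"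
  unfolding upper_tuples_def block_upper_iff[symmetric]
  by (auto simp: all_set_conv_all_nth mat_tuplesD(1))

lemma length_diag_blocks [simp]: "length (diag_blocks \<pi> i A) = length A"
  unfolding diag_blocks_def by simp

lemma diag_blocks_nth: "l < length A \<Longrightarrow> diag_blocks \<pi> i A ! l = block \<pi> i i (A ! l)"
  unfolding diag_blocks_def by simp

lemma diag_blocks_closed: "A \<in> mat_tuples p n \<Longrightarrow> diag_blocks \<pi> i A \<in> mat_tuples (\<pi> ! i) n"
  by (intro mat_tuplesI) (auto simp: diag_blocks_nth mat_tuplesD(1))

text \<open>In the sum for the entry (i,j) of the product only those r contribute whose block lies
  between the blocks of i and j. Below the diagonal there are none, and inside a diagonal block they
  are exactly that block, so passing to a diagonal block is multiplicative.\<close>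

lemma block_mult:
  assumes M: "M \<in> carrier_mat (sum_list \<pi>) (sum_list \<pi>)" "block_upper \<pi> M"
    and N: "N \<in> carrier_mat (sum_list \<pi>) (sum_list \<pi>)" "block_upper \<pi> N"
  shows "block_upper \<pi> (M * N)"
    "a < length \<pi> \<Longrightarrow> block \<pi> a a (M * N) = block \<pi> a a M * block \<pi> a a N"
proof -
  let ?p = "sum_list \<pi>"
  have idx: "(M * N) $$ (i,j) = (\<Sum>r | r < ?p \<and> blk \<pi> i \<le> blk \<pi> r \<and> blk \<pi> r \<le> blk \<pi> j. M $$ (i,r) * N $$ (r,j))"
    if ij: "i < ?p" "j < ?p" for i j
  proof -
    have "(M * N) $$ (i,j) = (\<Sum>r<?p. M $$ (i,r) * N $$ (r,j))"
      by (rule index_mult_mat_sum[OF M(1) N(1) ij])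
    also have "\<dots> = (\<Sum>r | r < ?p \<and> blk \<pi> i \<le> blk \<pi> r \<and> blk \<pi> r \<le> blk \<pi> j. M $$ (i,r) * N $$ (r,j))"
    proof (rule sum.mono_neutral_right)
      show "\<forall>r\<in>{..<?p} - {r. r < ?p \<and> blk \<pi> i \<le> blk \<pi> r \<and> blk \<pi> r \<le> blk \<pi> j}. M $$ (i,r) * N $$ (r,j) = 0"
        using M(2) N(2) ij unfolding block_upper_def by (metis (mono_tags, lifting) Diff_iff lessThan_iff mem_Collect_eq mult_zero_left mult_zero_right not_le)
    qed auto
    finally show ?thesis .
  qed
  show "block_upper \<pi> (M * N)"
    unfolding block_upper_def
  proof (intro allI impI)
    fix i j assume ij: "i < ?p" "j < ?p" "blk \<pi> j < blk \<pi> i"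
    then have "{r. r < ?p \<and> blk \<pi> i \<le> blk \<pi> r \<and> blk \<pi> r \<le> blk \<pi> j} = {}" by auto
    then show "(M * N) $$ (i,j) = 0" unfolding idx[OF ij(1,2)] by (simp only: sum.empty)
  qed
  assume a: "a < length \<pi>"
  show "block \<pi> a a (M * N) = block \<pi> a a M * block \<pi> a a N"
  proof (rule eq_matI)
    fix s t assume "s < dim_row (block \<pi> a a M * block \<pi> a a N)" "t < dim_col (block \<pi> a a M * block \<pi> a a N)"
    then have st: "s < \<pi> ! a" "t < \<pi> ! a" by auto
    have "block \<pi> a a (M * N) $$ (s,t) = (M * N) $$ (start \<pi> a + s, start \<pi> a + t)"
      using st by (simp add: index_block)
    also have "\<dots> = (\<Sum>r | r < ?p \<and> blk \<pi> r = a. M $$ (start \<pi> a + s,r) * N $$ (r,start \<pi> a + t))"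
      using blk_start[OF a st(1)] blk_start[OF a st(2)] idx by (auto intro!: sum.cong)
    also have "\<dots> = (\<Sum>r<\<pi> ! a. M $$ (start \<pi> a + s, start \<pi> a + r) * N $$ (start \<pi> a + r,start \<pi> a + t))"
      by (rule sum_over_block[OF a])
    also have "\<dots> = (block \<pi> a a M * block \<pi> a a N) $$ (s,t)"
      using st by (subst index_mult_mat_sum[OF block_carrier block_carrier]) (auto simp: index_block intro!: sum.cong)
    finally show "block \<pi> a a (M * N) $$ (s,t) = (block \<pi> a a M * block \<pi> a a N) $$ (s,t)" .
  qed simp_all
qed

lemma block_one: "a < length \<pi> \<Longrightarrow> block \<pi> a a (1\<^sub>m (sum_list \<pi>)) = 1\<^sub>m (\<pi> ! a)"
  by (rule eq_matI) (auto simp: index_block blk_start)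

definition block_diag :: "nat list \<Rightarrow> (nat \<Rightarrow> complex mat) \<Rightarrow> complex mat" where
  "block_diag \<pi> G = mat (sum_list \<pi>) (sum_list \<pi>) (\<lambda>(i,j). if blk \<pi> i = blk \<pi> j
     then G (blk \<pi> i) $$ (i - start \<pi> (blk \<pi> i), j - start \<pi> (blk \<pi> i)) else 0)"

lemma block_diag_props:
  shows "block_diag \<pi> G \<in> carrier_mat (sum_list \<pi>) (sum_list \<pi>)" "block_upper \<pi> (block_diag \<pi> G)"
    "a < length \<pi> \<Longrightarrow> G a \<in> carrier_mat (\<pi> ! a) (\<pi> ! a) \<Longrightarrow> block \<pi> a a (block_diag \<pi> G) = G a"
proof -
  show "block_diag \<pi> G \<in> carrier_mat (sum_list \<pi>) (sum_list \<pi>)"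
    unfolding block_diag_def by simp
  show "block_upper \<pi> (block_diag \<pi> G)"
    unfolding block_upper_def block_diag_def by auto
  assume "a < length \<pi>" "G a \<in> carrier_mat (\<pi> ! a) (\<pi> ! a)"
  then show "block \<pi> a a (block_diag \<pi> G) = G a"
    by (intro eq_matI) (auto simp: index_block blk_start block_diag_def)
qed

lemma block_diag_mult:
  assumes "\<And>a. a < length \<pi> \<Longrightarrow> G a \<in> carrier_mat (\<pi> ! a) (\<pi> ! a)"
    and "\<And>a. a < length \<pi> \<Longrightarrow> H a \<in> carrier_mat (\<pi> ! a) (\<pi> ! a)"
    and "\<And>a. a < length \<pi> \<Longrightarrow> G a * H a = 1\<^sub>m (\<pi> ! a)"
  shows "block_diag \<pi> G * block_diag \<pi> H = 1\<^sub>m (sum_list \<pi>)"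
proof (rule eq_matI)
  let ?p = "sum_list \<pi>"
  note GH = block_diag_props(1,2)[of \<pi> G] block_diag_props(1,2)[of \<pi> H]
  fix i j assume "i < dim_row (1\<^sub>m ?p)" "j < dim_col (1\<^sub>m ?p)"
  then have ij: "i < ?p" "j < ?p" by auto
  show "(block_diag \<pi> G * block_diag \<pi> H) $$ (i,j) = 1\<^sub>m ?p $$ (i,j)"
  proof (cases "blk \<pi> i = blk \<pi> j")
    case False
    have "(block_diag \<pi> G * block_diag \<pi> H) $$ (i,j) = (\<Sum>r<?p. block_diag \<pi> G $$ (i,r) * block_diag \<pi> H $$ (r,j))"
      by (rule index_mult_mat_sum[OF GH(1) GH(3) ij])
    also have "\<dots> = 0"
      using False ij by (intro sum.neutral) (auto simp: block_diag_def)
    finally show ?thesis using False ij by auto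
  next
    case True
    define a where "a = blk \<pi> i"
    have a: "a < length \<pi>" using blk_props(1)[OF ij(1)] a_def by simp
    have "block \<pi> a a (block_diag \<pi> G * block_diag \<pi> H) = 1\<^sub>m (\<pi> ! a)"
      using block_mult(2)[OF GH a] block_diag_props(3)[OF a, of G] block_diag_props(3)[OF a, of H] assms a by simp
    also have "\<dots> = block \<pi> a a (1\<^sub>m ?p)" using block_one[OF a] by simp
    finally have "block \<pi> a a (block_diag \<pi> G * block_diag \<pi> H) $$ (i - start \<pi> a, j - start \<pi> a) =
      block \<pi> a a (1\<^sub>m ?p) $$ (i - start \<pi> a, j - start \<pi> a)" by simp
    then show ?thesis
      using blk_offset[OF ij(1)] blk_offset[OF ij(2)] True a_def by (simp add: index_block)
  qed
qed (simp_all add: block_diag_def)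

text \<open>The element \<open>g\<close> is block diagonal, that is, it lies in the Levi subgroup of
  the parabolic of type \<open>\<pi>\<close>. It moves the diagonal blocks independently of each
  other without leaving \<open>upper_tuples\<close>.\<close>

lemma levi_conjugation:
  assumes A: "A \<in> upper_tuples p n \<pi>" and \<pi>: "sum_list \<pi> = p"
    and G: "\<And>a. a < length \<pi> \<Longrightarrow> G a \<in> GL (\<pi> ! a)"
  obtains g where "g \<in> GL p" "conj_act p g A \<in> upper_tuples p n \<pi>"
    "\<And>a. a < length \<pi> \<Longrightarrow> diag_blocks \<pi> a (conj_act p g A) = conj_act (\<pi> ! a) (G a) (diag_blocks \<pi> a A)"
proof
  define g where "g = block_diag \<pi> G"
  define h where "h = block_diag \<pi> (\<lambda>a. minv (\<pi> ! a) (G a))"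
  have gh: "g * h = 1\<^sub>m p"
    unfolding g_def h_def \<pi>[symmetric]
    by (rule block_diag_mult) (auto intro: G GL_carrier GL_minv)
  have c: "g \<in> carrier_mat p p" "h \<in> carrier_mat p p" and u: "block_upper \<pi> g" "block_upper \<pi> h"
    using block_diag_props(1,2)[of \<pi>] \<pi> unfolding g_def h_def by auto
  have bg: "block \<pi> a a g = G a" "block \<pi> a a h = minv (\<pi> ! a) (G a)" if "a < length \<pi>" for a
    using block_diag_props(3)[OF that] G[OF that] GL_carrier GL_minv(1) unfolding g_def h_def by auto
  show g: "g \<in> GL p" using GL_I(1)[OF c gh] .
  have inv: "minv p g = h" using GL_I(3)[OF c gh] .
  have A': "A \<in> mat_tuples p n" "\<And>l. l < n \<Longrightarrow> block_upper \<pi> (A ! l)"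
    using A upper_tuples_iff by auto
  have len: "length A = n" using mat_tuplesD(1)[OF A'(1)] .
  have main: "block_upper \<pi> (g * (A ! l) * h)"
    "a < length \<pi> \<Longrightarrow> block \<pi> a a (g * (A ! l) * h) = G a * block \<pi> a a (A ! l) * minv (\<pi> ! a) (G a)"
    if l: "l < n" for l a
  proof -
    have c1: "A ! l \<in> carrier_mat p p" "g * (A ! l) \<in> carrier_mat p p"
      using mat_tuplesD(2)[OF A'(1) l] c by auto
    note b1 = block_mult[of g \<pi> "A ! l", unfolded \<pi>, OF c(1) u(1) c1(1) A'(2)[OF l]]
    note b2 = block_mult[of "g * (A ! l)" \<pi> h, unfolded \<pi>, OF c1(2) b1(1) c(2) u(2)]
    show "block_upper \<pi> (g * (A ! l) * h)" by (rule b2(1))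
    show "a < length \<pi> \<Longrightarrow> block \<pi> a a (g * (A ! l) * h) = G a * block \<pi> a a (A ! l) * minv (\<pi> ! a) (G a)"
      using b1(2) b2(2) bg by simp
  qed
  show "conj_act p g A \<in> upper_tuples p n \<pi>"
    unfolding upper_tuples_iff using conj_act_closed[OF g A'(1)] main(1) len inv by (auto simp: conj_act_nth)
  fix a assume a: "a < length \<pi>"
  show "diag_blocks \<pi> a (conj_act p g A) = conj_act (\<pi> ! a) (G a) (diag_blocks \<pi> a A)"
    by (rule nth_equalityI) (use main(2)[OF _ a] len inv in \<open>auto simp: diag_blocks_nth conj_act_nth\<close>)
qed

section \<open>Simple representations of the free algebra and their characters\<close>

section \<open>Representations of the free algebra\<close>

text \<open>Noncommutative polynomials are kept as syntax: only their values at matrix tuples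
  matter, so different expressions for one element never have to be identified.\<close>

datatype nc = NConst complex | NVar nat | NAdd nc nc | NMul nc nc

text \<open>The variable case goes through \<^const>\<open>mat\<close> so that the value is a \<open>q \<times> q\<close> matrix, with
  polynomial entries, for every list \<open>A\<close> whatsoever.\<close>

fun ev :: "nat \<Rightarrow> nat \<Rightarrow> complex mat list \<Rightarrow> nc \<Rightarrow> complex mat" where
  "ev n q A (NConst c) = c \<cdot>\<^sub>m 1\<^sub>m q"
| "ev n q A (NVar l) = (if l < n then mat q q (\<lambda>(i,j). (A ! l) $$ (i,j)) else 0\<^sub>m q q)"
| "ev n q A (NAdd e f) = ev n q A e + ev n q A f"
| "ev n q A (NMul e f) = ev n q A e * ev n q A f"

lemma ev_carrier [simp]: "ev n q A e \<in> carrier_mat q q"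
  by (induction e) auto

lemma ev_dims [simp]: "dim_row (ev n q A e) = q" "dim_col (ev n q A e) = q"
  using ev_carrier[of n q A e] by blast+

lemma ev_NVar:
  assumes "A \<in> mat_tuples q n" "l < n"
  shows "ev n q A (NVar l) = A ! l"
  using mat_tuplesD(2)[OF assms] assms(2) by (auto intro!: eq_matI)

lemma conj_smult_one:
  assumes "g \<in> GL q"
  shows "g * (c \<cdot>\<^sub>m 1\<^sub>m q) * minv q g = c \<cdot>\<^sub>m 1\<^sub>m q"
proof -
  note gc = GL_carrier[OF assms] GL_minv[OF assms]
  have "g * (c \<cdot>\<^sub>m 1\<^sub>m q) = c \<cdot>\<^sub>m g"
    using mult_smult_distrib[OF gc(1), of "1\<^sub>m q" q c] right_mult_one_mat[OF gc(1)] by simp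
  then show ?thesis using mult_smult_assoc_mat[OF gc(1,2), of c] gc(3) by simp
qed

lemma ev_conj_act:
  assumes g: "g \<in> GL q" and A: "A \<in> mat_tuples q n"
  shows "ev n q (conj_act q g A) e = g * ev n q A e * minv q g"
proof (induction e)
  case (NConst c)
  then show ?case using conj_smult_one[OF g] by simp
next
  case (NVar l)
  show ?case
  proof (cases "l < n")
    case True
    then show ?thesis
      using ev_NVar[OF A True] ev_NVar[OF conj_act_closed[OF g A] True] conj_act_nth[of l A q g] mat_tuplesD(1)[OF A]
      by simp
  next
    case False
    then show ?thesis using GL_carrier[OF g] GL_minv(1)[OF g] by simp
  qed
next
  case (NAdd e f)
  note c = GL_carrier[OF g] GL_minv(1)[OF g]
  show ?case
    using NAdd mult_add_distrib_mat[OF c(1) ev_carrier[of n q A e] ev_carrier[of n q A f]]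
      add_mult_distrib_mat[OF mult_carrier_mat[OF c(1) ev_carrier[of n q A e]] mult_carrier_mat[OF c(1) ev_carrier[of n q A f]] c(2)]
    by simp
next
  case (NMul e f)
  then show ?case
    using conj_mult[OF GL_carrier[OF g] GL_minv(1,3)[OF g] ev_carrier ev_carrier] by simp
qed

text \<open>The generators are block triangular, and sums and products preserve this while acting
  blockwise on the diagonal. Hence the trace of any expression splits into its traces on the
  subquotients of the flag.\<close>

lemma ev_block:
  assumes A: "A \<in> upper_tuples p n \<pi>" and p: "sum_list \<pi> = p"
  shows "block_upper \<pi> (ev n p A e) \<and>
    (\<forall>a<length \<pi>. block \<pi> a a (ev n p A e) = ev n (\<pi> ! a) (diag_blocks \<pi> a A) e)"
proof (induction e)
  case (NConst c)
  show ?case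
    unfolding p[symmetric] by (auto simp: block_upper_def index_block blk_start intro!: eq_matI)
next
  case (NVar l)
  have A': "A \<in> mat_tuples p n" "\<And>l. l < n \<Longrightarrow> block_upper \<pi> (A ! l)"
    using A upper_tuples_iff by auto
  show ?case
  proof (cases "l < n")
    case True
    then show ?thesis
      using ev_NVar[OF A'(1) True] ev_NVar[OF diag_blocks_closed[OF A'(1)] True] A'(2)
        diag_blocks_nth[of l A \<pi>] mat_tuplesD(1)[OF A'(1)] by (simp del: ev.simps)
  next
    case False
    then show ?thesis
      unfolding p[symmetric] by (auto simp: block_upper_def index_block blk_start intro!: eq_matI)
  qed
next
  case (NAdd e f)
  have i: "(M + N) $$ (i,j) = M $$ (i,j) + N $$ (i,j)" if "i < p" "j < p" "N \<in> carrier_mat p p" for M N :: "complex mat" and i j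
    using that by auto
  have "block \<pi> a a (ev n p A e + ev n p A f) = block \<pi> a a (ev n p A e) + block \<pi> a a (ev n p A f)"
    if "a < length \<pi>" for a
    using blk_start(2)[OF that] p by (intro eq_matI) (auto simp: index_block i)
  then show ?case
    using NAdd p by (auto simp: block_upper_def i)
next
  case (NMul e f)
  then show ?case
    using block_mult[of "ev n p A e" \<pi> "ev n p A f"] p by auto
qed

definition mtr :: "complex mat \<Rightarrow> complex" where
  "mtr M = (\<Sum>i<dim_row M. M $$ (i,i))"

lemma mtr_mult_comm:
  assumes "M \<in> carrier_mat r c" "N \<in> carrier_mat c r"
  shows "mtr (M * N) = mtr (N * M)"
proof -
  have "mtr (M * N) = (\<Sum>i<r. \<Sum>k<c. M $$ (i,k) * N $$ (k,i))"
    unfolding mtr_def using assms by (auto simp: index_mult_mat_sum[OF assms] simp del: index_mult_mat(1) intro!: sum.cong)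
  also have "\<dots> = (\<Sum>k<c. \<Sum>i<r. N $$ (k,i) * M $$ (i,k))"
    by (subst sum.swap) (simp add: mult.commute)
  also have "\<dots> = mtr (N * M)"
    unfolding mtr_def using assms by (auto simp: index_mult_mat_sum[OF assms(2,1)] simp del: index_mult_mat(1) intro!: sum.cong)
  finally show ?thesis .
qed

lemma mtr_one: "mtr (1\<^sub>m q) = of_nat q"
  unfolding mtr_def by simp

lemma mtr_conj:
  assumes g: "g \<in> GL q" and M: "M \<in> carrier_mat q q"
  shows "mtr (g * M * minv q g) = mtr M"
proof -
  note c = GL_carrier[OF g] GL_minv[OF g]
  have "mtr (g * M * minv q g) = mtr (minv q g * (g * M))"
    using c M by (intro mtr_mult_comm[of _ q q]) auto
  also have "minv q g * (g * M) = M"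
    using c M by (simp add: assoc_mult_mat[of _ q q _ q _ q, symmetric])
  finally show ?thesis .
qed

lemma mtr_blocks:
  assumes "M \<in> carrier_mat (sum_list \<pi>) (sum_list \<pi>)"
  shows "mtr M = (\<Sum>a<length \<pi>. mtr (block \<pi> a a M))"
  using assms unfolding mtr_def by (simp add: sum_over_blocks index_block)

lemma ev_polynomial: "(\<lambda>A. ev n q A e) \<in> polynomial_mats (coords q n) q q"
proof (induction e)
  case (NVar l)
  show ?case
  proof (cases "l < n")
    case True
    have "(\<lambda>A. (A ! l) $$ (i,j)) \<in> coords q n" if "i < q" "j < q" for i j
      unfolding coords_def using that True by blast
    then show ?thesis
      using True by (intro polynomial_matsI) (auto intro: polynomial_functions.coord)
  next
    case False
    then show ?thesis by (auto intro: polynomial_mats_const)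
  qed
qed (auto intro: polynomial_mats_const polynomial_mats_add polynomial_mats_mult)

lemma trace_invariant: "(\<lambda>A. mtr (ev n p A e)) \<in> invariants p n"
proof -
  have "(\<lambda>A. mtr (ev n p A e)) \<in> polynomial_functions (coords p n)"
    unfolding mtr_def using polynomial_matsD(4)[OF ev_polynomial] by (auto intro: polynomial_functions_sum)
  then show ?thesis
    unfolding invariants_def by (auto simp: ev_conj_act mtr_conj)
qed

section \<open>Composition series\<close>

text \<open>Irreducibility in the form that every nonzero vector is cyclic, which is equivalent to
  the absence of proper nonzero invariant subspaces. It hands out expressions with prescribed effect
  on a vector, which is how irreducibility is used throughout.\<close>

definition irr :: "nat \<Rightarrow> nat \<Rightarrow> complex mat list \<Rightarrow> bool" where
  "irr n q A \<longleftrightarrow> 0 < q \<and> A \<in> mat_tuples q n \<and>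
    (\<forall>v\<in>carrier_vec q. v \<noteq> 0\<^sub>v q \<longrightarrow> (\<forall>x\<in>carrier_vec q. \<exists>e. ev n q A e *\<^sub>v v = x))"

lemma irrD:
  assumes "irr n q A"
  shows "0 < q" "A \<in> mat_tuples q n"
    "v \<in> carrier_vec q \<Longrightarrow> v \<noteq> 0\<^sub>v q \<Longrightarrow> x \<in> carrier_vec q \<Longrightarrow> \<exists>e. ev n q A e *\<^sub>v v = x"
  using assms unfolding irr_def by auto

lemma ev_vec_closed [simp]: "v \<in> carrier_vec q \<Longrightarrow> ev n q A e *\<^sub>v v \<in> carrier_vec q"
  by (rule mult_mat_vec_carrier[OF ev_carrier])

lemma ev_NMul_vec: "v \<in> carrier_vec q \<Longrightarrow> ev n q A (NMul e f) *\<^sub>v v = ev n q A e *\<^sub>v (ev n q A f *\<^sub>v v)"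
  using assoc_mult_mat_vec[OF ev_carrier ev_carrier] by simp

lemma ev_NAdd_vec: "v \<in> carrier_vec q \<Longrightarrow> ev n q A (NAdd e f) *\<^sub>v v = ev n q A e *\<^sub>v v + ev n q A f *\<^sub>v v"
  using add_mult_distrib_mat_vec[OF ev_carrier ev_carrier] by simp

lemma ev_NConst_vec: "v \<in> carrier_vec q \<Longrightarrow> ev n q A (NConst c) *\<^sub>v v = c \<cdot>\<^sub>v v"
  by (intro eq_vecI) auto

declare ev.simps [simp del]

lemma mult_mat_vec_sum:
  assumes "M \<in> carrier_mat r c" "v \<in> carrier_vec c" "i < r"
  shows "(M *\<^sub>v v) $ i = (\<Sum>j<c. M $$ (i,j) * v $ j)"
  using assms by (auto simp: scalar_prod_def atLeast0LessThan intro!: sum.cong)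

lemma mult_unit_vec:
  fixes M :: "complex mat"
  assumes "M \<in> carrier_mat r c" "i < r" "j < c"
  shows "(M *\<^sub>v unit_vec c j) $ i = M $$ (i,j)"
  using assms by (simp add: scalar_prod_right_unit)

lemma mat_eq_by_vec:
  fixes M N :: "complex mat"
  assumes "M \<in> carrier_mat r c" "N \<in> carrier_mat r c"
    and "\<And>v. v \<in> carrier_vec c \<Longrightarrow> M *\<^sub>v v = N *\<^sub>v v"
  shows "M = N"
proof (rule eq_matI)
  fix i j assume "i < dim_row N" "j < dim_col N"
  then have ij: "i < r" "j < c" using assms by auto
  have "M $$ (i,j) = (M *\<^sub>v unit_vec c j) $ i" by (rule mult_unit_vec[OF assms(1) ij, symmetric])
  also have "\<dots> = (N *\<^sub>v unit_vec c j) $ i" using assms(3) by simp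
  also have "\<dots> = N $$ (i,j)" by (rule mult_unit_vec[OF assms(2) ij])
  finally show "M $$ (i,j) = N $$ (i,j)" .
qed (use assms in auto)

text \<open>Choose \<open>g\<close> so that \<open>g\<^sup>-\<^sup>1\<close> sends as many initial unit vectors as possible into \<open>W\<close>: a vector of
  \<open>W\<close> with a further nonzero coordinate could replace the next basis vector.\<close>

lemma subspace_adapted_basis:
  assumes W: "W \<subseteq> carrier_vec q"
  obtains g r where "g \<in> GL q" "r \<le> q" "\<And>j. j < r \<Longrightarrow> minv q g *\<^sub>v unit_vec q j \<in> W"
    "\<And>x i. x \<in> W \<Longrightarrow> r \<le> i \<Longrightarrow> i < q \<Longrightarrow> (g *\<^sub>v x) $ i = 0"
proof -
  define Q where "Q r \<longleftrightarrow> r \<le> q \<and> (\<exists>g\<in>GL q. \<forall>j<r. minv q g *\<^sub>v unit_vec q j \<in> W)" for r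
  have "1\<^sub>m q \<in> GL q" using GL_I(1)[of "1\<^sub>m q" q "1\<^sub>m q"] by simp
  then have Q0: "Q 0" unfolding Q_def by auto
  have "\<exists>r. Q r \<and> (\<forall>s. Q s \<longrightarrow> s \<le> r)"
    by (rule Nat.ex_has_greatest_nat[of Q 0 q, OF Q0]) (auto simp: Q_def)
  then obtain r where r: "Q r" "\<And>s. Q s \<Longrightarrow> s \<le> r" by auto
  then obtain g where g: "g \<in> GL q" "r \<le> q" "\<And>j. j < r \<Longrightarrow> minv q g *\<^sub>v unit_vec q j \<in> W"
    unfolding Q_def by auto
  note c = GL_carrier[OF g(1)] GL_minv[OF g(1)]
  have "(g *\<^sub>v x) $ k = 0" if x: "x \<in> W" and k: "r \<le> k" "k < q" for x k
  proof (rule ccontr)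
    assume nz: "(g *\<^sub>v x) $ k \<noteq> 0"
    define u where "u = g *\<^sub>v x"
    have xc: "x \<in> carrier_vec q" using x W by auto
    have uc: "u \<in> carrier_vec q" unfolding u_def using c xc by auto
    \<comment> \<open>\<open>P\<close> has \<open>u\<close> as column \<open>r\<close>. Its other
      columns are unit vectors: those before \<open>r\<close> stay in place, the vector with number
      \<open>k\<close> is left out, and the one with number \<open>r\<close>, if different, moves to
      column \<open>k\<close>. As \<open>u\<close> has a nonzero coordinate at \<open>k\<close>,
      this is again a basis.\<close>
    define s where "s i = (if i = k then r else if i = r then k else i)" for i
    have ss: "s (s i) = i" for i unfolding s_def by auto
    have sq: "i < q \<Longrightarrow> s i < q" for i unfolding s_def using k by auto
    define P where "P = mat q q (\<lambda>(i,j). if j = r then u $ i else if i = s j then 1 else 0)"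
    have Pc: "P \<in> carrier_mat q q" unfolding P_def by simp
    have Pe: "P $$ (i,j) = (if j = r then u $ i else if i = s j then 1 else 0)" if "i < q" "j < q" for i j
      using that unfolding P_def by simp
    have "det P \<noteq> 0"
    proof
      assume "det P = 0"
      then obtain z where z: "z \<in> carrier_vec q" "z \<noteq> 0\<^sub>v q" "P *\<^sub>v z = 0\<^sub>v q"
        using det_0_iff_vec_prod_zero[OF Pc] by auto
      have eq: "(\<Sum>j<q. P $$ (i,j) * z $ j) = 0" if "i < q" for i
        using mult_mat_vec_sum[OF Pc z(1) that] z(3) that by simp
      have "(\<Sum>j<q. P $$ (k,j) * z $ j) = (\<Sum>j\<in>{r}. P $$ (k,j) * z $ j)"
        using k by (intro sum.mono_neutral_right) (auto simp: P_def s_def split: if_splits)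
      then have zr: "z $ r = 0" using eq[OF k(2)] nz k by (simp add: P_def u_def)
      have "z $ i = 0" if i: "i < q" for i
      proof -
        have "(\<Sum>j<q. P $$ (s i,j) * z $ j) = (\<Sum>j\<in>{i}. P $$ (s i,j) * z $ j)"
        proof (rule sum.mono_neutral_right)
          show "\<forall>j\<in>{..<q} - {i}. P $$ (s i, j) * z $ j = 0"
          proof
            fix j assume j: "j \<in> {..<q} - {i}"
            have "s i \<noteq> s j" using ss[of i] ss[of j] j by auto
            then show "P $$ (s i, j) * z $ j = 0" using j sq[OF i] zr by (auto simp: P_def)
          qed
        qed (use i in auto)
        moreover have "P $$ (s i, i) = 1" if "i \<noteq> r" using that i sq[OF i] by (simp add: P_def)
        ultimately show ?thesis using eq[OF sq[OF i]] zr by (cases "i = r") auto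
      qed
      then have "z = 0\<^sub>v q" using z(1) by auto
      then show False using z(2) by simp
    qed
    then have P: "P \<in> GL q" using GL_det Pc by auto
    note h = GL_mult[OF GL_minv(4)[OF P] g(1)]
    have hi: "minv q (minv q P * g) = minv q g * P"
      using h(2) minv_minv[OF P] by simp
    have "minv q (minv q P * g) *\<^sub>v unit_vec q j \<in> W" if j: "j < Suc r" for j
    proof -
      have jq: "j < q" using j k by simp
      have "minv q (minv q P * g) *\<^sub>v unit_vec q j = minv q g *\<^sub>v (P *\<^sub>v unit_vec q j)"
        unfolding hi using c Pc by (intro assoc_mult_mat_vec) auto
      moreover have "minv q g *\<^sub>v (P *\<^sub>v unit_vec q j) \<in> W"
      proof (cases "j = r")
        case True
        have "P *\<^sub>v unit_vec q j = u"
          using Pc uc jq True by (intro eq_vecI) (auto simp: mult_unit_vec[OF Pc] Pe simp del: index_mult_mat_vec)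
        moreover have "minv q g *\<^sub>v u = x"
          unfolding u_def using c xc by (simp add: assoc_mult_mat_vec[of _ q q _ q, symmetric])
        ultimately show ?thesis using x by simp
      next
        case False
        then have "P *\<^sub>v unit_vec q j = unit_vec q j"
          using Pc jq j k by (intro eq_vecI) (auto simp: mult_unit_vec[OF Pc] Pe s_def simp del: index_mult_mat_vec)
        then show ?thesis using g(3)[of j] False j by simp
      qed
      ultimately show ?thesis by simp
    qed
    then have "Q (Suc r)" unfolding Q_def using h(1) k by auto
    then show False using r(2) by fastforce
  qed
  then show ?thesis using that g by blast
qed

text \<open>Some nonzero \<open>v\<close> fails to generate some \<open>x\<close>. The cyclic
  subspace \<open>W\<close> of \<open>v\<close> is invariant, contains \<open>v\<close> and misses
  \<open>x\<close>, so it is neither zero nor everything, and a basis adapted to \<open>W\<close>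
  makes the tuple block triangular with two blocks.\<close>

lemma reducible_conj_upper:
  assumes A: "A \<in> mat_tuples p n" and p: "0 < p" and red: "\<not> irr n p A"
  obtains g r where "g \<in> GL p" "0 < r" "r < p" "conj_act p g A \<in> upper_tuples p n [r, p - r]"
proof -
  obtain v x where v: "v \<in> carrier_vec p" "v \<noteq> 0\<^sub>v p" and x: "x \<in> carrier_vec p" "\<And>e. ev n p A e *\<^sub>v v \<noteq> x"
    using A p red unfolding irr_def by auto
  define W where "W = range (\<lambda>e. ev n p A e *\<^sub>v v)"
  have Wc: "W \<subseteq> carrier_vec p" unfolding W_def using v by auto
  obtain g r where g: "g \<in> GL p" "r \<le> p" "\<And>j. j < r \<Longrightarrow> minv p g *\<^sub>v unit_vec p j \<in> W"
    "\<And>x i. x \<in> W \<Longrightarrow> r \<le> i \<Longrightarrow> i < p \<Longrightarrow> (g *\<^sub>v x) $ i = 0"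
    using subspace_adapted_basis[OF Wc] by blast
  note c = GL_carrier[OF g(1)] GL_minv[OF g(1)]
  have Wadd: "a + b \<in> W" if "a \<in> W" "b \<in> W" for a b
    using that ev_NAdd_vec[OF v(1), symmetric] unfolding W_def by auto
  have Wmul: "ev n p A e *\<^sub>v w \<in> W" if "w \<in> W" for w e
    using that ev_NMul_vec[OF v(1), symmetric] unfolding W_def by auto
  have Wsm: "c \<cdot>\<^sub>v w \<in> W" if "w \<in> W" for w c
    using Wmul[OF that, of "NConst c"] ev_NConst_vec[of w p n A c] that Wc by auto
  have vW: "v \<in> W"
  proof -
    have "v = ev n p A (NConst 1) *\<^sub>v v"
      using ev_NConst_vec[OF v(1), of n A 1] v(1) by auto
    then show ?thesis unfolding W_def by (rule range_eqI)
  qed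
  have "r \<noteq> 0"
  proof
    assume r0: "r = 0"
    have "g *\<^sub>v v = 0\<^sub>v p" using g(4)[OF vW] r0 c v by (intro eq_vecI) auto
    then have "minv p g *\<^sub>v (g *\<^sub>v v) = 0\<^sub>v p" using c by auto
    moreover have "minv p g *\<^sub>v (g *\<^sub>v v) = v"
      using c v by (simp add: assoc_mult_mat_vec[of _ p p _ p, symmetric])
    ultimately show False using v by simp
  qed
  moreover have "r \<noteq> p"
  proof
    assume rp: "r = p"
    \<comment> \<open>If all basis vectors lay in \<open>W\<close>, the truncations of
      \<open>g *\<^sub>v x\<close> could be moved into \<open>W\<close> one coordinate at a time;
      the full vector gives the contradiction that \<open>x\<close> is in \<open>W\<close>.\<close>
    have part: "minv p g *\<^sub>v vec p (\<lambda>i. if i < m then (g *\<^sub>v x) $ i else 0) \<in> W" if "m \<le> p" for m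
      using that
    proof (induction m)
      case 0
      have "0 \<cdot>\<^sub>v v \<in> W" by (rule Wsm[OF vW])
      also have "0 \<cdot>\<^sub>v v = minv p g *\<^sub>v vec p (\<lambda>i. if i < 0 then (g *\<^sub>v x) $ i else 0)"
        using c(2) v by (intro eq_vecI) (auto simp: mult_mat_vec_sum[OF c(2)] simp del: index_mult_mat_vec)
      finally show ?case .
    next
      case (Suc m)
      have "minv p g *\<^sub>v vec p (\<lambda>i. if i < Suc m then (g *\<^sub>v x) $ i else 0) =
        minv p g *\<^sub>v (vec p (\<lambda>i. if i < m then (g *\<^sub>v x) $ i else 0) + (g *\<^sub>v x) $ m \<cdot>\<^sub>v unit_vec p m)"
        using Suc.prems by (intro arg_cong[of _ _ "\<lambda>z. minv p g *\<^sub>v z"] eq_vecI) (auto simp: less_Suc_eq simp del: index_mult_mat_vec)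
      also have "\<dots> = minv p g *\<^sub>v vec p (\<lambda>i. if i < m then (g *\<^sub>v x) $ i else 0) +
         (g *\<^sub>v x) $ m \<cdot>\<^sub>v (minv p g *\<^sub>v unit_vec p m)"
        using c(2) by (subst mult_add_distrib_mat_vec[of _ p p]) (auto simp: mult_mat_vec[of _ p p] simp del: index_mult_mat_vec)
      also have "\<dots> \<in> W"
        using Suc g(3)[of m] rp by (intro Wadd Wsm) auto
      finally show ?case .
    qed
    have "vec p (\<lambda>i. if i < p then (g *\<^sub>v x) $ i else 0) = g *\<^sub>v x"
      using c x by (intro eq_vecI) auto
    then have "minv p g *\<^sub>v (g *\<^sub>v x) \<in> W" using part[of p] by simp
    moreover have "minv p g *\<^sub>v (g *\<^sub>v x) = x"
      using c x by (simp add: assoc_mult_mat_vec[of _ p p _ p, symmetric])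
    ultimately show False using x(2) unfolding W_def by auto
  qed
  ultimately have r: "0 < r" "r < p" using g(2) by auto
  have "block_upper [r, p - r] (conj_act p g A ! l)" if l: "l < n" for l
    unfolding block_upper_def
  proof (intro allI impI)
    fix i j assume ij: "i < sum_list [r, p - r]" "j < sum_list [r, p - r]" "blk [r, p - r] j < blk [r, p - r] i"
    have bl: "blk [r, p - r] k = (if k < r then 0 else 1)" if "k < p" for k
      using that r by (auto intro!: blk_eqI simp: start_def)
    have ij': "r \<le> i" "i < p" "j < r" "j < p" using ij r bl[of i] bl[of j] by (auto split: if_splits)
    have M: "A ! l \<in> carrier_mat p p" using mat_tuplesD(2)[OF A l] .
    have "conj_act p g A ! l $$ (i,j) = ((g * (A ! l) * minv p g) *\<^sub>v unit_vec p j) $ i"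
      using l mat_tuplesD(1)[OF A] ij' mult_unit_vec[OF mult3_carrier[OF c(1) M c(2)] ij'(2,4)] by (simp add: conj_act_nth)
    also have "(g * (A ! l) * minv p g) *\<^sub>v unit_vec p j = g *\<^sub>v ((A ! l) *\<^sub>v (minv p g *\<^sub>v unit_vec p j))"
      using c M by (simp add: assoc_mult_mat_vec[of _ p p _ p] assoc_mult_mat[of _ p p _ p _ p] mult_carrier_mat[of _ p p _ p])
    also have "\<dots> $ i = 0"
      using g(4)[OF Wmul[OF g(3)[OF ij'(3)], of "NVar l"] ij'(1,2)] ev_NVar[OF A l] by simp
    finally show "conj_act p g A ! l $$ (i,j) = 0" .
  qed
  then have "conj_act p g A \<in> upper_tuples p n [r, p - r]"
    unfolding upper_tuples_iff using conj_act_closed[OF g(1) A] by auto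
  then show ?thesis using that g(1) r by blast
qed

lemma start_append:
  "a \<le> length \<pi> \<Longrightarrow> start (\<pi> @ \<rho>) a = start \<pi> a"
  "start (\<pi> @ \<rho>) (length \<pi> + a) = sum_list \<pi> + start \<rho> a"
  unfolding start_def by auto

text \<open>A flag in a subrepresentation, followed by the preimage of a flag in the quotient, is a
  flag of the whole representation with the same factors; the two compositions are
  concatenated.\<close>

lemma upper_tuples_append:
  assumes B: "B \<in> upper_tuples p n [r, s]" and p: "p = r + s"
    and \<pi>: "sum_list \<pi> = r" "diag_blocks [r,s] 0 B \<in> upper_tuples r n \<pi>"
    and \<rho>: "sum_list \<rho> = s" "diag_blocks [r,s] 1 B \<in> upper_tuples s n \<rho>"
  shows "B \<in> upper_tuples p n (\<pi> @ \<rho>)"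
    "a < length \<pi> \<Longrightarrow> diag_blocks (\<pi> @ \<rho>) a B = diag_blocks \<pi> a (diag_blocks [r,s] 0 B)"
    "a < length \<rho> \<Longrightarrow> diag_blocks (\<pi> @ \<rho>) (length \<pi> + a) B = diag_blocks \<rho> a (diag_blocks [r,s] 1 B)"
proof -
  let ?u = "[r,s]"
  have B': "B \<in> mat_tuples p n" "length B = n" "\<And>l. l < n \<Longrightarrow> block ?u 1 0 (B ! l) = 0\<^sub>m s r"
    using B unfolding upper_tuples_def by (auto dest: mat_tuplesD(1))
  have st: "start ?u 0 = 0" "start ?u (Suc 0) = r" by (auto simp: start_def)
  have lt: "start \<pi> a + i < r" if "a < length \<pi>" "i < \<pi> ! a" for a i
    using blk_start(2)[OF that] \<pi>(1) by simp
  have lt2: "start \<rho> a + i < s" if "a < length \<rho>" "i < \<rho> ! a" for a i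
    using blk_start(2)[OF that] \<rho>(1) by simp
  have b1: "block (\<pi> @ \<rho>) a b M = block \<pi> a b (block ?u 0 0 M)" if "a < length \<pi>" "b < length \<pi>" for a b M
    using that lt by (intro eq_matI) (auto simp: index_block nth_append start_append st)
  have b2: "block (\<pi> @ \<rho>) (length \<pi> + a) (length \<pi> + b) M = block \<rho> a b (block ?u 1 1 M)"
    if "a < length \<rho>" "b < length \<rho>" for a b M
    using that lt2 by (intro eq_matI) (auto simp: index_block nth_append start_append st \<pi>(1) add.assoc)
  have b3: "block (\<pi> @ \<rho>) (length \<pi> + a) b (B ! l) = 0\<^sub>m (\<rho> ! a) (\<pi> ! b)"
    if "a < length \<rho>" "b < length \<pi>" "l < n" for a b l
  proof (rule eq_matI)
    fix i j assume "i < dim_row (0\<^sub>m (\<rho> ! a) (\<pi> ! b))" "j < dim_col (0\<^sub>m (\<rho> ! a) (\<pi> ! b))"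
    then have ij: "i < \<rho> ! a" "j < \<pi> ! b" by auto
    have "block (\<pi> @ \<rho>) (length \<pi> + a) b (B ! l) $$ (i,j) = (B ! l) $$ (r + (start \<rho> a + i), start \<pi> b + j)"
      using ij that by (simp add: index_block nth_append start_append \<pi>(1) add.assoc)
    also have "\<dots> = block ?u 1 0 (B ! l) $$ (start \<rho> a + i, start \<pi> b + j)"
      using lt[OF that(2) ij(2)] lt2[OF that(1) ij(1)] by (simp add: index_block st)
    also have "\<dots> = 0" using B'(3)[OF that(3)] lt[OF that(2) ij(2)] lt2[OF that(1) ij(1)] by simp
    finally show "block (\<pi> @ \<rho>) (length \<pi> + a) b (B ! l) $$ (i,j) = 0\<^sub>m (\<rho> ! a) (\<pi> ! b) $$ (i,j)"
      using ij by simp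
  qed (use that in \<open>auto simp: nth_append\<close>)
  show "B \<in> upper_tuples p n (\<pi> @ \<rho>)"
    unfolding upper_tuples_iff block_upper_iff
  proof (intro conjI allI impI)
    show "B \<in> mat_tuples p n" by fact
    fix l a b assume l: "l < n" and ab: "a < length (\<pi> @ \<rho>)" "b < a"
    have d: "block_upper \<pi> (block ?u 0 0 (B ! l))" "block_upper \<rho> (block ?u 1 1 (B ! l))"
      using \<pi>(2) \<rho>(2) l B'(2) unfolding upper_tuples_iff by (auto simp: diag_blocks_nth)
    consider "a < length \<pi>" | a' b' where "a = length \<pi> + a'" "b = length \<pi> + b'" "b' < a'" "a' < length \<rho>"
      | a' where "a = length \<pi> + a'" "b < length \<pi>" "a' < length \<rho>"
    proof (cases "a < length \<pi>")
      case False
      then have a: "a = length \<pi> + (a - length \<pi>)" "a - length \<pi> < length \<rho>" using ab by auto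
      show ?thesis
      proof (cases "b < length \<pi>")
        case True
        then show ?thesis using that(3)[OF a(1) _ a(2)] by simp
      next
        case F: False
        then show ?thesis using that(2)[OF a(1), of "b - length \<pi>"] a(2) ab by auto
      qed
    qed (use that in auto)
    then show "block (\<pi> @ \<rho>) a b (B ! l) = 0\<^sub>m ((\<pi> @ \<rho>) ! a) ((\<pi> @ \<rho>) ! b)"
    proof cases
      case 1
      then show ?thesis using b1[of a b] d(1) ab unfolding block_upper_iff by (auto simp: nth_append)
    next
      case 2
      then show ?thesis using b2[of a' b'] d(2) unfolding block_upper_iff by (auto simp: nth_append)
    next
      case 3
      then show ?thesis using b3[of a' b l] l by (auto simp: nth_append)
    qed
  qed
  show "a < length \<pi> \<Longrightarrow> diag_blocks (\<pi> @ \<rho>) a B = diag_blocks \<pi> a (diag_blocks ?u 0 B)"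
    by (rule nth_equalityI) (auto simp: diag_blocks_nth b1)
  show "a < length \<rho> \<Longrightarrow> diag_blocks (\<pi> @ \<rho>) (length \<pi> + a) B = diag_blocks \<rho> a (diag_blocks ?u 1 B)"
    by (rule nth_equalityI) (auto simp: diag_blocks_nth b2)
qed

text \<open>Induction on the dimension. A reducible tuple splits into a subrepresentation and a
  quotient of smaller dimension, and the two base changes supplied by the induction hypothesis are
  carried out at once by a block diagonal one.\<close>

lemma composition_series:
  assumes "A \<in> mat_tuples p n" "0 < p"
  shows "\<exists>g\<in>GL p. \<exists>\<pi>. \<pi> \<noteq> [] \<and> sum_list \<pi> = p \<and> conj_act p g A \<in> upper_tuples p n \<pi> \<and>
    (\<forall>a<length \<pi>. irr n (\<pi> ! a) (diag_blocks \<pi> a (conj_act p g A)))"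
  using assms
proof (induction p arbitrary: A rule: less_induct)
  case (less p)
  show ?case
  proof (cases "irr n p A")
    case True
    have b: "block [p] 0 0 M = M" if "M \<in> carrier_mat p p" for M
      using that by (intro eq_matI) (auto simp: block_def)
    have "diag_blocks [p] 0 A = A"
      by (rule nth_equalityI) (use mat_tuplesD[OF less.prems(1)] b in \<open>auto simp: diag_blocks_nth\<close>)
    moreover have "A \<in> upper_tuples p n [p]"
      using less.prems(1) unfolding upper_tuples_def by auto
    ultimately show ?thesis
      using True conj_act_one[OF less.prems(1)]
      by (intro bexI[of _ "1\<^sub>m p"] exI[of _ "[p]"]) auto
  next
    case False
    obtain g r where g: "g \<in> GL p" "0 < r" "r < p" "conj_act p g A \<in> upper_tuples p n [r, p - r]"
      by (rule reducible_conj_upper[OF less.prems False])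
    define u where "u = [r, p - r]"
    have su: "sum_list u = p" and lu: "length u = 2" using g(3) unfolding u_def by auto
    define A' where "A' = conj_act p g A"
    have A': "A' \<in> mat_tuples p n" "A' \<in> upper_tuples p n u"
      using conj_act_closed[OF g(1) less.prems(1)] g(4) unfolding A'_def u_def by auto
    have d: "diag_blocks u 0 A' \<in> mat_tuples r n" "diag_blocks u 1 A' \<in> mat_tuples (p - r) n"
      using diag_blocks_closed[OF A'(1), of u 0] diag_blocks_closed[OF A'(1), of u 1] unfolding u_def by auto
    obtain g1 \<pi> where 1: "g1 \<in> GL r" "\<pi> \<noteq> []" "sum_list \<pi> = r"
      "conj_act r g1 (diag_blocks u 0 A') \<in> upper_tuples r n \<pi>"
      "\<And>a. a < length \<pi> \<Longrightarrow> irr n (\<pi> ! a) (diag_blocks \<pi> a (conj_act r g1 (diag_blocks u 0 A')))"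
      using less.IH[OF g(3) d(1) g(2)] by auto
    obtain g2 \<rho> where 2: "g2 \<in> GL (p - r)" "\<rho> \<noteq> []" "sum_list \<rho> = p - r"
      "conj_act (p - r) g2 (diag_blocks u 1 A') \<in> upper_tuples (p - r) n \<rho>"
      "\<And>a. a < length \<rho> \<Longrightarrow> irr n (\<rho> ! a) (diag_blocks \<rho> a (conj_act (p - r) g2 (diag_blocks u 1 A')))"
      using less.IH[OF _ d(2)] g(2,3) by auto
    have "(if a = 0 then g1 else g2) \<in> GL (u ! a)" if "a < length u" for a
      using that 1(1) 2(1) unfolding u_def by (cases a) auto
    then obtain h where h: "h \<in> GL p" "conj_act p h A' \<in> upper_tuples p n u"
      "\<And>a. a < length u \<Longrightarrow> diag_blocks u a (conj_act p h A') =
        conj_act (u ! a) (if a = 0 then g1 else g2) (diag_blocks u a A')"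
      using levi_conjugation[OF A'(2) su, of "\<lambda>a. if a = 0 then g1 else g2"] by blast
    define B where "B = conj_act p h A'"
    have dB: "diag_blocks u 0 B = conj_act r g1 (diag_blocks u 0 A')"
      "diag_blocks u 1 B = conj_act (p - r) g2 (diag_blocks u 1 A')"
      using h(3)[of 0] h(3)[of 1] lu unfolding B_def u_def by auto
    have pr: "p = r + (p - r)" using g(3) by simp
    note app = upper_tuples_append[of B p n r "p - r" \<pi> \<rho>, folded u_def, OF _ pr 1(3) _ 2(3), unfolded dB,
        OF h(2)[folded B_def] 1(4) 2(4)]
    have "irr n ((\<pi> @ \<rho>) ! a) (diag_blocks (\<pi> @ \<rho>) a B)" if "a < length (\<pi> @ \<rho>)" for a
    proof (cases "a < length \<pi>")
      case True
      then show ?thesis using app(2) 1(5) by (simp add: nth_append)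
    next
      case False
      have "a - length \<pi> < length \<rho>" "a = length \<pi> + (a - length \<pi>)" using that False by auto
      then obtain b where "a = length \<pi> + b" "b < length \<rho>"
        by blast
      then show ?thesis using app(3) 2(5) by (simp add: nth_append)
    qed
    moreover have "B = conj_act p (h * g) A"
      unfolding B_def A'_def using conj_act_conj_act[OF h(1) g(1) less.prems(1)] .
    ultimately show ?thesis
      using app(1) GL_mult(1)[OF h(1) g(1)] 1 2 pr
      by (intro bexI[of _ "h * g"] exI[of _ "\<pi> @ \<rho>"]) auto
  qed
qed

section \<open>Isomorphic representations\<close>

text \<open>A representation is a pair of dimension and tuple, so that composition factors of
  different sizes can be members of one list.\<close>

definition rep_iso :: "nat \<times> complex mat list \<Rightarrow> nat \<times> complex mat list \<Rightarrow> bool" where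
  "rep_iso x y \<longleftrightarrow> fst x = fst y \<and> (\<exists>g\<in>GL (fst x). conj_act (fst x) g (snd x) = snd y)"

definition irr_rep :: "nat \<Rightarrow> nat \<times> complex mat list \<Rightarrow> bool" where
  "irr_rep n x \<longleftrightarrow> irr n (fst x) (snd x)"

abbreviation rep_ev :: "nat \<Rightarrow> nat \<times> complex mat list \<Rightarrow> nc \<Rightarrow> complex mat" where
  "rep_ev n x e \<equiv> ev n (fst x) (snd x) e"

lemma mtr_ev_rep_iso:
  assumes "irr_rep n x" "rep_iso x y"
  shows "mtr (rep_ev n x e) = mtr (rep_ev n y e)"
proof -
  obtain g where g: "g \<in> GL (fst x)" "conj_act (fst x) g (snd x) = snd y" and f: "fst x = fst y"
    using assms(2) unfolding rep_iso_def by auto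
  have A: "snd x \<in> mat_tuples (fst x) n" using assms(1) irrD(2) unfolding irr_rep_def by blast
  have "rep_ev n y e = g * rep_ev n x e * minv (fst x) g"
    using ev_conj_act[OF g(1) A] g(2) f by simp
  then show ?thesis using mtr_conj[OF g(1) ev_carrier] by simp
qed

primrec ncomb :: "(nat \<Rightarrow> complex) \<Rightarrow> (nat \<Rightarrow> nc) \<Rightarrow> nat \<Rightarrow> nc" where
  "ncomb c e 0 = NConst 0"
| "ncomb c e (Suc m) = NAdd (ncomb c e m) (NMul (NConst (c m)) (e m))"

lemma ncomb_vec:
  assumes "v \<in> carrier_vec q" "i < q"
  shows "(ev n q A (ncomb c e m) *\<^sub>v v) $ i = (\<Sum>k<m. c k * (ev n q A (e k) *\<^sub>v v) $ i)"
proof (induction m)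
  case (Suc m)
  have d: "dim_vec (ev n q A f *\<^sub>v v) = q" for f using carrier_vecD[OF ev_vec_closed[OF assms(1)]] .
  show ?case
    using Suc assms d ev_vec_closed[OF assms(1), of n A "e m"]
    by (simp add: ev_NAdd_vec ev_NMul_vec ev_NConst_vec del: index_mult_mat_vec)
qed (use assms in \<open>simp add: ev_NConst_vec del: index_mult_mat_vec\<close>)

text \<open>Since \<open>x\<close> is cyclic, sending \<open>a x\<close> to \<open>a y\<close> for
  every expression \<open>a\<close> prescribes a map on the whole space, and the hypothesis on
  annihilators makes it well defined. \<open>G\<close> records its values on the unit
  vectors.\<close>

lemma intertwiner:
  assumes irr: "irr n q A" and x: "x \<in> carrier_vec q" "x \<noteq> 0\<^sub>v q" and y: "y \<in> carrier_vec q'"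
    and ann: "\<And>a. ev n q A a *\<^sub>v x = 0\<^sub>v q \<Longrightarrow> ev n q' A' a *\<^sub>v y = 0\<^sub>v q'"
  obtains G where "G \<in> carrier_mat q' q" "\<And>a. G *\<^sub>v (ev n q A a *\<^sub>v x) = ev n q' A' a *\<^sub>v y"
proof -
  have "\<exists>e. ev n q A e *\<^sub>v x = unit_vec q k" if "k < q" for k
    using irrD(3)[OF irr x, of "unit_vec q k"] by simp
  then obtain e where e: "\<And>k. k < q \<Longrightarrow> ev n q A (e k) *\<^sub>v x = unit_vec q k" by metis
  define G where "G = mat q' q (\<lambda>(i,k). (ev n q' A' (e k) *\<^sub>v y) $ i)"
  have Gc: "G \<in> carrier_mat q' q" unfolding G_def by simp
  have "G *\<^sub>v (ev n q A a *\<^sub>v x) = ev n q' A' a *\<^sub>v y" for a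
  proof -
    define c where "c k = (ev n q A a *\<^sub>v x) $ k" for k
    \<comment> \<open>\<open>b\<close> is \<open>a\<close> minus the combination of the
      \<open>e k\<close> whose coefficients are the coordinates of \<open>a x\<close>. It
      annihilates \<open>x\<close>, hence also \<open>y\<close>, which expresses the value at
      \<open>a x\<close> linearly through the columns of \<open>G\<close>.\<close>
    define b where "b = NAdd a (NMul (NConst (-1)) (ncomb c e q))"
    have "ev n q A (ncomb c e q) *\<^sub>v x = ev n q A a *\<^sub>v x"
    proof (rule eq_vecI)
      fix i assume "i < dim_vec (ev n q A a *\<^sub>v x)"
      then have i: "i < q" using ev_vec_closed[OF x(1), of n A a] by auto
      have "(\<Sum>k<q. c k * (ev n q A (e k) *\<^sub>v x) $ i) = (\<Sum>k<q. if k = i then c i else 0)"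
        using e i by (intro sum.cong) (auto simp del: index_mult_mat_vec)
      also have "\<dots> = c i" using i by simp
      finally show "(ev n q A (ncomb c e q) *\<^sub>v x) $ i = (ev n q A a *\<^sub>v x) $ i"
        unfolding ncomb_vec[OF x(1) i] c_def .
    qed simp
    then have "ev n q A b *\<^sub>v x = 0\<^sub>v q"
      unfolding b_def using x(1) by (simp add: ev_NAdd_vec ev_NMul_vec ev_NConst_vec) (auto simp del: index_mult_mat_vec simp: eq_vecI)
    then have b0: "ev n q' A' b *\<^sub>v y = 0\<^sub>v q'" by (rule ann)
    show ?thesis
    proof (rule eq_vecI)
      fix i assume "i < dim_vec (ev n q' A' a *\<^sub>v y)"
      then have i: "i < q'" using ev_vec_closed[OF y, of n A' a] by auto
      have d: "dim_vec (ev n q' A' f *\<^sub>v y) = q'" for f using carrier_vecD[OF ev_vec_closed[OF y]] .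
      have "0 = (ev n q' A' b *\<^sub>v y) $ i" using b0 i by simp
      also have "\<dots> = (ev n q' A' a *\<^sub>v y) $ i - (ev n q' A' (ncomb c e q) *\<^sub>v y) $ i"
        unfolding b_def using y i d by (simp add: ev_NAdd_vec ev_NMul_vec ev_NConst_vec del: index_mult_mat_vec)
      finally have "(ev n q' A' a *\<^sub>v y) $ i = (\<Sum>k<q. c k * (ev n q' A' (e k) *\<^sub>v y) $ i)"
        using ncomb_vec[OF y i, of n A' c e q] by simp
      also have "\<dots> = (G *\<^sub>v (ev n q A a *\<^sub>v x)) $ i"
        unfolding mult_mat_vec_sum[OF Gc ev_vec_closed[OF x(1)] i]
        using i by (intro sum.cong) (auto simp: G_def c_def simp del: index_mult_mat_vec)
      finally show "(G *\<^sub>v (ev n q A a *\<^sub>v x)) $ i = (ev n q' A' a *\<^sub>v y) $ i" ..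
    qed (use Gc in simp)
  qed
  then show ?thesis using that Gc by blast
qed

text \<open>Equal annihilators give intertwiners in both directions which exchange \<open>x\<close>
  and \<open>y\<close>. Both vectors are cyclic, so the two maps are inverse to each other.\<close>

lemma rep_isoI:
  assumes irr: "irr n q A" "irr n q' A'" and x: "x \<in> carrier_vec q" "x \<noteq> 0\<^sub>v q" and y: "y \<in> carrier_vec q'" "y \<noteq> 0\<^sub>v q'"
    and ann: "\<And>a. ev n q A a *\<^sub>v x = 0\<^sub>v q \<longleftrightarrow> ev n q' A' a *\<^sub>v y = 0\<^sub>v q'"
  shows "rep_iso (q, A) (q', A')"
proof -
  obtain G where G: "G \<in> carrier_mat q' q" "\<And>a. G *\<^sub>v (ev n q A a *\<^sub>v x) = ev n q' A' a *\<^sub>v y"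
    using intertwiner[OF irr(1) x y(1)] ann by blast
  obtain H where H: "H \<in> carrier_mat q q'" "\<And>a. H *\<^sub>v (ev n q' A' a *\<^sub>v y) = ev n q A a *\<^sub>v x"
    using intertwiner[OF irr(2) y x(1)] ann by blast
  have "H * G = 1\<^sub>m q"
  proof (rule mat_eq_by_vec[of _ q q])
    fix v :: "complex vec" assume v: "v \<in> carrier_vec q"
    then obtain a where a: "ev n q A a *\<^sub>v x = v" using irrD(3)[OF irr(1) x v] by auto
    show "H * G *\<^sub>v v = 1\<^sub>m q *\<^sub>v v"
      using assoc_mult_mat_vec[OF H(1) G(1) v] G(2)[of a] H(2)[of a] a v by simp
  qed (use G H in auto)
  moreover have "G * H = 1\<^sub>m q'"
  proof (rule mat_eq_by_vec[of _ q' q'])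
    fix v :: "complex vec" assume v: "v \<in> carrier_vec q'"
    then obtain a where a: "ev n q' A' a *\<^sub>v y = v" using irrD(3)[OF irr(2) y v] by auto
    show "G * H *\<^sub>v v = 1\<^sub>m q' *\<^sub>v v"
      using assoc_mult_mat_vec[OF G(1) H(1) v] G(2)[of a] H(2)[of a] a v by simp
  qed (use G H in auto)
  \<comment> \<open>The traces of \<open>H * G\<close> and \<open>G * H\<close> agree, and they are
    the two dimensions.\<close>
  ultimately have "(of_nat q :: complex) = of_nat q'"
    using mtr_mult_comm[OF G(1) H(1)] mtr_one by metis
  then have q: "q' = q" by simp
  have HG: "H * G = 1\<^sub>m q" "G * H = 1\<^sub>m q" by fact (use \<open>G * H = 1\<^sub>m q'\<close> q in simp)
  have Gc: "G \<in> carrier_mat q q" "H \<in> carrier_mat q q" using G H q by auto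
  note GL = GL_I[OF Gc HG(2)]
  have A: "A \<in> mat_tuples q n" "A' \<in> mat_tuples q n" using irrD(2) irr q by auto
  have "conj_act q G A = A'"
  proof (rule nth_equalityI)
    show "length (conj_act q G A) = length A'" using A mat_tuplesD(1) by simp
    fix l assume "l < length (conj_act q G A)"
    then have l: "l < n" "l < length A" using A(1) mat_tuplesD(1) by auto
    note lc = mat_tuplesD(2)[OF A(1) l(1)] mat_tuplesD(2)[OF A(2) l(1)]
    have "G * (A ! l) = (A' ! l) * G"
    proof (rule mat_eq_by_vec[of _ q q])
      fix v :: "complex vec" assume v: "v \<in> carrier_vec q"
      then obtain a where a: "ev n q A a *\<^sub>v x = v" using irrD(3)[OF irr(1) x v] by auto
      have "G * (A ! l) *\<^sub>v v = G *\<^sub>v (ev n q A (NMul (NVar l) a) *\<^sub>v x)"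
        using assoc_mult_mat_vec[OF Gc(1) lc(1) v] ev_NMul_vec[OF x(1)] ev_NVar[OF A(1) l(1)] a by simp
      also have "\<dots> = (A' ! l) *\<^sub>v (G *\<^sub>v v)"
        using G(2) ev_NMul_vec[OF y(1)] ev_NVar[OF A(2) l(1)] a q by metis
      also have "\<dots> = (A' ! l) * G *\<^sub>v v"
        using assoc_mult_mat_vec[OF lc(2) Gc(1) v] by simp
      finally show "G * (A ! l) *\<^sub>v v = (A' ! l) * G *\<^sub>v v" .
    qed (use Gc lc in auto)
    then have "conj_act q G A ! l = (A' ! l) * G * H" using l GL(3) by (simp add: conj_act_nth)
    also have "\<dots> = A' ! l" using lc(2) Gc HG(2) by (simp add: assoc_mult_mat[of _ q q _ q _ q])
    finally show "conj_act q G A ! l = A' ! l" .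
  qed
  then show ?thesis using GL(1) q unfolding rep_iso_def by auto
qed

section \<open>Growth of kernels\<close>

definition ker :: "nat \<Rightarrow> complex mat \<Rightarrow> complex vec set" where
  "ker q M = {v \<in> carrier_vec q. M *\<^sub>v v = 0\<^sub>v q}"

text \<open>The leading positions of the vectors in the kernel, as in an echelon form. Their number
  is the dimension of the kernel, of which only boundedness and (strict) monotonicity are
  required.\<close>

definition pivots :: "nat \<Rightarrow> complex mat \<Rightarrow> nat set" where
  "pivots q M = {i. i < q \<and> (\<exists>v\<in>ker q M. v $ i \<noteq> 0 \<and> (\<forall>j<i. v $ j = 0))}"

lemma card_pivots_le: "card (pivots q M) \<le> q"
proof -
  have "pivots q M \<subseteq> {..<q}" unfolding pivots_def by auto
  then show ?thesis using card_mono[of "{..<q}" "pivots q M"] by simp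
qed

lemma pivots_mono: "ker q M \<subseteq> ker q N \<Longrightarrow> card (pivots q M) \<le> card (pivots q N)"
  by (rule card_mono) (auto simp: pivots_def)

lemma ker_combine:
  assumes "N \<in> carrier_mat q q" "x \<in> ker q N" "v \<in> ker q N"
  shows "x + c \<cdot>\<^sub>v v \<in> ker q N"
proof -
  have "N *\<^sub>v (x + c \<cdot>\<^sub>v v) = N *\<^sub>v x + c \<cdot>\<^sub>v (N *\<^sub>v v)"
    using assms mult_add_distrib_mat_vec[of N q q x "c \<cdot>\<^sub>v v"] mult_mat_vec[of N q q v c] unfolding ker_def by simp
  then show ?thesis using assms unfolding ker_def by auto
qed

text \<open>If the pivots were the same, every vector of the larger kernel could be reduced to zero
  by subtracting multiples of vectors of the smaller one, each step cancelling the leading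
  coordinate; so it would lie in the smaller kernel.\<close>

lemma pivots_strict_mono:
  assumes N: "N \<in> carrier_mat q q" and M: "M \<in> carrier_mat q q" and sub: "ker q M \<subset> ker q N"
  shows "card (pivots q M) < card (pivots q N)"
proof (rule psubset_card_mono)
  show "finite (pivots q N)" unfolding pivots_def by auto
  have "pivots q M \<noteq> pivots q N"
  proof
    assume eq: "pivots q M = pivots q N"
    have "x \<in> ker q M" if "x \<in> ker q N" "\<forall>j<q - d. x $ j = 0" "d \<le> q" for x d
      using that
    proof (induction d arbitrary: x)
      case 0
      then have "x = 0\<^sub>v q" by (intro eq_vecI) (auto simp: ker_def)
      then show ?case using M unfolding ker_def by auto
    next
      case (Suc d)
      define i where "i = q - Suc d"
      have i: "i < q" "q - d = Suc i" using Suc.prems(3) unfolding i_def by auto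
      have xc: "x \<in> carrier_vec q" using Suc.prems unfolding ker_def by auto
      show ?case
      proof (cases "x $ i = 0")
        case True
        then show ?thesis using Suc.IH[of x] Suc.prems i by (auto simp: i_def[symmetric] less_Suc_eq)
      next
        case False
        then have "i \<in> pivots q N" using Suc.prems i unfolding pivots_def i_def by auto
        then obtain v where v: "v \<in> ker q M" "v $ i \<noteq> 0" "\<forall>j<i. v $ j = 0"
          using eq unfolding pivots_def by (smt (verit) mem_Collect_eq)
        have vc: "v \<in> carrier_vec q" using v unfolding ker_def by auto
        define c where "c = - (x $ i / v $ i)"
        have "x + c \<cdot>\<^sub>v v \<in> ker q N" using ker_combine[OF N Suc.prems(1)] v sub by auto
        moreover have "\<forall>j<q - d. (x + c \<cdot>\<^sub>v v) $ j = 0"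
          unfolding i(2) using i(1) v xc vc Suc.prems(2) by (auto simp: less_Suc_eq i_def[symmetric] c_def)
        ultimately have "x + c \<cdot>\<^sub>v v \<in> ker q M" using Suc.IH Suc.prems(3) by simp
        then have "x + c \<cdot>\<^sub>v v + (-c) \<cdot>\<^sub>v v \<in> ker q M" by (rule ker_combine[OF M _ v(1)])
        moreover have "x + c \<cdot>\<^sub>v v + (-c) \<cdot>\<^sub>v v = x" using xc vc by (intro eq_vecI) auto
        ultimately show ?thesis by simp
      qed
    qed
    from this[of _ q] have "ker q N \<subseteq> ker q M" by auto
    then show False using sub by auto
  qed
  then show "pivots q M \<subset> pivots q N"
    using sub unfolding pivots_def by blast
qed

section \<open>Products of shifted matrices\<close>

primrec shift_prod :: "nat \<Rightarrow> complex mat \<Rightarrow> complex list \<Rightarrow> complex mat" where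
  "shift_prod q M [] = 1\<^sub>m q"
| "shift_prod q M (t # ts) = (M - t \<cdot>\<^sub>m 1\<^sub>m q) * shift_prod q M ts"

lemma shift_carrier [simp]: "M \<in> carrier_mat q q \<Longrightarrow> M - t \<cdot>\<^sub>m 1\<^sub>m q \<in> carrier_mat q q"
  by (simp add: minus_carrier_mat)

lemma shift_prod_carrier [simp]: "M \<in> carrier_mat q q \<Longrightarrow> shift_prod q M ts \<in> carrier_mat q q"
proof (induction ts)
  case (Cons t ts)
  then show ?case using mult_carrier_mat[OF shift_carrier[of M q t]] by simp
qed simp

lemma shift_prod_conj:
  assumes g: "g \<in> GL q" and M: "M \<in> carrier_mat q q"
  shows "shift_prod q (g * M * minv q g) ts = g * shift_prod q M ts * minv q g"
proof (induction ts)
  case Nil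
  show ?case using GL_minv(2)[OF g] right_mult_one_mat[OF GL_carrier[OF g]] by simp
next
  case (Cons t ts)
  note c = GL_carrier[OF g] GL_minv[OF g]
  have "g * (M - t \<cdot>\<^sub>m 1\<^sub>m q) * minv q g = g * M * minv q g - g * (t \<cdot>\<^sub>m 1\<^sub>m q) * minv q g"
    using mult_minus_distrib_mat[OF c(1) M smult_carrier_mat[OF one_carrier_mat], of t]
      minus_mult_distrib_mat[OF mult_carrier_mat[OF c(1) M] mult_carrier_mat[OF c(1) smult_carrier_mat[OF one_carrier_mat]] c(2), of t]
    by simp
  then have "g * M * minv q g - t \<cdot>\<^sub>m 1\<^sub>m q = g * (M - t \<cdot>\<^sub>m 1\<^sub>m q) * minv q g"
    using conj_smult_one[OF g] by simp
  then show ?case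
    using Cons conj_mult[OF c(1,2,4) shift_carrier[OF M] shift_prod_carrier[OF M]] by simp
qed

lemma shift_vec:
  fixes v :: "complex vec"
  assumes "M \<in> carrier_mat q q" "v \<in> carrier_vec q"
  shows "(M - t \<cdot>\<^sub>m 1\<^sub>m q) *\<^sub>v v = M *\<^sub>v v - t \<cdot>\<^sub>v v"
proof -
  have "(t \<cdot>\<^sub>m 1\<^sub>m q) *\<^sub>v v = t \<cdot>\<^sub>v v"
    using ev_NConst_vec[OF assms(2), of 0 "[]" t] by (simp add: ev.simps)
  then show ?thesis using minus_mult_distrib_mat_vec[of M q q "t \<cdot>\<^sub>m 1\<^sub>m q" v] assms by simp
qed

text \<open>Subtracting the i-th diagonal entry makes a triangular matrix send the span of the first
  i+1 unit vectors into that of the first i. The factors act from right to left and so descend from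
  level \<open>r\<close> to level \<open>m\<close>.\<close>

lemma shift_prod_upper_triangular:
  assumes T: "T \<in> carrier_mat q q" "upper_triangular T" and v: "v \<in> carrier_vec q"
    and z: "\<And>i. r \<le> i \<Longrightarrow> i < q \<Longrightarrow> v $ i = 0" and "m \<le> r" "r \<le> q" "m \<le> i" "i < q"
  shows "(shift_prod q T (map (\<lambda>i. T $$ (i,i)) [m..<r]) *\<^sub>v v) $ i = 0"
  using \<open>m \<le> r\<close> \<open>m \<le> i\<close> \<open>i < q\<close>
proof (induction "r - m" arbitrary: m i)
  case 0
  then show ?case using v z by simp
next
  case (Suc d)
  then have m: "[m..<r] = m # [Suc m..<r]" "Suc m \<le> r" "d = r - Suc m" by (auto simp: upt_conv_Cons)
  define w where "w = shift_prod q T (map (\<lambda>i. T $$ (i,i)) [Suc m..<r]) *\<^sub>v v"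
  have w: "w \<in> carrier_vec q" unfolding w_def using mult_mat_vec_carrier[OF shift_prod_carrier[OF T(1)] v] .
  have w0: "w $ j = 0" if "Suc m \<le> j" "j < q" for j
    unfolding w_def by (rule Suc.hyps(1)[OF m(3,2) that])
  have "shift_prod q T (map (\<lambda>i. T $$ (i,i)) [m..<r]) *\<^sub>v v = T *\<^sub>v w - T $$ (m,m) \<cdot>\<^sub>v w"
    using shift_vec[OF T(1) w] assoc_mult_mat_vec[OF shift_carrier[OF T(1)] shift_prod_carrier[OF T(1)] v] m(1) w_def by simp
  moreover have "(T *\<^sub>v w) $ i = T $$ (i,i) * w $ i"
  proof -
    have "(T *\<^sub>v w) $ i = (\<Sum>j<q. T $$ (i,j) * w $ j)"
      by (rule mult_mat_vec_sum[OF T(1) w Suc.prems(3)])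
    also have "\<dots> = (\<Sum>j\<in>{i}. T $$ (i,j) * w $ j)"
    proof (rule sum.mono_neutral_right)
      show "\<forall>j\<in>{..<q} - {i}. T $$ (i,j) * w $ j = 0"
      proof
        fix j assume j: "j \<in> {..<q} - {i}"
        then show "T $$ (i,j) * w $ j = 0"
          using w0[of j] Suc.prems T unfolding upper_triangular_def by (cases "j < i") auto
      qed
    qed (use Suc.prems in auto)
    finally show ?thesis by simp
  qed
  ultimately have "(shift_prod q T (map (\<lambda>i. T $$ (i,i)) [m..<r]) *\<^sub>v v) $ i = T $$ (i,i) * w $ i - T $$ (m,m) * w $ i"
    using w T Suc.prems by (simp del: index_mult_mat_vec)
  then show ?case using w0[of i] Suc.prems by (cases "i = m") auto
qed

lemma schur_GL:
  assumes M: "M \<in> carrier_mat q q"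
  obtains g T where "g \<in> GL q" "T \<in> carrier_mat q q" "upper_triangular T" "M = g * T * minv q g"
proof -
  obtain es where es: "char_poly M = (\<Prod>a\<leftarrow>es. [:- a, 1:])"
    using char_poly_factorized[OF M] by auto
  obtain B P Q where B: "schur_decomposition M es = (B, P, Q)" by (metis prod_cases3)
  have s: "similar_mat_wit M B P Q" "upper_triangular B"
    using schur_decomposition[OF M es B] by auto
  note w = similar_mat_witD2[OF M s(1)]
  show ?thesis
    using that[of P B] GL_I[OF w(6,7) w(1)] w s(2) by simp
qed

text \<open>Cayley-Hamilton in factored form: after Schur triangularization, the descent of
  \<open>shift_prod_upper_triangular\<close> goes from level \<open>q\<close> down to level
  0.\<close>

lemma annihilating_shift_prod:
  assumes M: "M \<in> carrier_mat q q"
  shows "\<exists>ts. shift_prod q M ts = 0\<^sub>m q q"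
proof -
  obtain g T where g: "g \<in> GL q" "T \<in> carrier_mat q q" "upper_triangular T" "M = g * T * minv q g"
    using schur_GL[OF M] .
  define ts where "ts = map (\<lambda>i. T $$ (i,i)) [0..<q]"
  have "shift_prod q T ts = 0\<^sub>m q q"
  proof (rule mat_eq_by_vec[of _ q q])
    fix v :: "complex vec" assume v: "v \<in> carrier_vec q"
    show "shift_prod q T ts *\<^sub>v v = 0\<^sub>m q q *\<^sub>v v"
    proof (rule eq_vecI)
      fix i assume "i < dim_vec (0\<^sub>m q q *\<^sub>v v)"
      then have i: "i < q" by simp
      have "(shift_prod q T ts *\<^sub>v v) $ i = 0"
        unfolding ts_def using shift_prod_upper_triangular[OF g(2,3) v, of q 0 i] i by auto
      then show "(shift_prod q T ts *\<^sub>v v) $ i = (0\<^sub>m q q *\<^sub>v v) $ i" using i v by simp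
    qed (use shift_prod_carrier[OF g(2), of ts] in auto)
  qed (use g in auto)
  then have "shift_prod q M ts = g * 0\<^sub>m q q * minv q g"
    unfolding g(4) using shift_prod_conj[OF g(1,2)] by simp
  also have "\<dots> = 0\<^sub>m q q" using GL_carrier[OF g(1)] GL_minv(1)[OF g(1)] by simp
  finally show ?thesis by blast
qed

section \<open>Separating irreducible representations by traces\<close>

lemma zero_mat_vec: "v \<in> carrier_vec c \<Longrightarrow> 0\<^sub>m r c *\<^sub>v v = (0\<^sub>v r :: complex vec)"
  by (intro eq_vecI) (auto simp: scalar_prod_def)

text \<open>Apply the factors of an annihilating product for \<open>E * B\<close> successively to
  \<open>E x\<close>; the last nonzero vector is an eigenvector of \<open>E * B\<close>. All vectors
  on the way remain in the image of \<open>E\<close>, because \<open>E * B\<close> minus a scalar u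
  takes \<open>E z\<close> to \<open>E (B (E z) - u z)\<close>.\<close>

lemma eigenvector_in_image:
  assumes x: "x \<in> carrier_vec q" "ev n q A e *\<^sub>v x \<noteq> 0\<^sub>v q"
  shows "\<exists>c z. z \<in> carrier_vec q \<and> ev n q A e *\<^sub>v z \<noteq> 0\<^sub>v q \<and>
    ev n q A e *\<^sub>v (ev n q A a *\<^sub>v (ev n q A e *\<^sub>v z)) = c \<cdot>\<^sub>v (ev n q A e *\<^sub>v z)"
proof -
  define E where "E = ev n q A e"
  define B where "B = ev n q A a"
  define M where "M = E * B"
  have c: "E \<in> carrier_mat q q" "B \<in> carrier_mat q q" "M \<in> carrier_mat q q"
    unfolding E_def B_def M_def by (auto intro: mult_carrier_mat)
  obtain ts where ts: "shift_prod q M ts = 0\<^sub>m q q"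
    using annihilating_shift_prod[OF c(3)] by auto
  have "(\<exists>z\<in>carrier_vec q. shift_prod q M us *\<^sub>v (E *\<^sub>v x) = E *\<^sub>v z \<and> E *\<^sub>v z \<noteq> 0\<^sub>v q) \<or>
    (\<exists>c. \<exists>z\<in>carrier_vec q. E *\<^sub>v z \<noteq> 0\<^sub>v q \<and> M *\<^sub>v (E *\<^sub>v z) = c \<cdot>\<^sub>v (E *\<^sub>v z))" for us
  proof (induction us)
    case Nil
    then show ?case using x c unfolding E_def by auto
  next
    case (Cons u us)
    show ?case
    proof (cases "\<exists>c. \<exists>z\<in>carrier_vec q. E *\<^sub>v z \<noteq> 0\<^sub>v q \<and> M *\<^sub>v (E *\<^sub>v z) = c \<cdot>\<^sub>v (E *\<^sub>v z)")
      case False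
      then obtain z where z: "z \<in> carrier_vec q" "shift_prod q M us *\<^sub>v (E *\<^sub>v x) = E *\<^sub>v z" "E *\<^sub>v z \<noteq> 0\<^sub>v q"
        using Cons by auto
      have Ez: "E *\<^sub>v z \<in> carrier_vec q" using mult_mat_vec_carrier[OF c(1) z(1)] .
      have BEz: "B *\<^sub>v (E *\<^sub>v z) \<in> carrier_vec q" using mult_mat_vec_carrier[OF c(2) Ez] .
      define z' where "z' = B *\<^sub>v (E *\<^sub>v z) - u \<cdot>\<^sub>v z"
      have z': "z' \<in> carrier_vec q" unfolding z'_def using BEz z(1) by auto
      have "shift_prod q M (u # us) *\<^sub>v (E *\<^sub>v x) = (M - u \<cdot>\<^sub>m 1\<^sub>m q) *\<^sub>v (E *\<^sub>v z)"
        using assoc_mult_mat_vec[OF shift_carrier[OF c(3)] shift_prod_carrier[OF c(3)] mult_mat_vec_carrier[OF c(1) x(1)]]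
          z(2) by simp
      also have "\<dots> = M *\<^sub>v (E *\<^sub>v z) - u \<cdot>\<^sub>v (E *\<^sub>v z)" by (rule shift_vec[OF c(3) Ez])
      also have "M *\<^sub>v (E *\<^sub>v z) = E *\<^sub>v (B *\<^sub>v (E *\<^sub>v z))"
        unfolding M_def by (rule assoc_mult_mat_vec[OF c(1,2) Ez])
      also have "E *\<^sub>v (B *\<^sub>v (E *\<^sub>v z)) - u \<cdot>\<^sub>v (E *\<^sub>v z) = E *\<^sub>v z'"
        unfolding z'_def using mult_minus_distrib_mat_vec[OF c(1) BEz, of "u \<cdot>\<^sub>v z"] mult_mat_vec[OF c(1) z(1)] z(1) by simp
      finally have step: "shift_prod q M (u # us) *\<^sub>v (E *\<^sub>v x) = E *\<^sub>v z'" .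
      have "E *\<^sub>v z' \<noteq> 0\<^sub>v q"
      proof
        assume "E *\<^sub>v z' = 0\<^sub>v q"
        then have 0: "M *\<^sub>v (E *\<^sub>v z) - u \<cdot>\<^sub>v (E *\<^sub>v z) = 0\<^sub>v q"
          using step \<open>shift_prod q M (u # us) *\<^sub>v (E *\<^sub>v x) = (M - u \<cdot>\<^sub>m 1\<^sub>m q) *\<^sub>v (E *\<^sub>v z)\<close>
            shift_vec[OF c(3) Ez] by simp
        have "M *\<^sub>v (E *\<^sub>v z) = u \<cdot>\<^sub>v (E *\<^sub>v z)"
        proof (rule eq_vecI)
          fix i assume "i < dim_vec (u \<cdot>\<^sub>v (E *\<^sub>v z))"
          then have i: "i < q" using c(1) by auto
          have "(M *\<^sub>v (E *\<^sub>v z) - u \<cdot>\<^sub>v (E *\<^sub>v z)) $ i = 0" using 0 i by simp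
          then show "(M *\<^sub>v (E *\<^sub>v z)) $ i = (u \<cdot>\<^sub>v (E *\<^sub>v z)) $ i"
            using i Ez c by (simp del: index_mult_mat_vec)
        qed (use Ez c in auto)
        then show False using False z by blast
      qed
      then show ?thesis using step z' by blast
    qed blast
  qed
  from this[of ts] obtain d z where "z \<in> carrier_vec q" "E *\<^sub>v z \<noteq> 0\<^sub>v q" "M *\<^sub>v (E *\<^sub>v z) = d \<cdot>\<^sub>v (E *\<^sub>v z)"
    using ts mult_mat_vec_carrier[OF c(1) x(1)] by (auto simp: zero_mat_vec)
  then show ?thesis
    using assoc_mult_mat_vec[OF c(1,2) mult_mat_vec_carrier[OF c(1)]] unfolding E_def B_def M_def by metis
qed

text \<open>If \<open>e\<close> acts nontrivially on \<open>x\<close> and its kernels on the members of \<open>L\<close> have maximal total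
  dimension subject to this, then \<open>(e a - c) e\<close> vanishes on \<open>x\<close> as soon as it kills some vector, of
  some member of \<open>L\<close>, that \<open>e\<close> does not kill. So \<open>e\<close> has rank one on \<open>x\<close> and vanishes on every
  member of \<open>L\<close> that is not isomorphic to \<open>x\<close>.\<close>

lemma separating_element:
  assumes L: "\<And>y. y \<in> set L \<Longrightarrow> irr_rep n y" and x: "x \<in> set L"
  shows "\<exists>e. \<forall>y\<in>set L. mtr (rep_ev n y e) = (if rep_iso x y then 1 else 0)"
proof -
  define m where "m e = (\<Sum>y\<in>set L. card (pivots (fst y) (rep_ev n y e)))" for e
  define nz where "nz e \<longleftrightarrow> (\<exists>v\<in>carrier_vec (fst x). rep_ev n x e *\<^sub>v v \<noteq> 0\<^sub>v (fst x))" for e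
  have xi: "irr n (fst x) (snd x)" using L[OF x] unfolding irr_rep_def .
  let ?q = "fst x"
  have "nz (NConst 1)"
    unfolding nz_def using irrD(1)[OF xi]
    by (intro bexI[of _ "unit_vec ?q 0"]) (auto simp: ev_NConst_vec unit_vec_nonzero)
  moreover have "m e \<le> (\<Sum>y\<in>set L. fst y)" for e
    unfolding m_def by (intro sum_mono card_pivots_le)
  ultimately have "\<exists>e. nz e \<and> (\<forall>f. nz f \<longrightarrow> m f \<le> m e)"
    using Lattices_Big.ex_has_greatest_nat[of nz "NConst 1" m "Suc (\<Sum>y\<in>set L. fst y)"]
    by (auto simp: less_Suc_eq_le)
  then obtain e where e: "nz e" and max: "\<And>f. nz f \<Longrightarrow> m f \<le> m e" by auto
  have key: "rep_ev n x e *\<^sub>v (rep_ev n x a *\<^sub>v (rep_ev n x e *\<^sub>v v)) = c \<cdot>\<^sub>v (rep_ev n x e *\<^sub>v v)"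
    if y: "y \<in> set L" and z: "z \<in> carrier_vec (fst y)" "rep_ev n y e *\<^sub>v z \<noteq> 0\<^sub>v (fst y)"
      and ez: "rep_ev n y e *\<^sub>v (rep_ev n y a *\<^sub>v (rep_ev n y e *\<^sub>v z)) = c \<cdot>\<^sub>v (rep_ev n y e *\<^sub>v z)"
      and v: "v \<in> carrier_vec ?q" for y z a c v
  proof -
    define b where "b = NMul (NAdd (NMul e a) (NConst (- c))) e"
    have b: "rep_ev n y b *\<^sub>v w = rep_ev n y e *\<^sub>v (rep_ev n y a *\<^sub>v (rep_ev n y e *\<^sub>v w)) + (- c) \<cdot>\<^sub>v (rep_ev n y e *\<^sub>v w)"
      if "w \<in> carrier_vec (fst y)" for w y
      unfolding b_def using that by (simp add: ev_NMul_vec ev_NAdd_vec ev_NConst_vec)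
    have sub: "ker (fst y) (rep_ev n y e) \<subseteq> ker (fst y) (rep_ev n y b)" for y
    proof
      fix w assume w: "w \<in> ker (fst y) (rep_ev n y e)"
      have "rep_ev n y f *\<^sub>v 0\<^sub>v (fst y) = 0\<^sub>v (fst y)" for f
        using mult_mat_vec[OF ev_carrier[of n "fst y" "snd y" f], of "0\<^sub>v (fst y)" 0] by (auto intro!: eq_vecI)
      then show "w \<in> ker (fst y) (rep_ev n y b)"
        using w b[of w y] unfolding ker_def by auto
    qed
    have cancel: "u + (-c) \<cdot>\<^sub>v u' = 0\<^sub>v k \<longleftrightarrow> u = c \<cdot>\<^sub>v u'" if "u \<in> carrier_vec k" "u' \<in> carrier_vec k" for u u' k
    proof
      assume a: "u + (-c) \<cdot>\<^sub>v u' = 0\<^sub>v k"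
      show "u = c \<cdot>\<^sub>v u'"
      proof (rule eq_vecI)
        fix i assume i: "i < dim_vec (c \<cdot>\<^sub>v u')"
        then have "(u + (-c) \<cdot>\<^sub>v u') $ i = 0" using a that by auto
        then show "u $ i = (c \<cdot>\<^sub>v u') $ i" using i that by simp
      qed (use that in auto)
    qed (use that in \<open>auto intro!: eq_vecI\<close>)
    have "z \<in> ker (fst y) (rep_ev n y b)"
      using b[OF z(1)] cancel[of _ "fst y"] ez z unfolding ker_def by simp
    moreover have "z \<notin> ker (fst y) (rep_ev n y e)" using z unfolding ker_def by simp
    ultimately have strict: "card (pivots (fst y) (rep_ev n y e)) < card (pivots (fst y) (rep_ev n y b))"
      using sub[of y] by (intro pivots_strict_mono) auto
    have "m e < m b"
      unfolding m_def using strict y pivots_mono[OF sub] by (intro sum_strict_mono_ex1) auto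
    then have "\<not> nz b" using max[of b] by auto
    then have "rep_ev n x b *\<^sub>v v = 0\<^sub>v ?q" unfolding nz_def using v by auto
    then show ?thesis using b[OF v] cancel[of _ ?q] v by simp
  qed
  obtain x1 where x1: "x1 \<in> carrier_vec ?q" "rep_ev n x e *\<^sub>v x1 \<noteq> 0\<^sub>v ?q"
    using e unfolding nz_def by auto
  define y1 where "y1 = rep_ev n x e *\<^sub>v x1"
  have y1: "y1 \<in> carrier_vec ?q" "y1 \<noteq> 0\<^sub>v ?q" unfolding y1_def using x1 by auto
  have iso: "rep_iso x y" if y: "y \<in> set L" and z: "z \<in> carrier_vec (fst y)" "rep_ev n y e *\<^sub>v z \<noteq> 0\<^sub>v (fst y)" for y z
  proof -
    have yi: "irr n (fst y) (snd y)" using L[OF y] unfolding irr_rep_def .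
    have c: "rep_ev n y e *\<^sub>v z \<in> carrier_vec (fst y)" using z by simp
    have zz: "rep_ev n y f *\<^sub>v 0\<^sub>v (fst y) = 0\<^sub>v (fst y)" for f y
      using mult_mat_vec[OF ev_carrier[of n "fst y" "snd y" f], of "0\<^sub>v (fst y)" 0] by (auto intro!: eq_vecI)
    \<comment> \<open>Suppose \<open>a\<close> kills one of the vectors \<open>y1\<close> and
      \<open>e z\<close> but not the other. Irreducibility gives \<open>b\<close> that leads the
      surviving image back to \<open>x1\<close> or \<open>z\<close>. Then \<open>e b a e\<close>
      acts as 1 on one side and as 0 on the other, whereas \<open>key\<close> transports the
      constant from \<open>z\<close> to \<open>x1\<close>.\<close>
    have "rep_ev n x a *\<^sub>v y1 = 0\<^sub>v ?q \<longleftrightarrow> rep_ev n y a *\<^sub>v (rep_ev n y e *\<^sub>v z) = 0\<^sub>v (fst y)" for a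
    proof
      assume a: "rep_ev n x a *\<^sub>v y1 = 0\<^sub>v ?q"
      show "rep_ev n y a *\<^sub>v (rep_ev n y e *\<^sub>v z) = 0\<^sub>v (fst y)"
      proof (rule ccontr)
        assume "rep_ev n y a *\<^sub>v (rep_ev n y e *\<^sub>v z) \<noteq> 0\<^sub>v (fst y)"
        then obtain b where b: "rep_ev n y b *\<^sub>v (rep_ev n y a *\<^sub>v (rep_ev n y e *\<^sub>v z)) = z"
          using irrD(3)[OF yi _ _ z(1)] c by (meson ev_vec_closed)
        have "rep_ev n x e *\<^sub>v (rep_ev n x (NMul b a) *\<^sub>v (rep_ev n x e *\<^sub>v x1)) = 1 \<cdot>\<^sub>v (rep_ev n x e *\<^sub>v x1)"
          using key[OF y z _ x1(1), of "NMul b a" 1] b c by (simp add: ev_NMul_vec)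
        then show False using a y1 zz[of x] by (simp add: ev_NMul_vec y1_def[symmetric])
      qed
    next
      assume a: "rep_ev n y a *\<^sub>v (rep_ev n y e *\<^sub>v z) = 0\<^sub>v (fst y)"
      show "rep_ev n x a *\<^sub>v y1 = 0\<^sub>v ?q"
      proof (rule ccontr)
        assume "rep_ev n x a *\<^sub>v y1 \<noteq> 0\<^sub>v ?q"
        then obtain b where b: "rep_ev n x b *\<^sub>v (rep_ev n x a *\<^sub>v y1) = x1"
          using irrD(3)[OF xi _ _ x1(1)] y1 by (meson ev_vec_closed)
        have "0 \<cdot>\<^sub>v (rep_ev n y e *\<^sub>v z) = 0\<^sub>v (fst y)" using c by (auto intro!: eq_vecI)
        then have "rep_ev n x e *\<^sub>v (rep_ev n x (NMul b a) *\<^sub>v (rep_ev n x e *\<^sub>v x1)) = 0 \<cdot>\<^sub>v (rep_ev n x e *\<^sub>v x1)"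
          using key[OF y z _ x1(1), of "NMul b a" 0] a c zz[of y] by (simp add: ev_NMul_vec)
        also have "\<dots> = 0\<^sub>v ?q" using y1(1) unfolding y1_def by (auto intro!: eq_vecI)
        finally show False using b y1 by (simp add: ev_NMul_vec y1_def[symmetric])
      qed
    qed
    then show ?thesis
      using rep_isoI[OF xi yi y1 c z(2)] by simp
  qed
  \<comment> \<open>The expression \<open>f = e a\<close> fixes \<open>y1\<close> and, by
    \<open>image\<close>, maps everything into the line through \<open>y1\<close>; hence its trace
    is 1.\<close>
  obtain a where a: "rep_ev n x a *\<^sub>v y1 = x1" using irrD(3)[OF xi y1 x1(1)] by auto
  define f where "f = NMul e a"
  \<comment> \<open>Write \<open>u\<close> as \<open>b y1\<close>. An eigenvalue of
    \<open>e b\<close> on the image of \<open>e\<close> exists over the complex numbers, and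
    \<open>key\<close> makes \<open>e b e\<close> act on \<open>x1\<close> by the same
    constant.\<close>
  have image: "\<exists>c. rep_ev n x e *\<^sub>v u = c \<cdot>\<^sub>v y1" if u: "u \<in> carrier_vec ?q" for u
  proof -
    obtain b where b: "rep_ev n x b *\<^sub>v y1 = u" using irrD(3)[OF xi y1 u] by auto
    obtain c z where z: "z \<in> carrier_vec ?q" "rep_ev n x e *\<^sub>v z \<noteq> 0\<^sub>v ?q"
      "rep_ev n x e *\<^sub>v (rep_ev n x b *\<^sub>v (rep_ev n x e *\<^sub>v z)) = c \<cdot>\<^sub>v (rep_ev n x e *\<^sub>v z)"
      using eigenvector_in_image[OF x1] by blast
    have "rep_ev n x e *\<^sub>v (rep_ev n x b *\<^sub>v (rep_ev n x e *\<^sub>v x1)) = c \<cdot>\<^sub>v (rep_ev n x e *\<^sub>v x1)"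
      by (rule key[OF x z x1(1)])
    then show ?thesis using b y1_def by auto
  qed
  have fy: "rep_ev n x f *\<^sub>v y1 = y1"
    unfolding f_def using y1(1) a by (simp add: ev_NMul_vec y1_def[symmetric])
  have "mtr (rep_ev n x f) = 1"
  proof -
    have "\<exists>c. rep_ev n x f *\<^sub>v unit_vec ?q k = c \<cdot>\<^sub>v y1" for k
      unfolding f_def using image[of "rep_ev n x a *\<^sub>v unit_vec ?q k"] by (simp add: ev_NMul_vec)
    then obtain c where c: "\<And>k. rep_ev n x f *\<^sub>v unit_vec ?q k = c k \<cdot>\<^sub>v y1" by metis
    have ent: "rep_ev n x f $$ (i,k) = c k * y1 $ i" if "i < ?q" "k < ?q" for i k
      using mult_unit_vec[OF ev_carrier[of n ?q "snd x" f] that] c[of k] y1(1) that by simp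
    obtain i where i: "i < ?q" "y1 $ i \<noteq> 0"
      using y1 by (metis carrier_vecD eq_vecI index_zero_vec)
    have "y1 $ i = (\<Sum>k<?q. rep_ev n x f $$ (i,k) * y1 $ k)"
      using mult_mat_vec_sum[OF ev_carrier[of n ?q "snd x" f] y1(1) i(1)] fy by simp
    also have "\<dots> = (\<Sum>k<?q. c k * y1 $ k) * y1 $ i"
      unfolding sum_distrib_right using i by (intro sum.cong) (auto simp: ent)
    also have "(\<Sum>k<?q. c k * y1 $ k) = mtr (rep_ev n x f)"
      unfolding mtr_def by (auto simp: ent intro!: sum.cong)
    finally show ?thesis using i by simp
  qed
  then have "mtr (rep_ev n y f) = 1" if "y \<in> set L" "rep_iso x y" for y
    using mtr_ev_rep_iso[OF L[OF x] that(2)] by simp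
  moreover have "mtr (rep_ev n y f) = 0" if y: "y \<in> set L" "\<not> rep_iso x y" for y
  proof -
    have "rep_ev n y e = 0\<^sub>m (fst y) (fst y)"
    proof (rule mat_eq_by_vec[of _ "fst y" "fst y"])
      fix v :: "complex vec" assume v: "v \<in> carrier_vec (fst y)"
      then show "rep_ev n y e *\<^sub>v v = 0\<^sub>m (fst y) (fst y) *\<^sub>v v"
        using iso[OF y(1) v] y(2) by (auto simp: zero_mat_vec)
    qed auto
    then show ?thesis unfolding f_def mtr_def by (simp add: ev.simps)
  qed
  ultimately show ?thesis by (intro exI[of _ f]) auto
qed

text \<open>For the head \<open>x\<close> of \<open>L\<close>, the trace of the separating element
  counts the members isomorphic to \<open>x\<close> in either list. The counts agree in
  characteristic 0, so \<open>L'\<close> contains a partner of \<open>x\<close>; both are removed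
  and the traces remain equal.\<close>

lemma match_by_traces:
  assumes "\<And>y. y \<in> set L \<union> set L' \<Longrightarrow> irr_rep n y"
    and "\<And>e. (\<Sum>y\<leftarrow>L. mtr (rep_ev n y e)) = (\<Sum>y\<leftarrow>L'. mtr (rep_ev n y e))"
  shows "\<exists>L''. mset L'' = mset L' \<and> list_all2 rep_iso L L''"
  using assms
proof (induction L arbitrary: L')
  case Nil
  have "L' = []"
  proof (rule ccontr)
    assume ne: "L' \<noteq> []"
    \<comment> \<open>The trace of the unit is the total dimension, which is positive for a nonempty
      list of irreducible representations.\<close>
    have "mtr (rep_ev n y (NConst 1)) = of_nat (fst y)" for y
      by (simp add: ev.simps mtr_def)
    then have "(\<Sum>y\<leftarrow>L'. mtr (rep_ev n y (NConst 1))) = (\<Sum>y\<leftarrow>L'. of_nat (fst y))" by simp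
    also have "\<dots> = of_nat (\<Sum>y\<leftarrow>L'. fst y)" by (induction L') auto
    finally have "(\<Sum>y\<leftarrow>L'. fst y) = 0" using Nil.prems(2)[of "NConst 1"] by simp
    moreover have "0 < fst (hd L')"
      using Nil.prems(1)[of "hd L'"] ne irrD(1) unfolding irr_rep_def by auto
    ultimately show False using ne by (cases L') auto
  qed
  then show ?case by simp
next
  case (Cons x L)
  obtain e where e: "\<And>y. y \<in> set (x # L @ L') \<Longrightarrow> mtr (rep_ev n y e) = (if rep_iso x y then 1 else 0)"
    using separating_element[of "x # L @ L'" n x] Cons.prems(1) by auto
  have count: "(\<Sum>y\<leftarrow>K. if rep_iso x y then 1 else 0) = (of_nat (length (filter (rep_iso x) K)) :: complex)" for K
    by (induction K) auto
  have "1\<^sub>m (fst x) \<in> GL (fst x) \<and> conj_act (fst x) (1\<^sub>m (fst x)) (snd x) = snd x"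
    using conj_act_one[of "snd x" "fst x" n] irrD(2) Cons.prems(1)[of x] unfolding irr_rep_def by auto
  then have xx: "rep_iso x x" unfolding rep_iso_def by auto
  have "(\<Sum>y\<leftarrow>x # L. mtr (rep_ev n y e)) = of_nat (length (filter (rep_iso x) (x # L)))"
    unfolding count[symmetric] using e by (intro arg_cong[of _ _ sum_list] map_cong) auto
  moreover have "(\<Sum>y\<leftarrow>L'. mtr (rep_ev n y e)) = of_nat (length (filter (rep_iso x) L'))"
    unfolding count[symmetric] using e by (intro arg_cong[of _ _ sum_list] map_cong) auto
  ultimately have "length (filter (rep_iso x) L') = length (filter (rep_iso x) (x # L))"
    using Cons.prems(2)[of e] by (metis of_nat_eq_iff)
  then have "filter (rep_iso x) L' \<noteq> []" using xx by auto
  then obtain y where y: "y \<in> set L'" "rep_iso x y" by (auto simp: filter_empty_conv)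
  then obtain ys zs where L': "L' = ys @ y # zs" by (meson split_list)
  have "mtr (rep_ev n x f) = mtr (rep_ev n y f)" for f
    using mtr_ev_rep_iso[OF _ y(2)] Cons.prems(1) by simp
  then have "(\<Sum>y\<leftarrow>L. mtr (rep_ev n y f)) = (\<Sum>y\<leftarrow>ys @ zs. mtr (rep_ev n y f))" for f
    using Cons.prems(2)[of f] unfolding L' by simp
  then obtain M where M: "mset M = mset (ys @ zs)" "list_all2 rep_iso L M"
    using Cons.IH[of "ys @ zs"] Cons.prems(1) unfolding L' by auto
  show ?case
    using M y(2) unfolding L' by (intro exI[of _ "y # M"]) auto
qed

section \<open>The orbits and the separating variety\<close>

section \<open>The separating variety as a union of orbits\<close>

lemma P_setI:
  assumes "\<pi> \<noteq> []" "sum_list \<pi> = p" "\<And>a. a < length \<pi> \<Longrightarrow> 0 < \<pi> ! a" "\<sigma> permutes {..<length \<pi>}"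
  shows "(\<pi>, \<sigma>) \<in> P_set p"
proof -
  have pos: "\<forall>m\<in>set \<pi>. 0 < m" using assms(3) by (auto simp: in_set_conv_nth)
  then have "length \<pi> \<le> sum_list \<pi>"
  proof (induction \<pi>)
    case (Cons a \<pi>)
    then have "0 < a" "length \<pi> \<le> sum_list \<pi>" by simp_all
    then show ?case by simp
  qed simp
  moreover have "length \<pi> \<noteq> 0" using assms(1) by simp
  ultimately have l: "length \<pi> \<in> {1..p}" unfolding assms(2) atLeastAtMost_iff by linarith
  have "\<pi> \<in> compositions p (length \<pi>)" unfolding compositions_def using assms(2) pos by simp
  then show ?thesis
    unfolding P_set_def using l assms(4) by (intro UN_I[of "length \<pi>"]) simp_all
qed

lemma mem_orbit2I:
  assumes g: "g \<in> GL p" "h \<in> GL p" and A: "A \<in> mat_tuples p n" "A' \<in> mat_tuples p n"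
    and Z: "(conj_act p g A, conj_act p h A') \<in> Z"
  shows "(A, A') \<in> orbit2 p Z"
  unfolding orbit2_def
  by (intro CollectI exI[of _ "minv p g"] exI[of _ "minv p h"] exI[of _ "conj_act p g A"] exI[of _ "conj_act p h A'"])
    (simp add: conj_act_minv(1)[OF g(1) A(1)] conj_act_minv(1)[OF g(2) A(2)] GL_minv(4)[OF g(1)] GL_minv(4)[OF g(2)] Z)

text \<open>Both tuples are put into triangular form with irreducible diagonal blocks. Traces match
  these blocks up to isomorphism, and a block diagonal conjugation of the second tuple turns the
  isomorphisms into the equalities demanded by \<open>C_space\<close>.\<close>

lemma separating_variety_subset_orbits:
  assumes p: "0 < p" and AA: "(A, A') \<in> separating_variety p n"
  shows "\<exists>(\<pi>, \<sigma>)\<in>P_set p. (A, A') \<in> orbit2 p (C_space p n \<pi> \<sigma>)"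
proof -
  have A: "A \<in> mat_tuples p n" "A' \<in> mat_tuples p n" and inv: "\<And>f. f \<in> invariants p n \<Longrightarrow> f A = f A'"
    using AA unfolding separating_variety_def by auto
  obtain g \<pi> where 1: "g \<in> GL p" "\<pi> \<noteq> []" "sum_list \<pi> = p" "conj_act p g A \<in> upper_tuples p n \<pi>"
    "\<And>a. a < length \<pi> \<Longrightarrow> irr n (\<pi> ! a) (diag_blocks \<pi> a (conj_act p g A))"
    using composition_series[OF A(1) p] by auto
  obtain h \<pi>' where 2: "h \<in> GL p" "\<pi>' \<noteq> []" "sum_list \<pi>' = p" "conj_act p h A' \<in> upper_tuples p n \<pi>'"
    "\<And>a. a < length \<pi>' \<Longrightarrow> irr n (\<pi>' ! a) (diag_blocks \<pi>' a (conj_act p h A'))"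
    using composition_series[OF A(2) p] by auto
  define V where "V = conj_act p g A"
  define W where "W = conj_act p h A'"
  define reps where "reps \<rho> B = map (\<lambda>a. (\<rho> ! a, diag_blocks \<rho> a B)) [0..<length \<rho>]" for \<rho> :: "nat list" and B
  have tr: "mtr (ev n p B e) = (\<Sum>y\<leftarrow>reps \<rho> B. mtr (rep_ev n y e))"
    if "B \<in> upper_tuples p n \<rho>" "sum_list \<rho> = p" for B \<rho> e
  proof -
    have "mtr (ev n p B e) = (\<Sum>a<length \<rho>. mtr (block \<rho> a a (ev n p B e)))"
      using mtr_blocks[of "ev n p B e" \<rho>] that(2) by simp
    also have "\<dots> = (\<Sum>a<length \<rho>. mtr (ev n (\<rho> ! a) (diag_blocks \<rho> a B) e))"
      using ev_block[OF that] by (intro sum.cong) auto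
    also have "\<dots> = (\<Sum>y\<leftarrow>reps \<rho> B. mtr (rep_ev n y e))"
      unfolding reps_def by (simp add: interv_sum_list_conv_sum_set_nat atLeast0LessThan o_def)
    finally show ?thesis .
  qed
  have "mtr (ev n p V e) = mtr (ev n p W e)" for e
    using inv[OF trace_invariant, of e] ev_conj_act[OF 1(1) A(1)] ev_conj_act[OF 2(1) A(2)]
      mtr_conj[OF 1(1)] mtr_conj[OF 2(1)] unfolding V_def W_def by simp
  \<comment> \<open>The factors of \<open>W\<close> come first so that those of \<open>V\<close> get
    permuted: the i-th block of \<open>W\<close> is then compared with block
    \<open>\<sigma> i\<close> of \<open>V\<close>, the orientation used in
    \<open>C_space\<close>.\<close>
  then have traces: "(\<Sum>y\<leftarrow>reps \<pi>' W. mtr (rep_ev n y e)) = (\<Sum>y\<leftarrow>reps \<pi> V. mtr (rep_ev n y e))" for e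
    using tr[OF 1(4,3)] tr[OF 2(4,3)] unfolding V_def W_def by simp
  have "irr_rep n y" if "y \<in> set (reps \<pi>' W) \<union> set (reps \<pi> V)" for y
    using that 1(5) 2(5) unfolding reps_def irr_rep_def V_def W_def by auto
  then obtain L where L: "mset L = mset (reps \<pi> V)" "list_all2 rep_iso (reps \<pi>' W) L"
    using match_by_traces[of "reps \<pi>' W" "reps \<pi> V" n] traces by blast
  have len: "length (reps \<rho> B) = length \<rho>" for \<rho> B unfolding reps_def by simp
  obtain \<sigma> where \<sigma>: "\<sigma> permutes {..<length \<pi>}" "permute_list \<sigma> (reps \<pi> V) = L"
    using mset_eq_permutation[OF L(1)] len by metis
  have len': "length \<pi>' = length \<pi>"
    using L len by (metis list_all2_lengthD size_mset)
  have iso: "rep_iso (\<pi>' ! i, diag_blocks \<pi>' i W) (\<pi> ! \<sigma> i, diag_blocks \<pi> (\<sigma> i) V)" if i: "i < length \<pi>" for i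
  proof -
    have si: "\<sigma> i < length \<pi>" using \<sigma>(1) i by (metis lessThan_iff permutes_in_image)
    have "rep_iso (reps \<pi>' W ! i) (L ! i)"
      using L(2) i len len' by (simp add: list_all2_conv_all_nth)
    moreover have "L ! i = reps \<pi> V ! \<sigma> i"
      using \<sigma> i len by (metis permute_list_nth)
    ultimately show ?thesis using i si len' unfolding reps_def by simp
  qed
  have \<pi>': "\<pi>' = permute_list \<sigma> \<pi>"
  proof (rule nth_equalityI)
    fix i assume "i < length \<pi>'"
    then show "\<pi>' ! i = permute_list \<sigma> \<pi> ! i"
      using iso[of i] len' permute_list_nth[OF \<sigma>(1), of i] unfolding rep_iso_def by simp
  qed (use len' in simp)
  have "\<exists>k\<in>GL (\<pi>' ! i). conj_act (\<pi>' ! i) k (diag_blocks \<pi>' i W) = diag_blocks \<pi> (\<sigma> i) V" if "i < length \<pi>'" for i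
    using iso[of i] that len' unfolding rep_iso_def fst_conv snd_conv by metis
  then obtain K where K: "\<And>i. i < length \<pi>' \<Longrightarrow> K i \<in> GL (\<pi>' ! i)"
    "\<And>i. i < length \<pi>' \<Longrightarrow> conj_act (\<pi>' ! i) (K i) (diag_blocks \<pi>' i W) = diag_blocks \<pi> (\<sigma> i) V"
    by metis
  obtain k where k: "k \<in> GL p" "conj_act p k W \<in> upper_tuples p n \<pi>'"
    "\<And>a. a < length \<pi>' \<Longrightarrow> diag_blocks \<pi>' a (conj_act p k W) = conj_act (\<pi>' ! a) (K a) (diag_blocks \<pi>' a W)"
    using levi_conjugation[OF 2(4,3) K(1)] unfolding W_def by blast
  have "(V, conj_act p k W) \<in> C_space p n \<pi> \<sigma>"
    unfolding C_space_def using 1(4) k(2,3) K(2) len' unfolding V_def \<pi>' by auto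
  then have "(A, A') \<in> orbit2 p (C_space p n \<pi> \<sigma>)"
    unfolding V_def W_def conj_act_conj_act[OF k(1) 2(1) A(2)]
    by (rule mem_orbit2I[OF 1(1) GL_mult(1)[OF k(1) 2(1)] A])
  moreover have "(\<pi>, \<sigma>) \<in> P_set p"
    using 1 \<sigma>(1) irrD(1) by (intro P_setI) blast+
  ultimately show ?thesis by blast
qed

section \<open>Positions of matched blocks\<close>

text \<open>The position in a \<open>\<pi>\<close>-block matrix that corresponds to the position \<open>i\<close> in a
  \<open>\<sigma>(\<pi>)\<close>-block matrix when the \<open>a\<close>-th block of the latter is the \<open>\<sigma>(a)\<close>-th block of the former.\<close>

definition matched_pos :: "nat list \<Rightarrow> (nat \<Rightarrow> nat) \<Rightarrow> nat \<Rightarrow> nat" where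
  "matched_pos \<pi> \<sigma> i = (let \<rho> = permute_list \<sigma> \<pi> in
     start \<pi> (\<sigma> (blk \<rho> i)) + (i - start \<rho> (blk \<rho> i)))"

lemma sum_list_permute_list:
  "\<sigma> permutes {..<length \<pi>} \<Longrightarrow> sum_list (permute_list \<sigma> \<pi>) = sum_list (\<pi> :: nat list)"
  by (metis mset_permute_list sum_mset_sum_list)

lemma matched_pos_props:
  assumes \<sigma>: "\<sigma> permutes {..<length \<pi>}" and i: "i < sum_list \<pi>"
  shows "matched_pos \<pi> \<sigma> i < sum_list \<pi>" "blk \<pi> (matched_pos \<pi> \<sigma> i) = \<sigma> (blk (permute_list \<sigma> \<pi>) i)"
proof -
  let ?\<rho> = "permute_list \<sigma> \<pi>"
  have i': "i < sum_list ?\<rho>" using i sum_list_permute_list[OF \<sigma>] by simp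
  have b: "blk ?\<rho> i < length \<pi>" using blk_props(1)[OF i'] by simp
  then have sb: "\<sigma> (blk ?\<rho> i) < length \<pi>" using \<sigma> by (metis lessThan_iff permutes_in_image)
  have "i - start ?\<rho> (blk ?\<rho> i) < \<pi> ! \<sigma> (blk ?\<rho> i)"
    using blk_offset(1)[OF i'] permute_list_nth[OF \<sigma> b] by simp
  from blk_start[OF sb this]
  show "matched_pos \<pi> \<sigma> i < sum_list \<pi>" "blk \<pi> (matched_pos \<pi> \<sigma> i) = \<sigma> (blk ?\<rho> i)"
    unfolding matched_pos_def Let_def by auto
qed

lemma matched_pos_start:
  assumes \<sigma>: "\<sigma> permutes {..<length \<pi>}" and a: "a < length \<pi>" and s: "s < \<pi> ! \<sigma> a"
  shows "matched_pos \<pi> \<sigma> (start (permute_list \<sigma> \<pi>) a + s) = start \<pi> (\<sigma> a) + s"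
  using blk_start(1)[of a "permute_list \<sigma> \<pi>" s] a s permute_list_nth[OF \<sigma> a] unfolding matched_pos_def Let_def by simp

lemma matched_pos_inj:
  assumes \<sigma>: "\<sigma> permutes {..<length \<pi>}"
  shows "inj_on (matched_pos \<pi> \<sigma>) {..<sum_list \<pi>}"
proof (rule inj_onI)
  let ?\<rho> = "permute_list \<sigma> \<pi>"
  fix i j assume "i \<in> {..<sum_list \<pi>}" "j \<in> {..<sum_list \<pi>}" and eq: "matched_pos \<pi> \<sigma> i = matched_pos \<pi> \<sigma> j"
  then have i: "i < sum_list \<pi>" "j < sum_list \<pi>" and i': "i < sum_list ?\<rho>" "j < sum_list ?\<rho>"
    using sum_list_permute_list[OF \<sigma>] by auto
  have "\<sigma> (blk ?\<rho> i) = \<sigma> (blk ?\<rho> j)"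
    using matched_pos_props(2)[OF \<sigma> i(1)] matched_pos_props(2)[OF \<sigma> i(2)] eq by simp
  then have b: "blk ?\<rho> i = blk ?\<rho> j" using permutes_inj[OF \<sigma>] by (simp add: inj_eq)
  then show "i = j"
    using eq blk_offset(2)[OF i'(1)] blk_offset(2)[OF i'(2)] unfolding matched_pos_def Let_def by simp
qed

lemma matched_pos_image:
  assumes \<sigma>: "\<sigma> permutes {..<length \<pi>}"
  shows "matched_pos \<pi> \<sigma> ` {..<sum_list \<pi>} = {..<sum_list \<pi>}"
  using matched_pos_inj[OF \<sigma>] matched_pos_props(1)[OF \<sigma>] by (intro endo_inj_surj) auto

text \<open>Written entrywise, membership is a system of linear equations in the coordinates. This
  form serves for segments between two members, for explicit points and for comparing diagonal
  entries.\<close>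

lemma C_space_iff:
  assumes \<sigma>: "\<sigma> permutes {..<length \<pi>}" and p: "sum_list \<pi> = p"
  shows "(A, A') \<in> C_space p n \<pi> \<sigma> \<longleftrightarrow> A \<in> upper_tuples p n \<pi> \<and> A' \<in> upper_tuples p n (permute_list \<sigma> \<pi>) \<and>
    (\<forall>l<n. \<forall>i<p. \<forall>j<p. blk (permute_list \<sigma> \<pi>) i = blk (permute_list \<sigma> \<pi>) j \<longrightarrow>
      A' ! l $$ (i,j) = A ! l $$ (matched_pos \<pi> \<sigma> i, matched_pos \<pi> \<sigma> j))"
proof -
  let ?\<rho> = "permute_list \<sigma> \<pi>" and ?\<tau> = "matched_pos \<pi> \<sigma>"
  have p': "sum_list ?\<rho> = p" using sum_list_permute_list[OF \<sigma>] p by simp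
  have "(\<forall>a<length \<pi>. diag_blocks ?\<rho> a A' = diag_blocks \<pi> (\<sigma> a) A) \<longleftrightarrow>
    (\<forall>l<n. \<forall>i<p. \<forall>j<p. blk ?\<rho> i = blk ?\<rho> j \<longrightarrow> A' ! l $$ (i,j) = A ! l $$ (?\<tau> i, ?\<tau> j))"
    if A: "A \<in> mat_tuples p n" "A' \<in> mat_tuples p n"
  proof
    assume d: "\<forall>a<length \<pi>. diag_blocks ?\<rho> a A' = diag_blocks \<pi> (\<sigma> a) A"
    show "\<forall>l<n. \<forall>i<p. \<forall>j<p. blk ?\<rho> i = blk ?\<rho> j \<longrightarrow> A' ! l $$ (i,j) = A ! l $$ (?\<tau> i, ?\<tau> j)"
    proof (intro allI impI)
      fix l i j assume l: "l < n" and ij: "i < p" "j < p" and b: "blk ?\<rho> i = blk ?\<rho> j"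
      define a where "a = blk ?\<rho> i"
      have i': "i < sum_list ?\<rho>" "j < sum_list ?\<rho>" using ij p' by auto
      have a: "a < length \<pi>" using blk_props(1)[OF i'(1)] unfolding a_def by simp
      define s t where "s = i - start ?\<rho> a" and "t = j - start ?\<rho> a"
      have st: "s < \<pi> ! \<sigma> a" "t < \<pi> ! \<sigma> a" "i = start ?\<rho> a + s" "j = start ?\<rho> a + t"
        using blk_offset[OF i'(1)] blk_offset[OF i'(2)] b permute_list_nth[OF \<sigma> a] unfolding a_def s_def t_def by auto
      have "block ?\<rho> a a (A' ! l) = block \<pi> (\<sigma> a) (\<sigma> a) (A ! l)"
        using d a l A mat_tuplesD(1) by (metis diag_blocks_nth)
      then have "block ?\<rho> a a (A' ! l) $$ (s,t) = block \<pi> (\<sigma> a) (\<sigma> a) (A ! l) $$ (s,t)" by simp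
      then show "A' ! l $$ (i,j) = A ! l $$ (?\<tau> i, ?\<tau> j)"
        using st a permute_list_nth[OF \<sigma> a] by (simp add: index_block matched_pos_start[OF \<sigma>])
    qed
  next
    assume e: "\<forall>l<n. \<forall>i<p. \<forall>j<p. blk ?\<rho> i = blk ?\<rho> j \<longrightarrow> A' ! l $$ (i,j) = A ! l $$ (?\<tau> i, ?\<tau> j)"
    show "\<forall>a<length \<pi>. diag_blocks ?\<rho> a A' = diag_blocks \<pi> (\<sigma> a) A"
    proof (intro allI impI nth_equalityI)
      fix a l assume a: "a < length \<pi>" and "l < length (diag_blocks ?\<rho> a A')"
      then have l: "l < n" "l < length A" "l < length A'" using A mat_tuplesD(1) by auto
      have a': "a < length ?\<rho>" "?\<rho> ! a = \<pi> ! \<sigma> a" using a permute_list_nth[OF \<sigma> a] by auto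
      have "block ?\<rho> a a (A' ! l) = block \<pi> (\<sigma> a) (\<sigma> a) (A ! l)"
      proof (rule eq_matI)
        fix s t assume "s < dim_row (block \<pi> (\<sigma> a) (\<sigma> a) (A ! l))" "t < dim_col (block \<pi> (\<sigma> a) (\<sigma> a) (A ! l))"
        then have st: "s < \<pi> ! \<sigma> a" "t < \<pi> ! \<sigma> a" by auto
        then show "block ?\<rho> a a (A' ! l) $$ (s,t) = block \<pi> (\<sigma> a) (\<sigma> a) (A ! l) $$ (s,t)"
          using e l(1) blk_start[OF a'(1), of s] blk_start[OF a'(1), of t] a' p'
          by (simp add: index_block matched_pos_start[OF \<sigma> a])
      qed (use a' in auto)
      then show "diag_blocks ?\<rho> a A' ! l = diag_blocks \<pi> (\<sigma> a) A ! l" using l by (simp add: diag_blocks_nth)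
    qed (use A mat_tuplesD(1) in auto)
  qed
  then show ?thesis
    unfolding C_space_def using upper_tuples_iff by auto
qed

section \<open>Orbits lie in the separating variety\<close>

lemma polynomial_functions_comp:
  assumes "f \<in> polynomial_functions \<Gamma>" "\<And>\<gamma>. \<gamma> \<in> \<Gamma> \<Longrightarrow> (\<lambda>x. \<gamma> (z x)) \<in> polynomial_functions \<Delta>"
  shows "(\<lambda>x. f (z x)) \<in> polynomial_functions \<Delta>"
  using assms(1)
  by induction (auto intro: polynomial_functions.const polynomial_functions.add polynomial_functions.mult assms(2))

text \<open>The algebraic substitute for a limit as t tends to 0: a polynomial that takes one value
  infinitely often is constant.\<close>

lemma poly_constant_off_zero:
  fixes q :: "complex poly"
  assumes "\<And>t. t \<noteq> 0 \<Longrightarrow> poly q t = c"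
  shows "poly q 0 = c"
proof -
  have "infinite {t. poly (q - [:c:]) t = 0}"
  proof
    assume "finite {t. poly (q - [:c:]) t = 0}"
    moreover have "- {0} \<subseteq> {t. poly (q - [:c:]) t = 0}" using assms by auto
    ultimately have "finite (- {0 :: complex})" by (rule rev_finite_subset)
    then show False using infinite_UNIV_char_0 finite_compl[of "{0 :: complex}"] by auto
  qed
  then have "q - [:c:] = 0" using poly_roots_finite by blast
  then show ?thesis by (metis diff_eq_diff_eq diff_zero poly_pCons mult_zero_left add.right_neutral)
qed

definition block_diag_part :: "nat \<Rightarrow> nat list \<Rightarrow> complex mat \<Rightarrow> complex mat" where
  "block_diag_part p \<pi> M = mat p p (\<lambda>(i,j). if blk \<pi> i = blk \<pi> j then M $$ (i,j) else 0)"

text \<open>Conjugation by the one-parameter subgroup \<open>diag(t\<^bsup>-blk i\<^esup>)\<close> contracts the strictly upper blocks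
  as \<open>t \<rightarrow> 0\<close>.\<close>

lemma invariant_block_diag_part:
  assumes A: "A \<in> upper_tuples p n \<pi>" and p: "sum_list \<pi> = p" and f: "f \<in> invariants p n"
  shows "f (map (block_diag_part p \<pi>) A) = f A"
proof -
  have A': "A \<in> mat_tuples p n" "\<And>l. l < n \<Longrightarrow> block_upper \<pi> (A ! l)"
    using A upper_tuples_iff by auto
  have len: "length A = n" using mat_tuplesD(1)[OF A'(1)] .
  have fp: "f \<in> polynomial_functions (coords p n)"
    and fi: "\<And>g. g \<in> GL p \<Longrightarrow> f (conj_act p g A) = f A"
    using f A'(1) unfolding invariants_def by auto
  \<comment> \<open>For nonzero t this is the conjugate of \<open>A\<close>, with the powers of t
    already combined so that the formula is polynomial and makes sense at 0 too. There only the
    exponent 0 survives, that is, the diagonal blocks.\<close>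
  define z where "z t = map (\<lambda>M. mat p p (\<lambda>(i,j). if blk \<pi> i \<le> blk \<pi> j then t ^ (blk \<pi> j - blk \<pi> i) * M $$ (i,j) else 0)) A"
    for t :: complex
  have "(\<lambda>t. f (z t)) \<in> polynomial_functions {\<lambda>t. t}"
  proof (rule polynomial_functions_comp[OF fp])
    fix \<gamma> assume "\<gamma> \<in> coords p n"
    then obtain l i j where \<gamma>: "\<gamma> = (\<lambda>A. (A ! l) $$ (i,j))" "l < n" "i < p" "j < p"
      unfolding coords_def by auto
    have "(\<lambda>t. \<gamma> (z t)) = (\<lambda>t. (if blk \<pi> i \<le> blk \<pi> j then t ^ (blk \<pi> j - blk \<pi> i) * (A ! l) $$ (i,j) else 0))"
      using \<gamma> len by (auto simp: z_def)
    also have "\<dots> \<in> polynomial_functions {\<lambda>t. t}"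
    proof (cases "blk \<pi> i \<le> blk \<pi> j")
      case True
      have "(\<lambda>t. t ^ (blk \<pi> j - blk \<pi> i) * (A ! l) $$ (i,j)) \<in> polynomial_functions {\<lambda>t. t}"
        by (intro polynomial_functions.const polynomial_functions.mult polynomial_functions_power polynomial_functions.coord) simp
      then show ?thesis using True by simp
    qed (simp add: polynomial_functions.const)
    finally show "(\<lambda>t. \<gamma> (z t)) \<in> polynomial_functions {\<lambda>t. t}" .
  qed
  then obtain q where q: "\<And>t. f (z t) = poly q t"
    using polynomial_functions_id_poly by (metis (no_types))
  have "poly q t = f A" if t: "t \<noteq> 0" for t
  proof -
    define g h where "g = mat_diag p (\<lambda>i. inverse t ^ blk \<pi> i)" and "h = mat_diag p (\<lambda>i. t ^ blk \<pi> i)"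
    have c: "g \<in> carrier_mat p p" "h \<in> carrier_mat p p" unfolding g_def h_def mat_diag_def by auto
    have gh: "g * h = 1\<^sub>m p"
      unfolding g_def h_def mat_diag_diag using t by (simp add: power_mult_distrib[symmetric])
    note GL = GL_I[OF c gh]
    have "z t = conj_act p g A"
    proof (rule nth_equalityI)
      fix l assume "l < length (z t)"
      then have l: "l < n" unfolding z_def using len by simp
      note M = mat_tuplesD(2)[OF A'(1) l]
      show "z t ! l = conj_act p g A ! l"
      proof (rule eq_matI)
        fix i j assume "i < dim_row (conj_act p g A ! l)" "j < dim_col (conj_act p g A ! l)"
        then have ij: "i < p" "j < p" using l len c GL(3) by (auto simp: conj_act_nth)
        have "(conj_act p g A ! l) $$ (i,j) = inverse t ^ blk \<pi> i * (A ! l) $$ (i,j) * t ^ blk \<pi> j"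
          using l len GL(3) ij M unfolding g_def h_def
          by (simp add: conj_act_nth mat_diag_mult_left[of _ p p] mat_diag_mult_right[of _ p p])
        also have "\<dots> = z t ! l $$ (i,j)"
        proof (cases "blk \<pi> i \<le> blk \<pi> j")
          case True
          then show ?thesis using ij l len t by (simp add: z_def power_diff power_inverse divide_inverse)
        next
          case False
          then show ?thesis using ij l len A'(2)[OF l] p unfolding block_upper_def by (simp add: z_def)
        qed
        finally show "z t ! l $$ (i,j) = (conj_act p g A ! l) $$ (i,j)" ..
      qed (use l len c GL(3) in \<open>auto simp: z_def conj_act_nth\<close>)
    qed (simp add: z_def)
    then show ?thesis using q fi[OF GL(1)] by metis
  qed
  then have "f (z 0) = f A" using q poly_constant_off_zero by metis
  moreover have "z 0 = map (block_diag_part p \<pi>) A"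
    unfolding z_def block_diag_part_def by (intro map_cong eq_matI) (auto simp: power_0_left)
  ultimately show ?thesis by simp
qed

text \<open>An invariant sees only the block diagonal parts, and those of the two tuples are
  conjugate by the permutation matrix of \<open>matched_pos\<close>.\<close>

lemma invariant_C_space:
  assumes \<sigma>: "\<sigma> permutes {..<length \<pi>}" and p: "sum_list \<pi> = p"
    and AA: "(A, A') \<in> C_space p n \<pi> \<sigma>" and f: "f \<in> invariants p n"
  shows "f A = f A'"
proof -
  let ?\<rho> = "permute_list \<sigma> \<pi>" and ?\<tau> = "matched_pos \<pi> \<sigma>"
  have p': "sum_list ?\<rho> = p" using sum_list_permute_list[OF \<sigma>] p by simp
  have A: "A \<in> upper_tuples p n \<pi>" "A' \<in> upper_tuples p n ?\<rho>"
    and e: "\<And>l i j. l < n \<Longrightarrow> i < p \<Longrightarrow> j < p \<Longrightarrow> blk ?\<rho> i = blk ?\<rho> j \<Longrightarrow>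
      A' ! l $$ (i,j) = A ! l $$ (?\<tau> i, ?\<tau> j)"
    using AA C_space_iff[OF \<sigma> p] by auto
  have len: "length A = n" "length A' = n" using A upper_tuples_iff mat_tuplesD(1) by blast+
  have \<tau>: "\<And>i. i < p \<Longrightarrow> ?\<tau> i < p" "\<And>i. i < p \<Longrightarrow> blk \<pi> (?\<tau> i) = \<sigma> (blk ?\<rho> i)"
    "\<And>i j. i < p \<Longrightarrow> j < p \<Longrightarrow> ?\<tau> i = ?\<tau> j \<longleftrightarrow> i = j"
    using matched_pos_props[OF \<sigma>] matched_pos_inj[OF \<sigma>] p by (auto dest: inj_onD)
  define P Q where "P = mat p p (\<lambda>(i,j). if j = ?\<tau> i then 1 else (0::complex))"
    and "Q = mat p p (\<lambda>(i,j). if i = ?\<tau> j then 1 else (0::complex))"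
  have c: "P \<in> carrier_mat p p" "Q \<in> carrier_mat p p" unfolding P_def Q_def by auto
  have PM: "(P * M) $$ (i,j) = M $$ (?\<tau> i, j)" if "M \<in> carrier_mat p p" "i < p" "j < p" for M i j
  proof -
    have "(P * M) $$ (i,j) = (\<Sum>k<p. if k = ?\<tau> i then M $$ (k,j) else 0)"
      unfolding index_mult_mat_sum[OF c(1) that] using that by (intro sum.cong) (auto simp: P_def)
    then show ?thesis using \<tau>(1)[OF that(2)] by simp
  qed
  have MQ: "(M * Q) $$ (i,j) = M $$ (i, ?\<tau> j)" if "M \<in> carrier_mat p p" "i < p" "j < p" for M i j
  proof -
    have "(M * Q) $$ (i,j) = (\<Sum>k<p. if k = ?\<tau> j then M $$ (i,k) else 0)"
      unfolding index_mult_mat_sum[OF that(1) c(2) that(2,3)] using that by (intro sum.cong) (auto simp: Q_def)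
    then show ?thesis using \<tau>(1)[OF that(3)] by simp
  qed
  have "P * Q = 1\<^sub>m p"
  proof (rule eq_matI)
    fix i j assume "i < dim_row (1\<^sub>m p :: complex mat)" "j < dim_col (1\<^sub>m p :: complex mat)"
    then have ij: "i < p" "j < p" by auto
    show "(P * Q) $$ (i,j) = 1\<^sub>m p $$ (i,j)"
      unfolding PM[OF c(2) ij] using ij \<tau> by (auto simp: Q_def)
  qed (use c in auto)
  note GL = GL_I[OF c this]
  have D: "map (block_diag_part p \<pi>) A \<in> mat_tuples p n"
    using len by (intro mat_tuplesI) (auto simp: block_diag_part_def)
  have "conj_act p P (map (block_diag_part p \<pi>) A) = map (block_diag_part p ?\<rho>) A'"
  proof (rule nth_equalityI)
    fix l assume "l < length (conj_act p P (map (block_diag_part p \<pi>) A))"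
    then have l: "l < n" using len by simp
    have M: "block_diag_part p \<pi> (A ! l) \<in> carrier_mat p p" unfolding block_diag_part_def by simp
    show "conj_act p P (map (block_diag_part p \<pi>) A) ! l = map (block_diag_part p ?\<rho>) A' ! l"
    proof (rule eq_matI)
      fix i j assume "i < dim_row (map (block_diag_part p ?\<rho>) A' ! l)" "j < dim_col (map (block_diag_part p ?\<rho>) A' ! l)"
      then have ij: "i < p" "j < p" using l len by (auto simp: block_diag_part_def)
      have "conj_act p P (map (block_diag_part p \<pi>) A) ! l $$ (i,j) = block_diag_part p \<pi> (A ! l) $$ (?\<tau> i, ?\<tau> j)"
        using l len MQ[OF mult_carrier_mat[OF c(1) M] ij] PM[OF M ij(1) \<tau>(1)[OF ij(2)]] GL(3)
        by (simp add: conj_act_nth)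
      also have "\<dots> = block_diag_part p ?\<rho> (A' ! l) $$ (i,j)"
        using \<tau> ij e[OF l ij] permutes_inj[OF \<sigma>] unfolding block_diag_part_def by (simp add: inj_eq)
      finally show "conj_act p P (map (block_diag_part p \<pi>) A) ! l $$ (i,j) = map (block_diag_part p ?\<rho>) A' ! l $$ (i,j)"
        using l len by simp
    qed (use l len c GL(3) in \<open>auto simp: conj_act_nth block_diag_part_def\<close>)
  qed (use len in simp)
  then have "f (map (block_diag_part p \<pi>) A) = f (map (block_diag_part p ?\<rho>) A')"
    using f GL(1) D unfolding invariants_def by (metis (mono_tags, lifting) mem_Collect_eq)
  then show ?thesis
    using invariant_block_diag_part[OF A(1) p f] invariant_block_diag_part[OF A(2) p' f] by simp
qed

lemma C_space_mat_tuples: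
  "(A, A') \<in> C_space p n \<pi> \<sigma> \<Longrightarrow> A \<in> mat_tuples p n \<and> A' \<in> mat_tuples p n"
  unfolding C_space_def upper_tuples_def by auto

lemma orbit2_subset_mat_tuples: "orbit2 p (C_space p n \<pi> \<sigma>) \<subseteq> mat_tuples p n \<times> mat_tuples p n"
  unfolding orbit2_def using C_space_mat_tuples conj_act_closed by fastforce

lemma orbit2_subset_separating_variety:
  assumes "\<sigma> permutes {..<length \<pi>}" "sum_list \<pi> = p"
  shows "orbit2 p (C_space p n \<pi> \<sigma>) \<subseteq> separating_variety p n"
proof
  fix x assume "x \<in> orbit2 p (C_space p n \<pi> \<sigma>)"
  then obtain g h A A' where x: "x = (conj_act p g A, conj_act p h A')" "g \<in> GL p" "h \<in> GL p" "(A, A') \<in> C_space p n \<pi> \<sigma>"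
    unfolding orbit2_def by auto
  have "f (conj_act p g A) = f (conj_act p h A')" if f: "f \<in> invariants p n" for f
    using invariant_C_space[OF assms x(4) f] f x(2,3) C_space_mat_tuples[OF x(4)] unfolding invariants_def by auto
  then show "x \<in> separating_variety p n"
    unfolding separating_variety_def using x C_space_mat_tuples[OF x(4)] conj_act_closed by auto
qed

lemma polynomial_functions_coords2:
  assumes "f \<in> polynomial_functions (coords p n)"
  shows "(\<lambda>x. f (fst x)) \<in> polynomial_functions (coords2 p n)" "(\<lambda>x. f (snd x)) \<in> polynomial_functions (coords2 p n)"
proof -
  have "(\<lambda>x. \<gamma> (fst x)) \<in> coords2 p n" "(\<lambda>x. \<gamma> (snd x)) \<in> coords2 p n" if "\<gamma> \<in> coords p n" for \<gamma>
    using that unfolding coords2_def comp_def by auto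
  then show "(\<lambda>x. f (fst x)) \<in> polynomial_functions (coords2 p n)"
    "(\<lambda>x. f (snd x)) \<in> polynomial_functions (coords2 p n)"
    using polynomial_functions_comp[OF assms, of fst] polynomial_functions_comp[OF assms, of snd]
      polynomial_functions.coord by blast+
qed

text \<open>Equality of an invariant on both components is a polynomial equation in the pair; this
  extends the inclusion of the orbits to their closures.\<close>

lemma closedin_separating_variety: "closedin (zariski2 p n) (separating_variety p n)"
  unfolding closedin_zariski
proof (intro exI conjI)
  let ?F = "(\<lambda>f x. f (fst x) - f (snd x)) ` invariants p n"
  show "?F \<subseteq> polynomial_functions (coords2 p n)"
  proof
    fix F assume "F \<in> ?F"
    then obtain f where f: "f \<in> polynomial_functions (coords p n)" "F = (\<lambda>x. f (fst x) - f (snd x))"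
      unfolding invariants_def by auto
    show "F \<in> polynomial_functions (coords2 p n)"
      unfolding f(2) by (intro polynomial_functions_diff polynomial_functions_coords2 f(1))
  qed
  show "separating_variety p n = {x \<in> mat_tuples p n \<times> mat_tuples p n. \<forall>f\<in>?F. f x = 0}"
    unfolding separating_variety_def by auto
qed

section \<open>Rational curves in the orbits\<close>

section \<open>Irreducibility of the orbits\<close>

lemma conj_act_entry_rational:
  assumes G: "G \<in> polynomial_mats {\<lambda>t. t} p p" and M: "M \<in> polynomial_mats {\<lambda>t. t} p p" and ij: "i < p" "j < p"
  obtains q where "q \<in> polynomial_functions {\<lambda>t. t}"
    "\<And>t. det (G t) \<noteq> 0 \<Longrightarrow> (G t * M t * minv p (G t)) $$ (i,j) * det (G t) = q t"
proof
  define q where "q t = (G t * M t * adj_mat (G t)) $$ (i,j)" for t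
  have "(\<lambda>t. G t * M t * adj_mat (G t)) \<in> polynomial_mats {\<lambda>t. t} p p"
    by (intro polynomial_mats_mult[of _ _ _ p] polynomial_mats_adj_mat G M)
  from polynomial_matsD(4)[OF this ij] show "q \<in> polynomial_functions {\<lambda>t. t}"
    unfolding q_def .
  fix t assume d: "det (G t) \<noteq> 0"
  have c: "G t \<in> carrier_mat p p" "M t \<in> carrier_mat p p" "adj_mat (G t) \<in> carrier_mat p p"
    using polynomial_matsD(1)[OF G] polynomial_matsD(1)[OF M] adj_mat(1) by auto
  have g: "G t \<in> GL p" using c d GL_det by auto
  show "(G t * M t * minv p (G t)) $$ (i,j) * det (G t) = q t"
    unfolding minv_adj_mat[OF g] q_def
    using d c ij by (simp add: mult_smult_distrib[OF mult_carrier_mat[OF c(1,2)] c(3)] del: index_mult_mat(1))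
qed

lemma line_polynomial_mats:
  assumes "X \<in> carrier_mat p p" "Y \<in> carrier_mat p p"
  shows "(\<lambda>t. (1 - t) \<cdot>\<^sub>m X + t \<cdot>\<^sub>m Y) \<in> polynomial_mats {\<lambda>t. t} p p"
  using assms
  by (intro polynomial_mats_add polynomial_mats_smult polynomial_mats_const polynomial_functions_diff
      polynomial_functions.const polynomial_functions.coord) auto

lemma line_endpoints:
  fixes X Y :: "complex mat"
  assumes "X \<in> carrier_mat p p" "Y \<in> carrier_mat p p"
  shows "(1 - 0) \<cdot>\<^sub>m X + 0 \<cdot>\<^sub>m Y = X" "(1 - 1) \<cdot>\<^sub>m X + 1 \<cdot>\<^sub>m Y = Y"
  using assms by (auto intro!: eq_matI)

lemma C_space_line:
  assumes \<sigma>: "\<sigma> permutes {..<length \<pi>}" and p: "sum_list \<pi> = p"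
    and A: "(A, A') \<in> C_space p n \<pi> \<sigma>" and B: "(B, B') \<in> C_space p n \<pi> \<sigma>"
  defines "L \<equiv> \<lambda>t X Y. map (\<lambda>l. (1 - t) \<cdot>\<^sub>m (X ! l) + t \<cdot>\<^sub>m (Y ! l)) [0..<n]"
  shows "(L t A B, L t A' B') \<in> C_space p n \<pi> \<sigma>"
proof -
  have c: "A ! l \<in> carrier_mat p p" "B ! l \<in> carrier_mat p p" "A' ! l \<in> carrier_mat p p" "B' ! l \<in> carrier_mat p p"
    if "l < n" for l
    using C_space_mat_tuples[OF A] C_space_mat_tuples[OF B] that by (auto dest: mat_tuplesD)
  have ent: "L t X Y ! l $$ (i,j) = (1 - t) * X ! l $$ (i,j) + t * Y ! l $$ (i,j)"
    if "l < n" "X ! l \<in> carrier_mat p p" "Y ! l \<in> carrier_mat p p" "i < p" "j < p" for X Y l i j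
    using that unfolding L_def by simp
  have mt: "L t A B \<in> mat_tuples p n" "L t A' B' \<in> mat_tuples p n"
    using c unfolding L_def by (auto intro!: mat_tuplesI)
  have p': "sum_list (permute_list \<sigma> \<pi>) = p" using sum_list_permute_list[OF \<sigma>] p by simp
  show ?thesis
    using A B matched_pos_props(1)[OF \<sigma>] p mt
    unfolding C_space_iff[OF \<sigma> p] upper_tuples_iff block_upper_def p p' by (simp add: ent c)
qed

text \<open>If closed sets \<open>D\<close> and \<open>E\<close> cover the orbit and miss the points
  \<open>x\<close> and \<open>y\<close> respectively, choose polynomials vanishing on
  \<open>D\<close> and \<open>E\<close> but not at these points. Their product vanishes along a
  curve from \<open>x\<close> to \<open>y\<close>; with denominators cleared, one of them vanishes
  identically in t, which fails at an endpoint.\<close>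

lemma irreducible_orbit2:
  assumes \<sigma>: "\<sigma> permutes {..<length \<pi>}" and p: "sum_list \<pi> = p"
  shows "irreducible_in (zariski2 p n) (orbit2 p (C_space p n \<pi> \<sigma>))"
  unfolding irreducible_in_def
proof (intro conjI allI)
  let ?X = "mat_tuples p n \<times> mat_tuples p n" and ?O = "orbit2 p (C_space p n \<pi> \<sigma>)"
  let ?Z = "replicate n (0\<^sub>m p p :: complex mat)"
  show "?O \<subseteq> topspace (zariski2 p n)" using orbit2_subset_mat_tuples by simp
  have p': "sum_list (permute_list \<sigma> \<pi>) = p" using sum_list_permute_list[OF \<sigma>] p by simp
  have Z: "?Z \<in> mat_tuples p n" by (intro mat_tuplesI) auto
  have "(?Z, ?Z) \<in> C_space p n \<pi> \<sigma>"
    unfolding C_space_iff[OF \<sigma> p] upper_tuples_iff block_upper_def using Z p p' matched_pos_props(1)[OF \<sigma>] by simp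
  then have "(?Z, ?Z) \<in> ?O"
    using mem_orbit2I[OF conj_act_one(2)[OF Z] conj_act_one(2)[OF Z] Z Z] conj_act_one(1)[OF Z] by simp
  then show "?O \<noteq> {}" by auto
  fix D E
  show "closedin (zariski2 p n) D \<and> closedin (zariski2 p n) E \<and> ?O \<subseteq> D \<union> E \<longrightarrow> ?O \<subseteq> D \<or> ?O \<subseteq> E"
  proof (rule ccontr)
    assume "\<not> (closedin (zariski2 p n) D \<and> closedin (zariski2 p n) E \<and> ?O \<subseteq> D \<union> E \<longrightarrow> ?O \<subseteq> D \<or> ?O \<subseteq> E)"
    then have DE: "closedin (zariski2 p n) D" "closedin (zariski2 p n) E" "?O \<subseteq> D \<union> E" "\<not> ?O \<subseteq> D" "\<not> ?O \<subseteq> E" by auto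
    have sep: "\<exists>f\<in>polynomial_functions (coords2 p n). (\<forall>y\<in>K. f y = 0) \<and> f x \<noteq> 0"
      if "closedin (zariski2 p n) K" "x \<notin> K" "x \<in> ?O" for K x
      using that orbit2_subset_mat_tuples[of p n \<pi> \<sigma>] unfolding closedin_zariski by blast
    obtain x y where x: "x \<in> ?O" "x \<notin> D" and y: "y \<in> ?O" "y \<notin> E" using DE by auto
    obtain f where f: "f \<in> polynomial_functions (coords2 p n)" "\<And>z. z \<in> D \<Longrightarrow> f z = 0" "f x \<noteq> 0"
      using sep[OF DE(1) x(2,1)] by auto
    obtain f' where f': "f' \<in> polynomial_functions (coords2 p n)" "\<And>z. z \<in> E \<Longrightarrow> f' z = 0" "f' y \<noteq> 0"
      using sep[OF DE(2) y(2,1)] by auto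
    obtain g1 h1 A1 A1' where x': "x = (conj_act p g1 A1, conj_act p h1 A1')" "g1 \<in> GL p" "h1 \<in> GL p" "(A1, A1') \<in> C_space p n \<pi> \<sigma>"
      using x(1) unfolding orbit2_def by auto
    obtain g2 h2 A2 A2' where y': "y = (conj_act p g2 A2, conj_act p h2 A2')" "g2 \<in> GL p" "h2 \<in> GL p" "(A2, A2') \<in> C_space p n \<pi> \<sigma>"
      using y(1) unfolding orbit2_def by auto
    have mt: "A1 \<in> mat_tuples p n" "A1' \<in> mat_tuples p n" "A2 \<in> mat_tuples p n" "A2' \<in> mat_tuples p n"
      using C_space_mat_tuples x'(4) y'(4) by auto
    define L where "L t X Y = map (\<lambda>l. (1 - t) \<cdot>\<^sub>m (X ! l) + t \<cdot>\<^sub>m (Y ! l)) [0..<n]" for t and X Y :: "complex mat list"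
    \<comment> \<open>The segments between the group elements may meet singular matrices, but not at
      the endpoints, so \<open>d\<close> is nonzero at 0 and at 1.\<close>
    define G where "G t = (1 - t) \<cdot>\<^sub>m g1 + t \<cdot>\<^sub>m g2" for t
    define H where "H t = (1 - t) \<cdot>\<^sub>m h1 + t \<cdot>\<^sub>m h2" for t
    define d where "d t = det (G t) * det (H t)" for t
    define w where "w t = (conj_act p (G t) (L t A1 A2), conj_act p (H t) (L t A1' A2'))" for t
    have GH: "G \<in> polynomial_mats {\<lambda>t. t} p p" "H \<in> polynomial_mats {\<lambda>t. t} p p"
      using line_polynomial_mats GL_carrier x'(2,3) y'(2,3) unfolding G_def H_def by auto
    have Lp: "(\<lambda>t. L t X Y ! l) \<in> polynomial_mats {\<lambda>t. t} p p"
      if "l < n" "X \<in> mat_tuples p n" "Y \<in> mat_tuples p n" for l X Y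
      using line_polynomial_mats[OF mat_tuplesD(2)[OF that(2,1)] mat_tuplesD(2)[OF that(3,1)]] that(1)
      unfolding L_def by simp
    have Lend: "L 0 X Y = X" "L 1 X Y = Y" if "X \<in> mat_tuples p n" "Y \<in> mat_tuples p n" for X Y
    proof -
      note e = line_endpoints[OF mat_tuplesD(2)[OF that(1)] mat_tuplesD(2)[OF that(2)]]
      show "L 0 X Y = X" "L 1 X Y = Y"
        unfolding L_def using e mat_tuplesD(1) that by (auto intro!: nth_equalityI)
    qed
    have dp: "d \<in> polynomial_functions {\<lambda>t. t}" "(\<lambda>t. det (G t)) \<in> polynomial_functions {\<lambda>t. t}"
      "(\<lambda>t. det (H t)) \<in> polynomial_functions {\<lambda>t. t}"
      unfolding d_def
      using polynomial_functions_det[OF GH(1)] polynomial_functions_det[OF GH(2)]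
      by (auto intro: polynomial_functions.mult)
    \<comment> \<open>Each coordinate of \<open>w t\<close> becomes polynomial after one
      multiplication by \<open>d t\<close>; sums and products need higher powers, hence the exponent
      \<open>N\<close>.\<close>
    have rational: "\<exists>q\<in>polynomial_functions {\<lambda>t. t}. \<exists>N. \<forall>t. d t \<noteq> 0 \<longrightarrow> F (w t) * d t ^ N = q t"
      if "F \<in> polynomial_functions (coords2 p n)" for F
      using that
    proof induction
      case (const c)
      show ?case by (intro bexI[of _ "\<lambda>_. c"] exI[of _ 0]) (auto intro: polynomial_functions.const)
    next
      case (coord \<gamma>)
      then consider l i j where "\<gamma> = (\<lambda>x. (fst x ! l) $$ (i,j))" "l < n" "i < p" "j < p"
        | l i j where "\<gamma> = (\<lambda>x. (snd x ! l) $$ (i,j))" "l < n" "i < p" "j < p"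
        unfolding coords2_def coords_def comp_def by auto
      then show ?case
      proof cases
        case 1
        obtain q where q: "q \<in> polynomial_functions {\<lambda>t. t}"
          "\<And>t. det (G t) \<noteq> 0 \<Longrightarrow> (G t * (L t A1 A2 ! l) * minv p (G t)) $$ (i,j) * det (G t) = q t"
          using conj_act_entry_rational[OF GH(1) Lp[OF 1(2) mt(1,3)] 1(3,4)] by auto
        have "\<gamma> (w t) = (G t * (L t A1 A2 ! l) * minv p (G t)) $$ (i,j)" for t
          unfolding 1(1) w_def using 1(2) by (simp add: conj_act_nth L_def)
        then have "\<gamma> (w t) * d t ^ 1 = q t * det (H t)" if "d t \<noteq> 0" for t
          using q(2)[of t] that unfolding d_def by (metis mult.assoc mult_eq_0_iff power_one_right)
        then show ?thesis
          using polynomial_functions.mult[OF q(1) dp(3)] by (intro bexI[of _ "\<lambda>t. q t * det (H t)"] exI[of _ 1]) auto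
      next
        case 2
        obtain q where q: "q \<in> polynomial_functions {\<lambda>t. t}"
          "\<And>t. det (H t) \<noteq> 0 \<Longrightarrow> (H t * (L t A1' A2' ! l) * minv p (H t)) $$ (i,j) * det (H t) = q t"
          using conj_act_entry_rational[OF GH(2) Lp[OF 2(2) mt(2,4)] 2(3,4)] by auto
        have "\<gamma> (w t) = (H t * (L t A1' A2' ! l) * minv p (H t)) $$ (i,j)" for t
          unfolding 2(1) w_def using 2(2) by (simp add: conj_act_nth L_def)
        then have "\<gamma> (w t) * d t ^ 1 = q t * det (G t)" if "d t \<noteq> 0" for t
          using q(2)[of t] that unfolding d_def by (metis mult.assoc mult.commute mult_eq_0_iff power_one_right)
        then show ?thesis
          using polynomial_functions.mult[OF q(1) dp(2)] by (intro bexI[of _ "\<lambda>t. q t * det (G t)"] exI[of _ 1]) auto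
      qed
    next
      case (add F1 F2)
      then obtain q1 N1 q2 N2 where q: "q1 \<in> polynomial_functions {\<lambda>t. t}" "q2 \<in> polynomial_functions {\<lambda>t. t}"
        "\<And>t. d t \<noteq> 0 \<Longrightarrow> F1 (w t) * d t ^ N1 = q1 t" "\<And>t. d t \<noteq> 0 \<Longrightarrow> F2 (w t) * d t ^ N2 = q2 t" by blast
      have "(\<lambda>t. q1 t * d t ^ N2 + q2 t * d t ^ N1) \<in> polynomial_functions {\<lambda>t. t}"
        by (intro polynomial_functions.add polynomial_functions.mult q polynomial_functions_power dp)
      moreover have "(F1 (w t) + F2 (w t)) * d t ^ (N1 + N2) = q1 t * d t ^ N2 + q2 t * d t ^ N1" if "d t \<noteq> 0" for t
        unfolding q(3,4)[OF that, symmetric] by (simp add: power_add algebra_simps)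
      ultimately show ?case by (intro bexI[of _ "\<lambda>t. q1 t * d t ^ N2 + q2 t * d t ^ N1"] exI[of _ "N1 + N2"]) auto
    next
      case (mult F1 F2)
      then obtain q1 N1 q2 N2 where q: "q1 \<in> polynomial_functions {\<lambda>t. t}" "q2 \<in> polynomial_functions {\<lambda>t. t}"
        "\<And>t. d t \<noteq> 0 \<Longrightarrow> F1 (w t) * d t ^ N1 = q1 t" "\<And>t. d t \<noteq> 0 \<Longrightarrow> F2 (w t) * d t ^ N2 = q2 t" by blast
      have "(\<lambda>t. q1 t * q2 t) \<in> polynomial_functions {\<lambda>t. t}"
        by (intro polynomial_functions.mult q)
      moreover have "(F1 (w t) * F2 (w t)) * d t ^ (N1 + N2) = q1 t * q2 t" if "d t \<noteq> 0" for t
        unfolding q(3,4)[OF that, symmetric] by (simp add: power_add algebra_simps)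
      ultimately show ?case by (intro bexI[of _ "\<lambda>t. q1 t * q2 t"] exI[of _ "N1 + N2"]) auto
    qed
    obtain q N where q: "q \<in> polynomial_functions {\<lambda>t. t}" "\<And>t. d t \<noteq> 0 \<Longrightarrow> f (w t) * d t ^ N = q t"
      using rational[OF f(1)] by blast
    obtain q' N' where q': "q' \<in> polynomial_functions {\<lambda>t. t}" "\<And>t. d t \<noteq> 0 \<Longrightarrow> f' (w t) * d t ^ N' = q' t"
      using rational[OF f'(1)] by blast
    obtain P P' P'' where P: "q = poly P" "q' = poly P'" "d = poly P''"
      using polynomial_functions_id_poly q(1) q'(1) dp(1) by blast
    have wO: "w t \<in> ?O" if "d t \<noteq> 0" for t
    proof -
      have "G t \<in> GL p" "H t \<in> GL p"
        using that GL_det polynomial_matsD(1)[OF GH(1)] polynomial_matsD(1)[OF GH(2)] unfolding d_def by auto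
      moreover have "(L t A1 A2, L t A1' A2') \<in> C_space p n \<pi> \<sigma>"
        unfolding L_def by (rule C_space_line[OF \<sigma> p x'(4) y'(4)])
      ultimately show ?thesis unfolding w_def orbit2_def by blast
    qed
    \<comment> \<open>The factor \<open>P''\<close>, which is \<open>d\<close>, takes care of the
      parameters where the curve is not defined, so that the product vanishes everywhere.\<close>
    have "poly (P * P' * P'') t = 0" for t
    proof (cases "d t = 0")
      case False
      then have "f (w t) = 0 \<or> f' (w t) = 0" using wO DE(3) f(2) f'(2) by blast
      then show ?thesis using q(2)[OF False] q'(2)[OF False] P by auto
    qed (simp add: P(3)[symmetric])
    then have "P * P' * P'' = 0" using poly_all_0_iff_0 by blast
    then have zero: "P = 0 \<or> P' = 0 \<or> P'' = 0" by simp
    have G01: "G 0 = g1" "G 1 = g2" "H 0 = h1" "H 1 = h2"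
      unfolding G_def H_def
      using line_endpoints[OF GL_carrier[OF x'(2)] GL_carrier[OF y'(2)]]
        line_endpoints[OF GL_carrier[OF x'(3)] GL_carrier[OF y'(3)]] by auto
    have w01: "w 0 = x" "w 1 = y"
      unfolding w_def G01 x'(1) y'(1) using Lend mt by auto
    have d01: "d 0 \<noteq> 0" "d 1 \<noteq> 0"
      unfolding d_def G01 using GL_det x'(2,3) y'(2,3) by auto
    have "q 0 \<noteq> 0" "q' 1 \<noteq> 0"
      using q(2)[OF d01(1)] q'(2)[OF d01(2)] w01 f(3) f'(3) d01 by auto
    then show False using zero d01 P by auto
  qed
qed

section \<open>Recovering composition and permutation from an orbit closure\<close>

section \<open>Eliminating eigenvalues\<close>

lemma upper_triangular_mult:
  assumes M: "M \<in> carrier_mat q q" "upper_triangular M" and N: "N \<in> carrier_mat q q" "upper_triangular N"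
  shows "upper_triangular (M * N)" "i < q \<Longrightarrow> (M * N) $$ (i,i) = M $$ (i,i) * (N $$ (i,i) :: complex)"
proof -
  have z: "M $$ (i,j) = 0" "N $$ (i,j) = 0" if "j < i" "i < q" for i j
    using that M N unfolding upper_triangular_def by auto
  show "upper_triangular (M * N)"
    unfolding upper_triangular_def
  proof (intro allI impI)
    fix i j assume ij: "i < dim_row (M * N)" "j < i"
    then have iq: "i < q" "j < q" using M by auto
    have "(M * N) $$ (i,j) = (\<Sum>k<q. M $$ (i,k) * N $$ (k,j))"
      by (rule index_mult_mat_sum[OF M(1) N(1) iq])
    also have "\<dots> = 0"
    proof (rule sum.neutral, rule ballI)
      fix k assume "k \<in> {..<q}"
      then show "M $$ (i,k) * N $$ (k,j) = 0" using z[of k i] z[of j k] ij(2) iq by (cases "k < i") auto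
    qed
    finally show "(M * N) $$ (i,j) = 0" .
  qed
  assume i: "i < q"
  have "(M * N) $$ (i,i) = (\<Sum>k<q. M $$ (i,k) * N $$ (k,i))"
    by (rule index_mult_mat_sum[OF M(1) N(1) i i])
  also have "\<dots> = (\<Sum>k\<in>{i}. M $$ (i,k) * N $$ (k,i))"
  proof (rule sum.mono_neutral_right)
    show "\<forall>k\<in>{..<q} - {i}. M $$ (i,k) * N $$ (k,i) = 0"
    proof
      fix k assume "k \<in> {..<q} - {i}"
      then show "M $$ (i,k) * N $$ (k,i) = 0" using z[of k i] z[of i k] i by (cases "k < i") auto
    qed
  qed (use i in auto)
  finally show "(M * N) $$ (i,i) = M $$ (i,i) * N $$ (i,i)" by simp
qed

lemma char_poly_root_conj_upper_triangular:
  assumes g: "g \<in> GL q" and T: "T \<in> carrier_mat q q" "upper_triangular T"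
  shows "poly (char_poly (g * T * minv q g)) c = 0 \<longleftrightarrow> (\<exists>i<q. c = T $$ (i,i))"
proof -
  have "similar_mat_wit (g * T * minv q g) T g (minv q g)"
    using GL_carrier[OF g] GL_minv[OF g] T(1) by (intro similar_mat_witI[of _ _ q]) (auto intro!: mult3_carrier)
  then have "char_poly (g * T * minv q g) = char_poly T"
    using char_poly_similar unfolding similar_mat_def by blast
  also have "\<dots> = (\<Prod>a\<leftarrow>diag_mat T. [:- a, 1:])" by (rule char_poly_upper_triangular[OF T])
  finally show ?thesis
    using T(1) by (auto simp: poly_prod_list prod_list_zero_iff o_def diag_mat_def)
qed

text \<open>Coordinate functions for a point together with \<open>k\<close> further variables.
  Values of the second component at \<open>k\<close> and beyond are present in the type, but no
  polynomial over these coordinates depends on them.\<close>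

definition adjoin_vars :: "('a \<Rightarrow> complex) set \<Rightarrow> nat \<Rightarrow> ('a \<times> (nat \<Rightarrow> complex) \<Rightarrow> complex) set" where
  "adjoin_vars \<Gamma> k = (\<lambda>\<gamma> x. \<gamma> (fst x)) ` \<Gamma> \<union> (\<lambda>i x. snd x i) ` {..<k}"

lemma polynomial_functions_fst:
  "f \<in> polynomial_functions \<Gamma> \<Longrightarrow> (\<lambda>x. f (fst x)) \<in> polynomial_functions (adjoin_vars \<Gamma> k)"
  by (erule polynomial_functions_comp) (auto simp: adjoin_vars_def intro!: polynomial_functions.coord)

lemma polynomial_mats_fst:
  "M \<in> polynomial_mats \<Gamma> r c \<Longrightarrow> (\<lambda>x. M (fst x)) \<in> polynomial_mats (adjoin_vars \<Gamma> k) r c"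
  using polynomial_matsD[of M \<Gamma> r c] by (auto intro!: polynomial_matsI polynomial_functions_fst)

text \<open>Substituting the matrix \<open>D z\<close> for the last variable turns a polynomial \<open>H\<close> into a matrix whose
  eigenvalues are the values of \<open>H\<close> at the eigenvalues of \<open>D z\<close>.\<close>

definition substituted ::
  "nat \<Rightarrow> ('a \<Rightarrow> complex mat) \<Rightarrow> nat \<Rightarrow> ('a \<times> (nat \<Rightarrow> complex) \<Rightarrow> complex) \<Rightarrow> ('a \<times> (nat \<Rightarrow> complex) \<Rightarrow> complex mat) \<Rightarrow> bool"
  where "substituted p D k H M \<longleftrightarrow> (\<forall>z t g T. g \<in> GL p \<longrightarrow> T \<in> carrier_mat p p \<longrightarrow>
    upper_triangular T \<longrightarrow> D z = g * T * minv p g \<longrightarrow>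
    (\<exists>U\<in>carrier_mat p p. upper_triangular U \<and> M (z,t) = g * U * minv p g \<and>
      (\<forall>i<p. U $$ (i,i) = H (z, t(k := T $$ (i,i))))))"

lemma substitutedD:
  assumes "substituted p D k H M" "g \<in> GL p" "T \<in> carrier_mat p p" "upper_triangular T" "D z = g * T * minv p g"
  shows "\<exists>U\<in>carrier_mat p p. upper_triangular U \<and> M (z,t) = g * U * minv p g \<and>
    (\<forall>i<p. U $$ (i,i) = H (z, t(k := T $$ (i,i))))"
  using assms unfolding substituted_def by simp

lemma substituted_add_mult:
  assumes "substituted p D k H1 M1" "substituted p D k H2 M2"
  shows "substituted p D k (\<lambda>x. H1 x + H2 x) (\<lambda>x. M1 x + M2 x)"
    "substituted p D k (\<lambda>x. H1 x * H2 x) (\<lambda>x. M1 x * M2 x)"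
  unfolding substituted_def
proof (safe)
  fix z t g T assume a: "g \<in> GL p" "T \<in> carrier_mat p p" "upper_triangular T" "D z = g * T * minv p g"
  obtain U1 U2 where U: "U1 \<in> carrier_mat p p" "upper_triangular U1" "M1 (z,t) = g * U1 * minv p g"
    "\<forall>i<p. U1 $$ (i,i) = H1 (z, t(k := T $$ (i,i)))"
    "U2 \<in> carrier_mat p p" "upper_triangular U2" "M2 (z,t) = g * U2 * minv p g"
    "\<forall>i<p. U2 $$ (i,i) = H2 (z, t(k := T $$ (i,i)))"
    using substitutedD[OF assms(1) a, of t] substitutedD[OF assms(2) a, of t] by auto
  note c = GL_carrier[OF a(1)] GL_minv[OF a(1)]
  have "g * (U1 + U2) * minv p g = g * U1 * minv p g + g * U2 * minv p g"
    using mult_add_distrib_mat[OF c(1) U(1,5)] add_mult_distrib_mat[OF mult_carrier_mat[OF c(1) U(1)] mult_carrier_mat[OF c(1) U(5)] c(2)]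
    by simp
  then show "\<exists>U\<in>carrier_mat p p. upper_triangular U \<and> M1 (z,t) + M2 (z,t) = g * U * minv p g \<and>
    (\<forall>i<p. U $$ (i,i) = H1 (z, t(k := T $$ (i,i))) + H2 (z, t(k := T $$ (i,i))))"
    using U by (intro bexI[of _ "U1 + U2"]) (auto simp: upper_triangular_def)
  show "\<exists>U\<in>carrier_mat p p. upper_triangular U \<and> M1 (z,t) * M2 (z,t) = g * U * minv p g \<and>
    (\<forall>i<p. U $$ (i,i) = H1 (z, t(k := T $$ (i,i))) * H2 (z, t(k := T $$ (i,i))))"
    using U(4,8) upper_triangular_mult[OF U(1,2,5,6)] conj_mult[OF c(1,2,4) U(1,5)] U(3,7) mult_carrier_mat[OF U(1,5)]
    by (intro bexI[of _ "U1 * U2"]) (simp_all del: index_mult_mat(1))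
qed

lemma substituted_scalar:
  assumes "\<And>z t c. H (z, t(k := c)) = h (z, t)"
  shows "substituted p D k H (\<lambda>x. h x \<cdot>\<^sub>m 1\<^sub>m p)"
  unfolding substituted_def
proof (intro allI impI)
  fix z t g T assume "g \<in> GL p"
  then show "\<exists>U\<in>carrier_mat p p. upper_triangular U \<and> h (z,t) \<cdot>\<^sub>m 1\<^sub>m p = g * U * minv p g \<and>
    (\<forall>i<p. U $$ (i,i) = H (z, t(k := T $$ (i,i))))"
    using assms by (intro bexI[of _ "h (z,t) \<cdot>\<^sub>m 1\<^sub>m p"]) (auto simp: conj_smult_one)
qed

text \<open>Old coordinates and remaining variables become multiples of the identity, the last
  variable becomes \<open>D\<close>. In a basis that triangularizes \<open>D z\<close> all these
  matrices are triangular, and their diagonals add and multiply like the values of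
  \<open>H\<close>.\<close>

lemma substitute_matrix:
  assumes D: "D \<in> polynomial_mats \<Gamma> p p" and H: "H \<in> polynomial_functions (adjoin_vars \<Gamma> (Suc k))"
  shows "\<exists>M\<in>polynomial_mats (adjoin_vars \<Gamma> k) p p. substituted p D k H M"
  using H
proof induction
  case (const c)
  have "(\<lambda>_. c \<cdot>\<^sub>m 1\<^sub>m p) \<in> polynomial_mats (adjoin_vars \<Gamma> k) p p"
    by (intro polynomial_mats_const) simp
  then show ?case by (rule bexI[rotated]) (rule substituted_scalar, simp)
next
  case (coord \<gamma>)
  have scalar: "(\<lambda>x. h x \<cdot>\<^sub>m 1\<^sub>m p) \<in> polynomial_mats (adjoin_vars \<Gamma> k) p p"
    if "h \<in> adjoin_vars \<Gamma> k" for h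
    using that by (intro polynomial_mats_smult polynomial_mats_const polynomial_functions.coord) simp_all
  consider "\<gamma> \<in> adjoin_vars \<Gamma> k" | "\<gamma> = (\<lambda>x. snd x k)"
    using coord unfolding adjoin_vars_def by (auto simp: less_Suc_eq)
  then show ?case
  proof cases
    case 1
    then have "\<gamma> (z, t(k := c)) = \<gamma> (z, t)" for z t c
      unfolding adjoin_vars_def by auto
    then show ?thesis by (intro bexI[OF _ scalar[OF 1]] substituted_scalar)
  next
    case 2
    have "substituted p D k \<gamma> (\<lambda>x. D (fst x))"
      unfolding substituted_def 2 by auto
    then show ?thesis by (rule bexI[OF _ polynomial_mats_fst[OF D]])
  qed
next
  case (add H1 H2)
  then obtain M1 M2 where M: "M1 \<in> polynomial_mats (adjoin_vars \<Gamma> k) p p" "substituted p D k H1 M1"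
    "M2 \<in> polynomial_mats (adjoin_vars \<Gamma> k) p p" "substituted p D k H2 M2" by blast
  show ?case by (intro bexI[OF _ polynomial_mats_add[OF M(1,3)]] substituted_add_mult(1)[OF M(2,4)])
next
  case (mult H1 H2)
  then obtain M1 M2 where M: "M1 \<in> polynomial_mats (adjoin_vars \<Gamma> k) p p" "substituted p D k H1 M1"
    "M2 \<in> polynomial_mats (adjoin_vars \<Gamma> k) p p" "substituted p D k H2 M2" by blast
  show ?case by (intro bexI[OF _ polynomial_mats_mult[OF M(1,3)]] substituted_add_mult(2)[OF M(2,4)])
qed

text \<open>\<open>H'\<close> is the determinant of \<open>H\<close> with \<open>D z\<close>
  substituted, hence the product of the values of \<open>H\<close> over the eigenvalues of
  \<open>D z\<close>. This is the resultant of \<open>H\<close> with the characteristic polynomial,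
  and the equivalence is exact because that polynomial is monic.\<close>

lemma eliminate_variable:
  assumes D: "D \<in> polynomial_mats \<Gamma> p p" and H: "H \<in> polynomial_functions (adjoin_vars \<Gamma> (Suc k))"
  shows "\<exists>H'\<in>polynomial_functions (adjoin_vars \<Gamma> k). \<forall>z t.
    H' (z,t) = 0 \<longleftrightarrow> (\<exists>c. poly (char_poly (D z)) c = 0 \<and> H (z, t(k := c)) = 0)"
proof -
  obtain M where M: "M \<in> polynomial_mats (adjoin_vars \<Gamma> k) p p"
    and P: "substituted p D k H M"
    using substitute_matrix[OF D H] by auto
  have "det (M (z,t)) = 0 \<longleftrightarrow> (\<exists>c. poly (char_poly (D z)) c = 0 \<and> H (z, t(k := c)) = 0)" for z t
  proof -
    obtain g T where g: "g \<in> GL p" "T \<in> carrier_mat p p" "upper_triangular T" "D z = g * T * minv p g"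
      using schur_GL[OF polynomial_matsD(1)[OF D]] by metis
    obtain U where U: "U \<in> carrier_mat p p" "upper_triangular U" "M (z,t) = g * U * minv p g"
      "\<And>i. i < p \<Longrightarrow> U $$ (i,i) = H (z, t(k := T $$ (i,i)))"
      using substitutedD[OF P g, of t] by auto
    have "det (M (z,t)) = 0 \<longleftrightarrow> det U = 0"
      using GL_carrier[OF g(1)] GL_minv(1,4)[OF g(1)] g(1) U(1) GL_det unfolding U(3)
      by (simp add: det_mult[of _ p])
    also have "det U = prod_list (diag_mat U)" by (rule det_upper_triangular[OF U(2,1)])
    also have "\<dots> = 0 \<longleftrightarrow> (\<exists>i<p. H (z, t(k := T $$ (i,i))) = 0)"
      using U(1,4) by (auto simp: prod_list_zero_iff diag_mat_def image_iff)
    also have "\<dots> \<longleftrightarrow> (\<exists>c. poly (char_poly (D z)) c = 0 \<and> H (z, t(k := c)) = 0)"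
      unfolding g(4) char_poly_root_conj_upper_triangular[OF g(1-3)] by auto
    finally show ?thesis .
  qed
  then show ?thesis using polynomial_functions_det[OF M] by (intro bexI[of _ "\<lambda>x. det (M x)"]) auto
qed

text \<open>Every variable ranges over the eigenvalues independently of the others; nothing makes
  the values of \<open>t\<close> exhaust the eigenvalues with their multiplicities. The condition
  \<open>H\<close> has to enforce this where it matters.\<close>

lemma eliminate_variables:
  assumes D: "D \<in> polynomial_mats \<Gamma> p p" and H: "H \<in> polynomial_functions (adjoin_vars \<Gamma> k)"
  shows "\<exists>f\<in>polynomial_functions \<Gamma>. \<forall>z.
    f z = 0 \<longleftrightarrow> (\<exists>t. (\<forall>i<k. poly (char_poly (D z)) (t i) = 0) \<and> H (z,t) = 0)"
  using H
proof (induction k arbitrary: H)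
  case 0
  have "H (z,t) = H (z,\<lambda>_. 0)" for z t
    using 0 by induction (auto simp: adjoin_vars_def)
  moreover have "(\<lambda>z. H (z, \<lambda>_. 0)) \<in> polynomial_functions \<Gamma>"
    by (rule polynomial_functions_comp[OF 0]) (auto simp: adjoin_vars_def intro: polynomial_functions.coord)
  ultimately show ?case by (intro bexI[of _ "\<lambda>z. H (z, \<lambda>_. 0)"]) (auto, metis)
next
  case (Suc k)
  obtain H' where H': "H' \<in> polynomial_functions (adjoin_vars \<Gamma> k)"
    "\<And>z t. H' (z,t) = 0 \<longleftrightarrow> (\<exists>c. poly (char_poly (D z)) c = 0 \<and> H (z, t(k := c)) = 0)"
    using eliminate_variable[OF D Suc.prems] by blast
  obtain f where f: "f \<in> polynomial_functions \<Gamma>"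
    "\<And>z. f z = 0 \<longleftrightarrow> (\<exists>t. (\<forall>i<k. poly (char_poly (D z)) (t i) = 0) \<and> H' (z,t) = 0)"
    using Suc.IH[OF H'(1)] by blast
  have "f z = 0 \<longleftrightarrow> (\<exists>t. (\<forall>i<Suc k. poly (char_poly (D z)) (t i) = 0) \<and> H (z,t) = 0)" for z
    unfolding f(2) H'(2)
  proof (intro iffI; elim exE conjE)
    fix t c assume "\<forall>i<k. poly (char_poly (D z)) (t i) = 0" "poly (char_poly (D z)) c = 0" "H (z, t(k := c)) = 0"
    then show "\<exists>t. (\<forall>i<Suc k. poly (char_poly (D z)) (t i) = 0) \<and> H (z,t) = 0"
      by (intro exI[of _ "t(k := c)"]) (auto simp: less_Suc_eq)
  next
    fix t assume "\<forall>i<Suc k. poly (char_poly (D z)) (t i) = 0" "H (z, t) = 0"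
    then show "\<exists>t. (\<forall>i<k. poly (char_poly (D z)) (t i) = 0) \<and>
      (\<exists>c. poly (char_poly (D z)) c = 0 \<and> H (z, t(k := c)) = 0)"
      by (intro exI[of _ t] conjI exI[of _ "t k"]) auto
  qed
  then show ?case using f(1) by blast
qed

section \<open>The staircase condition\<close>

text \<open>If \<open>M\<close> has an invariant flag with successive eigenvalues \<open>s 0, \<dots>, s (p - 1)\<close>, the right factor
  maps into the \<open>m\<close>-th member of the flag and the left factor annihilates it; so the product
  vanishes when \<open>N\<close> preserves that member.\<close>

definition staircase :: "nat \<Rightarrow> nat \<Rightarrow> complex mat \<Rightarrow> complex mat \<Rightarrow> (nat \<Rightarrow> complex) \<Rightarrow> complex mat" where
  "staircase p m M N s = shift_prod p M (map s [0..<m]) * N * shift_prod p M (map s [m..<p])"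

text \<open>The dimensions of the members of a flag of type \<open>\<pi>\<close>, including 0 and
  the full dimension. The latter is put to use: its staircase condition forces all eigenvalues to be
  listed.\<close>

abbreviation breaks :: "nat list \<Rightarrow> nat set" where
  "breaks \<pi> \<equiv> start \<pi> ` {..length \<pi>}"

lemma staircase_conj:
  assumes g: "g \<in> GL p" and M: "M \<in> carrier_mat p p" and N: "N \<in> carrier_mat p p"
  shows "staircase p m (g * M * minv p g) (g * N * minv p g) s = g * staircase p m M N s * minv p g"
proof -
  note c = GL_carrier[OF g] GL_minv[OF g]
  show ?thesis
    unfolding staircase_def shift_prod_conj[OF g M]
    using conj_mult[OF c(1,2,4) shift_prod_carrier[OF M] N]
      conj_mult[OF c(1,2,4) mult_carrier_mat[OF shift_prod_carrier[OF M] N] shift_prod_carrier[OF M]] by simp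
qed

lemma staircase_vanishes:
  assumes T: "T \<in> carrier_mat p p" "upper_triangular T" and N: "N \<in> carrier_mat p p" "block_upper \<pi> N"
    and p: "sum_list \<pi> = p" and m: "m \<in> breaks \<pi>" and s: "\<And>i. i < p \<Longrightarrow> s i = T $$ (i,i)"
  shows "staircase p m T N s = 0\<^sub>m p p"
proof -
  obtain a where a: "a \<le> length \<pi>" "m = start \<pi> a" using m by auto
  have mp: "m \<le> p" using start_mono[OF a(1), of \<pi>] a(2) p by simp
  have s1: "map s [0..<m] = map (\<lambda>i. T $$ (i,i)) [0..<m]" and s2: "map s [m..<p] = map (\<lambda>i. T $$ (i,i)) [m..<p]"
    using s mp by auto
  note c = shift_prod_carrier[OF T(1)]
  show ?thesis
  proof (rule mat_eq_by_vec[of _ p p])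
    fix v :: "complex vec" assume v: "v \<in> carrier_vec p"
    define w where "w = shift_prod p T (map s [m..<p]) *\<^sub>v v"
    have w: "w \<in> carrier_vec p" unfolding w_def using mult_mat_vec_carrier[OF c v] .
    have w0: "w $ i = 0" if "m \<le> i" "i < p" for i
      unfolding w_def s2 by (rule shift_prod_upper_triangular[OF T v _ mp _ that]) auto
    have Nw: "N *\<^sub>v w \<in> carrier_vec p" using mult_mat_vec_carrier[OF N(1) w] .
    have Nw0: "(N *\<^sub>v w) $ i = 0" if i: "m \<le> i" "i < p" for i
      unfolding mult_mat_vec_sum[OF N(1) w i(2)]
    proof (rule sum.neutral, rule ballI)
      fix j assume "j \<in> {..<p}"
      then have j: "j < p" by simp
      show "N $$ (i,j) * w $ j = 0"
      proof (cases "m \<le> j")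
        case False
        have "blk \<pi> j < a"
        proof (rule ccontr)
          assume "\<not> blk \<pi> j < a"
          then show False using start_mono[of a "blk \<pi> j" \<pi>] blk_props(2)[of j \<pi>] j p a(2) False by simp
        qed
        moreover have "a \<le> blk \<pi> i"
        proof (rule ccontr)
          assume "\<not> a \<le> blk \<pi> i"
          then show False using start_mono[of "Suc (blk \<pi> i)" a \<pi>] blk_props(3)[of i \<pi>] i p a(2) by simp
        qed
        ultimately show ?thesis using N(2) i j p unfolding block_upper_def by simp
      qed (use w0 j in simp)
    qed
    have "(shift_prod p T (map s [0..<m]) *\<^sub>v (N *\<^sub>v w)) $ i = 0" if "i < p" for i
      unfolding s1 by (rule shift_prod_upper_triangular[OF T Nw Nw0 _ mp _ that]) auto
    then have "shift_prod p T (map s [0..<m]) *\<^sub>v (N *\<^sub>v w) = 0\<^sub>v p"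
      using c[of "map s [0..<m]"] by (intro eq_vecI) auto
    moreover have "staircase p m T N s *\<^sub>v v = shift_prod p T (map s [0..<m]) *\<^sub>v (N *\<^sub>v w)"
      unfolding staircase_def w_def
      using assoc_mult_mat_vec[OF mult_carrier_mat[OF c N(1)] c v] assoc_mult_mat_vec[OF c N(1) mult_mat_vec_carrier[OF c v]] by simp
    ultimately show "staircase p m T N s *\<^sub>v v = 0\<^sub>m p p *\<^sub>v v" using zero_mat_vec[OF v] by simp
  qed (use c N in \<open>auto simp: staircase_def intro!: mult3_carrier\<close>)
qed

lemma polynomial_mats_staircase:
  assumes M: "M \<in> polynomial_mats \<Gamma> p p" and N: "N \<in> polynomial_mats \<Gamma> p p"
    and s: "\<And>i. i < p \<Longrightarrow> s i \<in> polynomial_functions \<Gamma>" and m: "m \<le> p"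
  shows "(\<lambda>x. staircase p m (M x) (N x) (\<lambda>i. s i x)) \<in> polynomial_mats \<Gamma> p p"
proof -
  have "(\<lambda>x. shift_prod p (M x) (map (\<lambda>i. s i x) is)) \<in> polynomial_mats \<Gamma> p p"
    if "set is \<subseteq> {..<p}" for "is"
    using that
  proof (induction "is")
    case Nil
    show ?case by (simp add: polynomial_mats_const)
  next
    case (Cons i "is")
    have "(\<lambda>x. M x - s i x \<cdot>\<^sub>m 1\<^sub>m p) \<in> polynomial_mats \<Gamma> p p"
      using polynomial_matsD[OF M] Cons.prems s
      by (intro polynomial_matsI)
        (auto intro!: polynomial_functions_diff polynomial_functions.mult polynomial_functions.const shift_carrier)
    then show ?case using Cons by (auto intro: polynomial_mats_mult)
  qed
  then show ?thesis
    unfolding staircase_def using m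
    by (intro polynomial_mats_mult[of _ _ _ p] N) (simp_all add: subset_iff)
qed

lemma shift_prod_mat_diag:
  "shift_prod p (mat_diag p d) ts = mat_diag p (\<lambda>r. \<Prod>t\<leftarrow>ts. d r - t)"
proof (induction ts)
  case (Cons t ts)
  have "mat_diag p d - t \<cdot>\<^sub>m 1\<^sub>m p = mat_diag p (\<lambda>r. d r - t)"
    by (intro eq_matI) (auto simp: mat_diag_def)
  then show ?case using Cons by simp
qed simp

lemma staircase_mat_diag:
  assumes N: "N \<in> carrier_mat p p" and rc: "r < p" "c < p"
  shows "staircase p m (mat_diag p d) N s $$ (r,c) =
    (\<Prod>i\<leftarrow>[0..<m]. d r - s i) * N $$ (r,c) * (\<Prod>i\<leftarrow>[m..<p]. d c - s i)"
  unfolding staircase_def shift_prod_mat_diag using N rc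
  by (simp add: mat_diag_mult_left[of _ p p] mat_diag_mult_right[of _ p p] o_def)

lemma down_closed_eq_lessThan:
  fixes I :: "nat set"
  assumes "finite I" "\<And>c d. c \<in> I \<Longrightarrow> d \<le> c \<Longrightarrow> d \<in> I"
  shows "I = {..<card I}"
proof (rule card_subset_eq)
  show "I \<subseteq> {..<card I}"
  proof
    fix c assume "c \<in> I"
    then have "{..c} \<subseteq> I" using assms(2) by auto
    then have "card {..c} \<le> card I" using assms(1) by (rule card_mono[rotated])
    then show "c \<in> {..<card I}" by simp
  qed
qed auto

text \<open>If c is among the first m values of \<open>U\<close> and d is not, the condition puts c
  into a strictly earlier block than d, hence c < d. So these m values form an initial segment, and
  m - 1 and m lie in different blocks unless m is 0 or p.\<close>

lemma staircase_combinatorics: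
  assumes U: "U ` {..<p} \<subseteq> {..<p}" and p: "sum_list \<pi> = p"
    and surj: "\<And>r. r < p \<Longrightarrow> r \<in> U ` {..<p}" and m: "m \<le> p"
    and stair: "\<And>r c. r < p \<Longrightarrow> c < p \<Longrightarrow> r \<in> U ` {..<m} \<or> blk \<pi> c < blk \<pi> r \<or> c \<in> U ` {m..<p}"
  shows "U ` {..<m} = {..<m}" "m \<in> breaks \<pi>"
proof -
  have img: "U ` {..<p} = {..<p}" using U surj by auto
  then have inj: "inj_on U {..<p}" by (intro eq_card_imp_inj_on) auto
  let ?I = "U ` {..<m}"
  have I: "?I \<subseteq> {..<p}" "finite ?I" using U m by (auto simp: image_subset_iff)
  have card: "card ?I = m" using inj m by (simp add: card_image inj_on_subset)
  have disj: "c \<notin> U ` {m..<p}" if "c \<in> ?I" for c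
    using that inj m by (auto dest!: inj_onD)
  have "d \<in> ?I" if "c \<in> ?I" "d \<le> c" for c d
  proof (rule ccontr)
    assume d: "d \<notin> ?I"
    have cp: "c < p" "d < p" using that I by auto
    then have "blk \<pi> c < blk \<pi> d" using stair[of d c] d disj[OF that(1)] by auto
    then show False using blk_mono[OF that(2), of \<pi>] cp p by auto
  qed
  then show Im: "?I = {..<m}" using down_closed_eq_lessThan[OF I(2)] card by metis
  consider "m = p" | "m = 0" | "0 < m" "m < p" using m by linarith
  then show "m \<in> breaks \<pi>"
  proof cases
    case 1
    then have "m = start \<pi> (length \<pi>)" using p by simp
    then show ?thesis by blast
  next
    case 2
    then have "m = start \<pi> 0" by simp
    then show ?thesis by blast
  next
    case 3
    have "m - 1 \<in> ?I" "m \<notin> ?I" unfolding Im using 3 by auto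
    then have lt: "blk \<pi> (m - 1) < blk \<pi> m" using stair[of m "m - 1"] disj 3 by auto
    have mp: "m < sum_list \<pi>" using 3 p by simp
    note b = blk_props[OF mp]
    have "start \<pi> (blk \<pi> m) = m"
    proof (rule ccontr)
      assume "start \<pi> (blk \<pi> m) \<noteq> m"
      then have "blk \<pi> (m - 1) = blk \<pi> m" using b by (intro blk_eqI) auto
      then show False using lt by simp
    qed
    then show ?thesis using b(1) by (intro image_eqI[of _ _ "blk \<pi> m"]) auto
  qed
qed

text \<open>Positive parts make the partial sums strictly increasing, so their set determines their
  list, and the parts are its differences.\<close>

lemma breaks_determine:
  assumes "\<And>a. a < length \<pi> \<Longrightarrow> 0 < \<pi> ! a" "\<And>a. a < length \<rho> \<Longrightarrow> 0 < \<rho> ! a" "breaks \<pi> = breaks \<rho>"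
  shows "\<pi> = \<rho>"
proof -
  have srt: "sorted (map (start \<pi>) [0..<Suc (length \<pi>)]) \<and> distinct (map (start \<pi>) [0..<Suc (length \<pi>)])"
    if pos: "\<And>a. a < length \<pi> \<Longrightarrow> 0 < \<pi> ! a" for \<pi>
  proof -
    have lt: "start \<pi> a < start \<pi> b" if "a < b" "b \<le> length \<pi>" for a b
      using start_mono[of "Suc a" b \<pi>] start_Suc[of a \<pi>] pos[of a] that by simp
    have "inj_on (start \<pi>) {0..<Suc (length \<pi>)}"
    proof (rule inj_onI)
      fix a b assume "a \<in> {0..<Suc (length \<pi>)}" "b \<in> {0..<Suc (length \<pi>)}" "start \<pi> a = start \<pi> b"
      then show "a = b" using lt[of a b] lt[of b a] by (cases a b rule: linorder_cases) auto
    qed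
    then show ?thesis by (auto simp: distinct_map sorted_iff_nth_mono start_mono simp del: upt_Suc)
  qed
  have set: "set (map (start \<pi>) [0..<Suc (length \<pi>)]) = breaks \<pi>" for \<pi>
    by (auto simp del: upt_Suc)
  have eq: "map (start \<pi>) [0..<Suc (length \<pi>)] = map (start \<rho>) [0..<Suc (length \<rho>)]"
    using srt[OF assms(1)] srt[OF assms(2)] set assms(3) by (intro sorted_distinct_set_unique) auto
  then have len: "length \<pi> = length \<rho>" by (metis diff_zero length_map length_upt nat.inject)
  have st: "start \<pi> a = start \<rho> a" if "a \<le> length \<pi>" for a
  proof -
    have "map (start \<pi>) [0..<Suc (length \<pi>)] ! a = map (start \<rho>) [0..<Suc (length \<rho>)] ! a" using eq by simp
    then show ?thesis using that len by (simp del: upt_Suc)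
  qed
  show ?thesis
  proof (rule nth_equalityI)
    fix a assume "a < length \<pi>"
    then show "\<pi> ! a = \<rho> ! a"
      using st[of a] st[of "Suc a"] start_Suc[of a \<pi>] start_Suc[of a \<rho>] len by simp
  qed (rule len)
qed

text \<open>The initial segments before and through a block are both mapped onto themselves, and an
  injective map then preserves their difference.\<close>

lemma blk_preserved:
  assumes p: "sum_list \<pi> = p" and U: "\<And>m. m \<in> breaks \<pi> \<Longrightarrow> U ` {..<m} = {..<m}" and inj: "inj_on U {..<p}" and i: "i < p"
  shows "blk \<pi> (U i) = blk \<pi> i"
proof (rule blk_eqI)
  have i': "i < sum_list \<pi>" using i p by simp
  note b = blk_props[OF i']
  have U1: "U ` {..<start \<pi> (blk \<pi> i)} = {..<start \<pi> (blk \<pi> i)}" and U2: "U ` {..<start \<pi> (Suc (blk \<pi> i))} = {..<start \<pi> (Suc (blk \<pi> i))}"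
    using b(1) by (auto intro!: U simp: Suc_leI)
  show "U i < start \<pi> (Suc (blk \<pi> i))" using U2 b(3) by blast
  show "start \<pi> (blk \<pi> i) \<le> U i"
  proof (rule ccontr)
    assume "\<not> start \<pi> (blk \<pi> i) \<le> U i"
    then obtain j where "j < start \<pi> (blk \<pi> i)" "U j = U i" using U1 by (metis imageE lessThan_iff not_le)
    then show False using inj_onD[OF inj, of j i] b(2) i by auto
  qed
qed

section \<open>Distinct orbit closures\<close>

lemma upper_triangular_from_blocks:
  assumes M: "M \<in> carrier_mat p p" "block_upper \<pi> M" and p: "sum_list \<pi> = p"
    and b: "\<And>a. a < length \<pi> \<Longrightarrow> upper_triangular (block \<pi> a a M)"
  shows "upper_triangular M"
  unfolding upper_triangular_def
proof (intro allI impI)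
  fix i j assume "i < dim_row M" "j < i"
  then have ij: "i < p" "j < p" "j < i" using M by auto
  have i': "i < sum_list \<pi>" "j < sum_list \<pi>" using ij p by auto
  show "M $$ (i,j) = 0"
  proof (cases "blk \<pi> j < blk \<pi> i")
    case True
    then show ?thesis using M(2) i' unfolding block_upper_def by simp
  next
    case False
    define a where "a = blk \<pi> i"
    have eq: "blk \<pi> j = a" using blk_mono[of j i \<pi>] False ij i' a_def by simp
    have o: "i - start \<pi> a < \<pi> ! a" "start \<pi> a + (i - start \<pi> a) = i" "j - start \<pi> a < \<pi> ! a" "start \<pi> a + (j - start \<pi> a) = j"
      using blk_offset[OF i'(1)] blk_offset[OF i'(2)] eq a_def by auto
    have "block \<pi> a a M $$ (i - start \<pi> a, j - start \<pi> a) = 0"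
      using b[of a] blk_props(1)[OF i'(1)] o ij(3) unfolding upper_triangular_def a_def[symmetric] by auto
    then show ?thesis using o by (simp add: index_block)
  qed
qed

text \<open>Schur triangularization is done in each diagonal block of the first tuple, and the same
  base change is applied to the matched block of the second. Matched blocks therefore stay equal and
  the pair remains in \<open>C_space\<close>.\<close>

lemma triangular_representative:
  assumes \<sigma>: "\<sigma> permutes {..<length \<pi>}" and p: "sum_list \<pi> = p" and n: "l < n"
    and z: "z \<in> orbit2 p (C_space p n \<pi> \<sigma>)"
  obtains g h A A' where "g \<in> GL p" "h \<in> GL p" "(A, A') \<in> C_space p n \<pi> \<sigma>"
    "z = (conj_act p g A, conj_act p h A')" "upper_triangular (A ! l)" "upper_triangular (A' ! l)"
proof -
  let ?\<rho> = "permute_list \<sigma> \<pi>"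
  have p': "sum_list ?\<rho> = p" using sum_list_permute_list[OF \<sigma>] p by simp
  obtain g h A A' where z': "z = (conj_act p g A, conj_act p h A')" "g \<in> GL p" "h \<in> GL p" "(A, A') \<in> C_space p n \<pi> \<sigma>"
    using z unfolding orbit2_def by auto
  have A: "A \<in> upper_tuples p n \<pi>" "A' \<in> upper_tuples p n ?\<rho>"
    "\<And>a. a < length \<pi> \<Longrightarrow> diag_blocks ?\<rho> a A' = diag_blocks \<pi> (\<sigma> a) A"
    using z'(4) unfolding C_space_def by auto
  have mt: "A \<in> mat_tuples p n" "A' \<in> mat_tuples p n" using C_space_mat_tuples[OF z'(4)] by auto
  have "\<exists>K\<in>GL (\<pi> ! a). upper_triangular (K * block \<pi> a a (A ! l) * minv (\<pi> ! a) K)" for a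
  proof -
    obtain K T where K: "K \<in> GL (\<pi> ! a)" "T \<in> carrier_mat (\<pi> ! a) (\<pi> ! a)" "upper_triangular T"
      "block \<pi> a a (A ! l) = K * T * minv (\<pi> ! a) K"
      using schur_GL[OF block_carrier[of \<pi> a a "A ! l"]] by metis
    note c = GL_carrier[OF K(1)] GL_minv[OF K(1)]
    have "minv (\<pi> ! a) K * block \<pi> a a (A ! l) * minv (\<pi> ! a) (minv (\<pi> ! a) K) = T"
    proof -
      have "minv (\<pi> ! a) K * (K * T * minv (\<pi> ! a) K) * K = (minv (\<pi> ! a) K * K) * T * (minv (\<pi> ! a) K * K)"
        using c(1,2) K(2) by (simp add: mult_carrier_mat[of _ "\<pi> ! a" "\<pi> ! a"] assoc_mult_mat[of _ "\<pi> ! a" "\<pi> ! a" _ "\<pi> ! a" _ "\<pi> ! a"])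
      then show ?thesis
        using c(4) minv_minv[OF K(1)] K(4) left_mult_one_mat[OF K(2)] right_mult_one_mat[OF K(2)] by simp
    qed
    then show ?thesis using K(3) c(5) by (intro bexI[of _ "minv (\<pi> ! a) K"]) simp_all
  qed
  then obtain K where K: "\<And>a. K a \<in> GL (\<pi> ! a)" "\<And>a. upper_triangular (K a * block \<pi> a a (A ! l) * minv (\<pi> ! a) (K a))"
    by metis
  obtain k where k: "k \<in> GL p" "conj_act p k A \<in> upper_tuples p n \<pi>"
    "\<And>a. a < length \<pi> \<Longrightarrow> diag_blocks \<pi> a (conj_act p k A) = conj_act (\<pi> ! a) (K a) (diag_blocks \<pi> a A)"
    using levi_conjugation[OF A(1) p, of K] K(1) by blast
  have K': "K (\<sigma> a) \<in> GL (?\<rho> ! a)" if "a < length ?\<rho>" for a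
    using K(1)[of "\<sigma> a"] that permute_list_nth[OF \<sigma>, of a] by simp
  obtain k' where k': "k' \<in> GL p" "conj_act p k' A' \<in> upper_tuples p n ?\<rho>"
    "\<And>a. a < length ?\<rho> \<Longrightarrow> diag_blocks ?\<rho> a (conj_act p k' A') = conj_act (?\<rho> ! a) (K (\<sigma> a)) (diag_blocks ?\<rho> a A')"
    using levi_conjugation[OF A(2) p', of "\<lambda>a. K (\<sigma> a)"] K' by blast
  have \<sigma>lt: "\<sigma> a < length \<pi>" if "a < length \<pi>" for a using \<sigma> that by (metis lessThan_iff permutes_in_image)
  have d: "diag_blocks ?\<rho> a (conj_act p k' A') = diag_blocks \<pi> (\<sigma> a) (conj_act p k A)" if "a < length \<pi>" for a
    using k(3)[OF \<sigma>lt[OF that]] k'(3)[of a] that A(3)[OF that] permute_list_nth[OF \<sigma>, of a] by simp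
  have C: "(conj_act p k A, conj_act p k' A') \<in> C_space p n \<pi> \<sigma>"
    unfolding C_space_def using k(2) k'(2) d by auto
  have len: "length A = n" "length A' = n" using mt mat_tuplesD(1) by auto
  have b: "upper_triangular (block \<pi> a a (conj_act p k A ! l))" if "a < length \<pi>" for a
  proof -
    have "block \<pi> a a (conj_act p k A ! l) = diag_blocks \<pi> a (conj_act p k A) ! l"
      using n len by (simp add: diag_blocks_nth)
    also have "\<dots> = K a * block \<pi> a a (A ! l) * minv (\<pi> ! a) (K a)"
      unfolding k(3)[OF that] using n len by (simp add: conj_act_nth diag_blocks_nth)
    finally show ?thesis using K(2) by simp
  qed
  have b': "upper_triangular (block ?\<rho> a a (conj_act p k' A' ! l))" if "a < length ?\<rho>" for a
  proof -
    have a: "a < length \<pi>" using that by simp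
    have "block ?\<rho> a a (conj_act p k' A' ! l) = diag_blocks ?\<rho> a (conj_act p k' A') ! l"
      using n len by (simp add: diag_blocks_nth)
    also have "\<dots> = block \<pi> (\<sigma> a) (\<sigma> a) (conj_act p k A ! l)"
      unfolding d[OF a] using n len by (simp add: diag_blocks_nth)
    finally show ?thesis using b[OF \<sigma>lt[OF a]] by simp
  qed
  have cl: "conj_act p k A \<in> mat_tuples p n" "conj_act p k' A' \<in> mat_tuples p n"
    using C_space_mat_tuples[OF C] by auto
  have bu: "block_upper \<pi> (conj_act p k A ! l)" "block_upper ?\<rho> (conj_act p k' A' ! l)"
    using k(2) k'(2) n unfolding upper_tuples_iff by auto
  have "z = (conj_act p (g * minv p k) (conj_act p k A), conj_act p (h * minv p k') (conj_act p k' A'))"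
    unfolding z'(1)
    using conj_act_conj_act[OF z'(2) GL_minv(4)[OF k(1)] cl(1)] conj_act_conj_act[OF z'(3) GL_minv(4)[OF k'(1)] cl(2)]
      conj_act_minv(1)[OF k(1) mt(1)] conj_act_minv(1)[OF k'(1) mt(2)] by simp
  moreover have "g * minv p k \<in> GL p" "h * minv p k' \<in> GL p"
    using GL_mult(1)[OF z'(2) GL_minv(4)[OF k(1)]] GL_mult(1)[OF z'(3) GL_minv(4)[OF k'(1)]] by auto
  moreover have "upper_triangular (conj_act p k A ! l)" "upper_triangular (conj_act p k' A' ! l)"
    using upper_triangular_from_blocks[OF mat_tuplesD(2)[OF cl(1) n] bu(1) p b]
      upper_triangular_from_blocks[OF mat_tuplesD(2)[OF cl(2) n] bu(2) p' b'] by auto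
  ultimately show ?thesis using that C by blast
qed

text \<open>Elimination handles a single equation, so all entries for all members of the flag are
  packed into one polynomial. Over the complex numbers its vanishing is weaker than that of the
  entries; only the vanishing of the entries implies that of the sum in general.\<close>

definition staircase_sum ::
  "nat \<Rightarrow> nat set \<Rightarrow> complex mat \<Rightarrow> complex mat \<Rightarrow> (nat \<Rightarrow> complex) \<Rightarrow> complex" where
  "staircase_sum p S M N s = (\<Sum>m\<in>S. \<Sum>r<p. \<Sum>c<p. (staircase p m M N s $$ (r,c))\<^sup>2)"

lemma staircase_sum_zero:
  assumes "\<And>m. m \<in> S \<Longrightarrow> staircase p m M N s = 0\<^sub>m p p"
  shows "staircase_sum p S M N s = 0"
  unfolding staircase_sum_def using assms by (intro sum.neutral ballI) auto

lemma breaks_le: "m \<in> breaks \<pi> \<Longrightarrow> m \<le> sum_list \<pi>"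
  using start_mono[of _ "length \<pi>" \<pi>] by auto

lemma polynomial_staircase_sum:
  assumes "M \<in> polynomial_mats \<Gamma> p p" "N \<in> polynomial_mats \<Gamma> p p"
    "\<And>i. i < p \<Longrightarrow> s i \<in> polynomial_functions \<Gamma>" "\<And>m. m \<in> S \<Longrightarrow> m \<le> p"
  shows "(\<lambda>x. staircase_sum p S (M x) (N x) (\<lambda>i. s i x)) \<in> polynomial_functions \<Gamma>"
  unfolding staircase_sum_def
  using polynomial_matsD(4)[OF polynomial_mats_staircase[OF assms(1-3)]] assms(4)
  by (intro polynomial_functions_sum polynomial_functions_power) auto

lemma staircase_sum_conj_vanishes:
  assumes g: "g \<in> GL p" and T: "T \<in> carrier_mat p p" "upper_triangular T" and N: "N \<in> carrier_mat p p" "block_upper \<pi> N"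
    and p: "sum_list \<pi> = p" and s: "\<And>i. i < p \<Longrightarrow> s i = T $$ (i,i)"
  shows "staircase_sum p (breaks \<pi>) (g * T * minv p g) (g * N * minv p g) s = 0"
proof (rule staircase_sum_zero)
  fix m assume m: "m \<in> breaks \<pi>"
  show "staircase p m (g * T * minv p g) (g * N * minv p g) s = 0\<^sub>m p p"
    using staircase_conj[OF g T(1) N(1)] staircase_vanishes[OF T N p m s] GL_carrier[OF g] GL_minv(1)[OF g] by simp
qed

text \<open>The value is a sum of squares of integers, so it vanishes only if every term does.\<close>

lemma staircase_sum_test:
  assumes s: "\<And>i. i < p \<Longrightarrow> s i = of_nat (u i)" and S: "finite S" "\<And>m. m \<in> S \<Longrightarrow> m \<le> p"
  obtains k :: int where "0 \<le> k" "staircase_sum p S (mat_diag p (\<lambda>r. of_nat (d r)))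
      (mat p p (\<lambda>(r,c). if blk \<pi> r \<le> blk \<pi> c then 1 else 0)) s = of_int k"
    "\<And>m r c. k = 0 \<Longrightarrow> m \<in> S \<Longrightarrow> r < p \<Longrightarrow> c < p \<Longrightarrow>
      d r \<in> u ` {..<m} \<or> blk \<pi> c < blk \<pi> r \<or> d c \<in> u ` {m..<p}"
proof
  define M where "M = mat_diag p (\<lambda>r. of_nat (d r) :: complex)"
  define N where "N = mat p p (\<lambda>(r,c). if blk \<pi> r \<le> blk \<pi> c then 1 else 0 :: complex)"
  define e where "e m r c = (\<Prod>i\<in>{0..<m}. int (d r) - int (u i)) * (if blk \<pi> r \<le> blk \<pi> c then 1 else 0) *
    (\<Prod>i\<in>{m..<p}. int (d c) - int (u i))" for m r c
  define k where "k = (\<Sum>m\<in>S. \<Sum>r<p. \<Sum>c<p. (e m r c)\<^sup>2)"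
  have entry: "staircase p m M N s $$ (r,c) = of_int (e m r c)" if "m \<in> S" "r < p" "c < p" for m r c
  proof -
    have pl: "(\<Prod>i\<leftarrow>[a..<b]. f i) = (\<Prod>i\<in>{a..<b}. f i)" for a b and f :: "nat \<Rightarrow> complex"
      using prod.distinct_set_conv_list[of "[a..<b]" f] by simp
    have 1: "(\<Prod>i\<leftarrow>[0..<m]. of_nat (d r) - s i) = of_int (\<Prod>i\<in>{0..<m}. int (d r) - int (u i))"
      unfolding pl of_int_prod using S(2)[OF that(1)] s by (intro prod.cong) auto
    have 2: "(\<Prod>i\<leftarrow>[m..<p]. of_nat (d c) - s i) = of_int (\<Prod>i\<in>{m..<p}. int (d c) - int (u i))"
      unfolding pl of_int_prod using s by (intro prod.cong) auto
    show ?thesis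
      unfolding M_def staircase_mat_diag[of N p, OF _ that(2,3), unfolded N_def, OF mat_carrier, folded N_def] 1 2 e_def
      using that by (simp add: N_def)
  qed
  show "0 \<le> k" unfolding k_def by (intro sum_nonneg) simp
  show "staircase_sum p S (mat_diag p (\<lambda>r. of_nat (d r)))
      (mat p p (\<lambda>(r,c). if blk \<pi> r \<le> blk \<pi> c then 1 else 0)) s = of_int k"
    unfolding M_def[symmetric] N_def[symmetric] staircase_sum_def k_def by (simp add: entry)
  fix m r c assume k0: "k = 0" and m: "m \<in> S" and rc: "r < p" "c < p"
  have "(\<Sum>r<p. \<Sum>c<p. (e m r c)\<^sup>2) = 0"
    using k0 m S(1) unfolding k_def by (subst (asm) sum_nonneg_eq_0_iff) (auto intro!: sum_nonneg)
  then have "(\<Sum>c<p. (e m r c)\<^sup>2) = 0"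
    using rc by (subst (asm) sum_nonneg_eq_0_iff) (auto intro: sum_nonneg)
  then have "(e m r c)\<^sup>2 = 0"
    using rc by (subst (asm) sum_nonneg_eq_0_iff) auto
  then have "e m r c = 0" by simp
  then show "d r \<in> u ` {..<m} \<or> blk \<pi> c < blk \<pi> r \<or> d c \<in> u ` {m..<p}"
    unfolding e_def by (auto simp: image_iff split: if_splits)
qed

text \<open>An equation valid on the orbit for \<open>\<kappa>\<close> and \<open>\<tau>\<close>
  persists on its closure, hence holds at a chosen point of the orbit for \<open>\<pi>\<close> and
  \<open>\<sigma>\<close>. There it becomes a purely combinatorial statement about a self-map
  \<open>T\<close> of the positions.\<close>

lemma orbit_in_closure_staircase:
  assumes \<sigma>: "\<sigma> permutes {..<length \<pi>}" and \<pi>: "sum_list \<pi> = p"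
    and \<tau>: "\<tau> permutes {..<length \<kappa>}" and \<kappa>: "sum_list \<kappa> = p" and n: "2 \<le> n"
    and sub: "orbit2 p (C_space p n \<pi> \<sigma>) \<subseteq> Abstract_Topology.closure_of (zariski2 p n) (orbit2 p (C_space p n \<kappa> \<tau>))"
  obtains T where "T ` {..<p} \<subseteq> {..<p}"
    "\<And>m r c. m \<in> breaks \<kappa> \<Longrightarrow> r < p \<Longrightarrow> c < p \<Longrightarrow> r \<in> T ` {..<m} \<or> blk \<pi> c < blk \<pi> r \<or> c \<in> T ` {m..<p}"
    "\<And>m r c. m \<in> breaks (permute_list \<tau> \<kappa>) \<Longrightarrow> r < p \<Longrightarrow> c < p \<Longrightarrow>
      matched_pos \<pi> \<sigma> r \<in> (\<lambda>i. T (matched_pos \<kappa> \<tau> i)) ` {..<m} \<or>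
      blk (permute_list \<sigma> \<pi>) c < blk (permute_list \<sigma> \<pi>) r \<or>
      matched_pos \<pi> \<sigma> c \<in> (\<lambda>i. T (matched_pos \<kappa> \<tau> i)) ` {m..<p}"
proof -
  let ?\<rho> = "permute_list \<sigma> \<pi>" and ?\<mu> = "permute_list \<tau> \<kappa>"
  let ?s = "matched_pos \<pi> \<sigma>" and ?t = "matched_pos \<kappa> \<tau>"
  have \<rho>: "sum_list ?\<rho> = p" and \<mu>: "sum_list ?\<mu> = p" using sum_list_permute_list \<sigma> \<tau> \<pi> \<kappa> by auto
  define V where "V l z = ev n p (fst z) (NVar l)" for l and z :: "complex mat list \<times> complex mat list"
  define W where "W l z = ev n p (snd z) (NVar l)" for l and z :: "complex mat list \<times> complex mat list"
  have comp: "(\<lambda>z. ev n p (fst z) e) \<in> polynomial_mats (coords2 p n) p p"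
    "(\<lambda>z. ev n p (snd z) e) \<in> polynomial_mats (coords2 p n) p p" for e
    using polynomial_matsD(4)[OF ev_polynomial[of n p e]]
    by (auto intro!: polynomial_matsI polynomial_functions_coords2)
  have VW: "V l \<in> polynomial_mats (coords2 p n) p p" "W l \<in> polynomial_mats (coords2 p n) p p" for l
    unfolding V_def W_def by (rule comp)+
  have VW_eq: "V l (A, A') = A ! l" "W l (A, A') = A' ! l"
    if "l < 2" "A \<in> mat_tuples p n" "A' \<in> mat_tuples p n" for l A A'
    unfolding V_def W_def using that n by (auto simp: ev_NVar)
  \<comment> \<open>Both summands use the same variables, those of the second tuple being reindexed
    by the matching of blocks. This ties the two flags together and makes the permutation visible,
    not just the two compositions.\<close>
  define H where "H x = staircase_sum p (breaks \<kappa>) (V 0 (fst x)) (V 1 (fst x)) (snd x) +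
    staircase_sum p (breaks ?\<mu>) (W 0 (fst x)) (W 1 (fst x)) (\<lambda>i. snd x (?t i))" for x
  have "(\<lambda>x. staircase_sum p (breaks \<kappa>) (V 0 (fst x)) (V 1 (fst x)) (\<lambda>i. snd x i)) \<in> polynomial_functions (adjoin_vars (coords2 p n) p)"
    using breaks_le \<kappa>
    by (intro polynomial_staircase_sum polynomial_mats_fst VW polynomial_functions.coord) (auto simp: adjoin_vars_def)
  moreover have "(\<lambda>x. staircase_sum p (breaks ?\<mu>) (W 0 (fst x)) (W 1 (fst x)) (\<lambda>i. snd x (?t i))) \<in> polynomial_functions (adjoin_vars (coords2 p n) p)"
    using breaks_le \<mu> matched_pos_props(1)[OF \<tau>] \<kappa>
    by (intro polynomial_staircase_sum polynomial_mats_fst VW polynomial_functions.coord) (auto simp: adjoin_vars_def)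
  ultimately have "H \<in> polynomial_functions (adjoin_vars (coords2 p n) p)"
    unfolding H_def by (auto dest: polynomial_functions.add)
  then obtain f where f: "f \<in> polynomial_functions (coords2 p n)"
    "\<And>z. f z = 0 \<longleftrightarrow> (\<exists>t. (\<forall>i<p. poly (char_poly (V 0 z)) (t i) = 0) \<and> H (z,t) = 0)"
    using eliminate_variables[OF VW(1)[of 0]] by blast
  have vanish: "f z = 0" if z: "z \<in> orbit2 p (C_space p n \<kappa> \<tau>)" for z
  proof -
    have "0 < n" using n by simp
    then obtain g h A A' where A: "g \<in> GL p" "h \<in> GL p" "(A, A') \<in> C_space p n \<kappa> \<tau>"
      "z = (conj_act p g A, conj_act p h A')" "upper_triangular (A ! 0)" "upper_triangular (A' ! 0)"
      using triangular_representative[OF \<tau> \<kappa> _ z] by metis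
    have mt: "A \<in> mat_tuples p n" "A' \<in> mat_tuples p n" using C_space_mat_tuples[OF A(3)] by auto
    have c: "A ! 0 \<in> carrier_mat p p" "A ! 1 \<in> carrier_mat p p" "A' ! 0 \<in> carrier_mat p p" "A' ! 1 \<in> carrier_mat p p"
      using mat_tuplesD(2)[OF mt(1)] mat_tuplesD(2)[OF mt(2)] n by auto
    have C: "block_upper \<kappa> (A ! 1)" "block_upper ?\<mu> (A' ! 1)"
      and match: "\<And>i. i < p \<Longrightarrow> A' ! 0 $$ (i,i) = A ! 0 $$ (?t i, ?t i)"
      using A(3) n unfolding C_space_iff[OF \<tau> \<kappa>] upper_tuples_iff by auto
    have VW': "V l z = g * (A ! l) * minv p g" "W l z = h * (A' ! l) * minv p h" if "l < 2" for l
      unfolding A(4) using VW_eq[OF that conj_act_closed[OF A(1) mt(1)] conj_act_closed[OF A(2) mt(2)]] that n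
        mat_tuplesD(1)[OF mt(1)] mat_tuplesD(1)[OF mt(2)] by (auto simp: conj_act_nth)
    \<comment> \<open>The diagonal of the triangular first matrix lists the eigenvalues in the order
      of the flag; by \<open>match\<close>, reindexing it gives the diagonal for the second
      tuple.\<close>
    define t where "t i = A ! 0 $$ (i,i)" for i
    have "poly (char_poly (V 0 z)) (t i) = 0" if "i < p" for i
      using that char_poly_root_conj_upper_triangular[OF A(1) c(1) A(5)] VW'(1)[of 0] unfolding t_def by auto
    moreover have "H (z,t) = 0"
      unfolding H_def
      using staircase_sum_conj_vanishes[OF A(1) c(1) A(5) c(2) C(1) \<kappa>, of t]
        staircase_sum_conj_vanishes[OF A(2) c(3) A(6) c(4) C(2) \<mu>, of "\<lambda>i. t (?t i)"] match
      by (simp add: VW' t_def)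
    ultimately show ?thesis using f(2) by blast
  qed
  have vanish_closure: "f z = 0" if z: "z \<in> Abstract_Topology.closure_of (zariski2 p n) (orbit2 p (C_space p n \<kappa> \<tau>))" for z
  proof -
    let ?X = "mat_tuples p n \<times> mat_tuples p n"
    have "closedin (zariski2 p n) {x \<in> ?X. \<forall>F\<in>{f}. F x = 0}"
      unfolding closedin_zariski using f(1) by blast
    moreover have "orbit2 p (C_space p n \<kappa> \<tau>) \<subseteq> {x \<in> ?X. \<forall>F\<in>{f}. F x = 0}"
      using vanish orbit2_subset_mat_tuples[of p n \<kappa> \<tau>] by auto
    ultimately have "Abstract_Topology.closure_of (zariski2 p n) (orbit2 p (C_space p n \<kappa> \<tau>)) \<subseteq> {x \<in> ?X. \<forall>F\<in>{f}. F x = 0}"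
      by (intro closure_of_minimal)
    then show ?thesis using z by auto
  qed
  define ones where "ones \<xi> = mat p p (\<lambda>(r,c). if blk \<xi> r \<le> blk \<xi> c then 1 else 0 :: complex)" for \<xi> :: "nat list"
  \<comment> \<open>The diagonal matrix of the second tuple is rearranged by \<open>?s\<close> so
    that matched diagonal blocks agree. For the second matrices this is automatic, since every
    diagonal block of \<open>ones\<close> consists of ones only.\<close>
  define A where "A = map (\<lambda>l. if l = 0 then mat_diag p of_nat else if l = 1 then ones \<pi> else 0\<^sub>m p p) [0..<n]"
  define A' where "A' = map (\<lambda>l. if l = 0 then mat_diag p (\<lambda>r. of_nat (?s r)) else if l = 1 then ones ?\<rho> else 0\<^sub>m p p) [0..<n]"
  have mt: "A \<in> mat_tuples p n" "A' \<in> mat_tuples p n"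
    unfolding A_def A'_def ones_def by (auto intro!: mat_tuplesI)
  have A01: "A ! 0 = mat_diag p of_nat" "A ! 1 = ones \<pi>" "A' ! 0 = mat_diag p (\<lambda>r. of_nat (?s r))" "A' ! 1 = ones ?\<rho>"
    using n unfolding A_def A'_def by auto
  have sp: "?s i < p" "blk \<pi> (?s i) = \<sigma> (blk ?\<rho> i)" if "i < p" for i
    using matched_pos_props[OF \<sigma>] \<pi> that by auto
  have sinj: "?s i = ?s j \<longleftrightarrow> i = j" if "i < p" "j < p" for i j
    using matched_pos_inj[OF \<sigma>] \<pi> that by (auto dest: inj_onD)
  have "(A, A') \<in> C_space p n \<pi> \<sigma>"
    unfolding C_space_iff[OF \<sigma> \<pi>] upper_tuples_iff block_upper_def \<pi> \<rho>
  proof (intro conjI allI impI)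
    fix l i j assume "l < n" "i < p" "j < p" "blk ?\<rho> i = blk ?\<rho> j"
    then show "A' ! l $$ (i,j) = A ! l $$ (?s i, ?s j)"
      using sp sinj unfolding A_def A'_def by (auto simp: mat_diag_def ones_def)
  qed (use mt in \<open>auto simp: A_def A'_def mat_diag_def ones_def\<close>)
  then have "(A, A') \<in> orbit2 p (C_space p n \<pi> \<sigma>)"
    using mem_orbit2I[OF conj_act_one(2)[OF mt(1)] conj_act_one(2)[OF mt(2)] mt] conj_act_one(1) mt by simp
  then have "f (A, A') = 0" using sub vanish_closure by blast
  then obtain t where t: "\<And>i. i < p \<Longrightarrow> poly (char_poly (V 0 (A, A'))) (t i) = 0" "H ((A, A'), t) = 0"
    using f(2) by blast
  have VWA: "V 0 (A, A') = mat_diag p of_nat" "V 1 (A, A') = ones \<pi>"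
    "W 0 (A, A') = mat_diag p (\<lambda>r. of_nat (?s r))" "W 1 (A, A') = ones ?\<rho>"
    using VW_eq[OF _ mt] A01 by auto
  \<comment> \<open>The eigenvalues at the test point are distinct natural numbers, so
    \<open>t\<close> amounts to a map \<open>T\<close> on positions. At this stage \<open>T\<close>
    may still repeat values.\<close>
  have "\<exists>k<p. t i = of_nat k" if i: "i < p" for i
  proof -
    have d: "(mat_diag p of_nat :: complex mat) \<in> carrier_mat p p" "upper_triangular (mat_diag p of_nat :: complex mat)"
      by (auto simp: mat_diag_def upper_triangular_def)
    have "1\<^sub>m p * mat_diag p of_nat * minv p (1\<^sub>m p) = (mat_diag p of_nat :: complex mat)"
      using GL_I(3)[of "1\<^sub>m p" p "1\<^sub>m p"] left_mult_one_mat[OF d(1)] right_mult_one_mat[OF d(1)] by simp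
    then have "\<exists>k<p. t i = mat_diag p of_nat $$ (k,k)"
      using t(1)[OF i] char_poly_root_conj_upper_triangular[OF conj_act_one(2)[OF mt(1)] d, of "t i"] VWA(1) by simp
    then show ?thesis by (auto simp: mat_diag_def)
  qed
  then obtain T where T: "\<And>i. i < p \<Longrightarrow> T i < p" "\<And>i. i < p \<Longrightarrow> t i = of_nat (T i)" by metis
  have tT: "t (?t i) = of_nat (T (?t i))" if "i < p" for i
    using T(2)[of "?t i"] matched_pos_props(1)[OF \<tau>] \<kappa> that by simp
  obtain k1 :: int where k1: "0 \<le> k1" "staircase_sum p (breaks \<kappa>) (mat_diag p (\<lambda>r. of_nat r)) (ones \<pi>) t = of_int k1"
    "\<And>m r c. k1 = 0 \<Longrightarrow> m \<in> breaks \<kappa> \<Longrightarrow> r < p \<Longrightarrow> c < p \<Longrightarrow>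
      r \<in> T ` {..<m} \<or> blk \<pi> c < blk \<pi> r \<or> c \<in> T ` {m..<p}"
    unfolding ones_def
    by (rule staircase_sum_test[of p t T "breaks \<kappa>" "\<lambda>r. r" \<pi>]) (use T(2) breaks_le \<kappa> in auto)
  obtain k2 :: int where k2: "0 \<le> k2" "staircase_sum p (breaks ?\<mu>) (mat_diag p (\<lambda>r. of_nat (?s r))) (ones ?\<rho>) (\<lambda>i. t (?t i)) = of_int k2"
    "\<And>m r c. k2 = 0 \<Longrightarrow> m \<in> breaks ?\<mu> \<Longrightarrow> r < p \<Longrightarrow> c < p \<Longrightarrow>
      ?s r \<in> (\<lambda>i. T (?t i)) ` {..<m} \<or> blk ?\<rho> c < blk ?\<rho> r \<or> ?s c \<in> (\<lambda>i. T (?t i)) ` {m..<p}"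
    unfolding ones_def
    by (rule staircase_sum_test[of p "\<lambda>i. t (?t i)" "\<lambda>i. T (?t i)" "breaks ?\<mu>" ?s ?\<rho>]) (use tT breaks_le \<mu> in auto)
  have "of_int (k1 + k2) = (0 :: complex)"
    using t(2) k1(2) k2(2) unfolding H_def fst_conv snd_conv VWA by simp
  then have "k1 + k2 = 0" by (metis of_int_eq_0_iff)
  then have "k1 = 0" "k2 = 0" using k1(1) k2(1) by auto
  then show ?thesis using that[of T] T(1) k1(3) k2(3) by (auto simp: image_subset_iff)
qed

text \<open>\<open>T\<close> and \<open>U\<close> describe the same list of eigenvalues by positions
  in the first and in the second tuple. The staircase conditions make each a permutation that
  preserves the initial segments given by the breaks, while the last conclusion links the
  two.\<close>

lemma breaks_subset_of_orbit_in_closure: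
  assumes \<sigma>: "\<sigma> permutes {..<length \<pi>}" and \<pi>: "sum_list \<pi> = p"
    and \<tau>: "\<tau> permutes {..<length \<kappa>}" and \<kappa>: "sum_list \<kappa> = p" and n: "2 \<le> n"
    and sub: "orbit2 p (C_space p n \<pi> \<sigma>) \<subseteq> Abstract_Topology.closure_of (zariski2 p n) (orbit2 p (C_space p n \<kappa> \<tau>))"
  obtains T U where "breaks \<kappa> \<subseteq> breaks \<pi>" "breaks (permute_list \<tau> \<kappa>) \<subseteq> breaks (permute_list \<sigma> \<pi>)"
    "inj_on T {..<p}" "inj_on U {..<p}" "U ` {..<p} = {..<p}"
    "\<And>m. m \<in> breaks \<kappa> \<Longrightarrow> T ` {..<m} = {..<m}" "\<And>m. m \<in> breaks (permute_list \<tau> \<kappa>) \<Longrightarrow> U ` {..<m} = {..<m}"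
    "\<And>i. i < p \<Longrightarrow> matched_pos \<pi> \<sigma> (U i) = T (matched_pos \<kappa> \<tau> i)"
proof -
  let ?\<rho> = "permute_list \<sigma> \<pi>" and ?\<mu> = "permute_list \<tau> \<kappa>"
  let ?s = "matched_pos \<pi> \<sigma>" and ?t = "matched_pos \<kappa> \<tau>"
  have \<rho>: "sum_list ?\<rho> = p" and \<mu>: "sum_list ?\<mu> = p" using sum_list_permute_list \<sigma> \<tau> \<pi> \<kappa> by auto
  obtain T where T: "T ` {..<p} \<subseteq> {..<p}"
    and st: "\<And>m r c. m \<in> breaks \<kappa> \<Longrightarrow> r < p \<Longrightarrow> c < p \<Longrightarrow> r \<in> T ` {..<m} \<or> blk \<pi> c < blk \<pi> r \<or> c \<in> T ` {m..<p}"
    and st': "\<And>m r c. m \<in> breaks ?\<mu> \<Longrightarrow> r < p \<Longrightarrow> c < p \<Longrightarrow>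
      ?s r \<in> (\<lambda>i. T (?t i)) ` {..<m} \<or> blk ?\<rho> c < blk ?\<rho> r \<or> ?s c \<in> (\<lambda>i. T (?t i)) ` {m..<p}"
    using orbit_in_closure_staircase[OF \<sigma> \<pi> \<tau> \<kappa> n sub] by blast
  have s: "?s ` {..<p} = {..<p}" "inj_on ?s {..<p}" and t: "?t ` {..<p} = {..<p}"
    using matched_pos_image[OF \<sigma>] matched_pos_inj[OF \<sigma>] matched_pos_image[OF \<tau>] \<pi> \<kappa> by auto
  have pb: "p \<in> breaks \<xi>" if "sum_list \<xi> = p" for \<xi> :: "nat list"
    using start_length[of \<xi>] that by (metis atMost_iff image_eqI order_refl)
  \<comment> \<open>At m = p the third alternative is empty, and taking the same position for row
    and column excludes the second.\<close>
  have Tsurj: "r \<in> T ` {..<p}" if "r < p" for r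
    using st[OF pb[OF \<kappa>] that that] by auto
  \<comment> \<open>This is \<open>T\<close> transported to positions of the second tuple, so that
    \<open>?s\<close> after \<open>U\<close> equals \<open>T\<close> after \<open>?t\<close>; then
    \<open>mem\<close> rewrites the second family of conditions into the form of the first.\<close>
  define U where "U i = inv_into {..<p} ?s (T (?t i))" for i
  have sU: "?s (U i) = T (?t i)" "U i < p" if "i < p" for i
  proof -
    have "T (?t i) \<in> ?s ` {..<p}" using that t T s(1) by blast
    then show "?s (U i) = T (?t i)" "U i < p"
      unfolding U_def using f_inv_into_f[of "T (?t i)" ?s "{..<p}"] inv_into_into[of "T (?t i)" ?s "{..<p}"] by auto
  qed
  have mem: "?s r \<in> (\<lambda>i. T (?t i)) ` I \<longleftrightarrow> r \<in> U ` I" if "r < p" "I \<subseteq> {..<p}" for r I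
  proof -
    have "?s r = T (?t i) \<longleftrightarrow> r = U i" if "i \<in> I" for i
      using sU[of i] inj_onD[OF s(2), of r "U i"] that \<open>r < p\<close> \<open>I \<subseteq> {..<p}\<close> by auto
    then show ?thesis by auto
  qed
  have stU: "r \<in> U ` {..<m} \<or> blk ?\<rho> c < blk ?\<rho> r \<or> c \<in> U ` {m..<p}" if "m \<in> breaks ?\<mu>" "r < p" "c < p" for m r c
  proof -
    have "{..<m} \<subseteq> {..<p}" "{m..<p} \<subseteq> {..<p}" using breaks_le[OF that(1)] \<mu> by auto
    then show ?thesis using st'[OF that] mem that by blast
  qed
  have Usurj: "r \<in> U ` {..<p}" if "r < p" for r
    using stU[OF pb[OF \<mu>] that that] by auto
  have Usub: "U ` {..<p} \<subseteq> {..<p}" using sU(2) by auto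
  note cT = staircase_combinatorics[OF T \<pi> Tsurj _ st]
  note cU = staircase_combinatorics[OF Usub \<rho> Usurj _ stU]
  have inj: "inj_on V {..<p}" if "V ` {..<p} = {..<p}" for V :: "nat \<Rightarrow> nat"
    using that by (intro eq_card_imp_inj_on) auto
  have img: "T ` {..<p} = {..<p}" "U ` {..<p} = {..<p}" using T Tsurj Usub Usurj by auto
  have sub1: "breaks \<kappa> \<subseteq> breaks \<pi>" using cT(2) breaks_le \<kappa> by blast
  have sub2: "breaks ?\<mu> \<subseteq> breaks ?\<rho>" using cU(2) breaks_le \<mu> by blast
  have T1: "T ` {..<m} = {..<m}" if "m \<in> breaks \<kappa>" for m using cT(1) that breaks_le[OF that] \<kappa> by blast
  have U1: "U ` {..<m} = {..<m}" if "m \<in> breaks ?\<mu>" for m using cU(1) that breaks_le[OF that] \<mu> by blast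
  show ?thesis
    by (rule that[OF sub1 sub2 inj[OF img(1)] inj[OF img(2)] img(2) T1 U1 sU(1)])
qed

text \<open>Containment in both directions gives equal breaks, hence equal compositions before and
  after permuting. Then \<open>T\<close> and \<open>U\<close> preserve blocks, and the relation
  between them, read on block numbers, says that \<open>\<sigma>\<close> and \<open>\<tau>\<close>
  agree.\<close>

lemma orbit_closure_inj:
  assumes x: "(\<pi>, \<sigma>) \<in> P_set p" and y: "(\<kappa>, \<tau>) \<in> P_set p" and n: "2 \<le> n"
    and eq: "orbit_closure p n (\<pi>, \<sigma>) = orbit_closure p n (\<kappa>, \<tau>)"
  shows "(\<pi>, \<sigma>) = (\<kappa>, \<tau>)"
proof -
  have P: "sum_list \<xi> = p \<and> \<upsilon> permutes {..<length \<xi>} \<and> (\<forall>a<length \<xi>. 0 < \<xi> ! a)"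
    if "(\<xi>, \<upsilon>) \<in> P_set p" for \<xi> \<upsilon>
    using that unfolding P_set_def compositions_def by auto
  have \<pi>: "sum_list \<pi> = p" "\<sigma> permutes {..<length \<pi>}" "\<And>a. a < length \<pi> \<Longrightarrow> 0 < \<pi> ! a"
    and \<kappa>: "sum_list \<kappa> = p" "\<tau> permutes {..<length \<kappa>}" "\<And>a. a < length \<kappa> \<Longrightarrow> 0 < \<kappa> ! a"
    using P[OF x] P[OF y] by auto
  have "orbit2 p (C_space p n \<pi> \<sigma>) \<subseteq> orbit_closure p n (\<pi>, \<sigma>)" "orbit2 p (C_space p n \<kappa> \<tau>) \<subseteq> orbit_closure p n (\<kappa>, \<tau>)"
    unfolding orbit_closure_def prod.case by (rule closure_of_subset; simp add: orbit2_subset_mat_tuples)+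
  then have sub: "orbit2 p (C_space p n \<pi> \<sigma>) \<subseteq> Abstract_Topology.closure_of (zariski2 p n) (orbit2 p (C_space p n \<kappa> \<tau>))"
    "orbit2 p (C_space p n \<kappa> \<tau>) \<subseteq> Abstract_Topology.closure_of (zariski2 p n) (orbit2 p (C_space p n \<pi> \<sigma>))"
    using eq unfolding orbit_closure_def by auto
  let ?\<rho> = "permute_list \<sigma> \<pi>" and ?\<mu> = "permute_list \<tau> \<kappa>"
  obtain T U where TU: "breaks \<kappa> \<subseteq> breaks \<pi>" "breaks ?\<mu> \<subseteq> breaks ?\<rho>"
    "inj_on T {..<p}" "inj_on U {..<p}" "U ` {..<p} = {..<p}"
    "\<And>m. m \<in> breaks \<kappa> \<Longrightarrow> T ` {..<m} = {..<m}" "\<And>m. m \<in> breaks ?\<mu> \<Longrightarrow> U ` {..<m} = {..<m}"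
    "\<And>i. i < p \<Longrightarrow> matched_pos \<pi> \<sigma> (U i) = T (matched_pos \<kappa> \<tau> i)"
    using breaks_subset_of_orbit_in_closure[OF \<pi>(2,1) \<kappa>(2,1) n sub(1)] by blast
  have rev: "breaks \<pi> \<subseteq> breaks \<kappa>" "breaks ?\<rho> \<subseteq> breaks ?\<mu>"
    using breaks_subset_of_orbit_in_closure[OF \<kappa>(2,1) \<pi>(2,1) n sub(2)] by blast+
  have pk: "\<pi> = \<kappa>" using breaks_determine[OF \<pi>(3) \<kappa>(3)] TU(1) rev(1) by blast
  have pos: "0 < permute_list \<upsilon> \<xi> ! a"
    if "\<upsilon> permutes {..<length \<xi>}" "\<And>a. a < length \<xi> \<Longrightarrow> 0 < \<xi> ! a" "a < length (permute_list \<upsilon> \<xi>)"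
    for \<upsilon> a and \<xi> :: "nat list"
    using that permute_list_nth[OF that(1), of a] permutes_in_image[OF that(1), of a] by simp
  have rm: "?\<rho> = ?\<mu>"
    using breaks_determine[OF pos[OF \<pi>(2,3)] pos[OF \<kappa>(2,3)]] TU(2) rev(2) by blast
  have \<rho>: "sum_list ?\<rho> = p" using sum_list_permute_list[OF \<pi>(2)] \<pi>(1) by simp
  have "\<sigma> a = \<tau> a" if a: "a < length \<pi>" for a
  proof -
    have pa: "0 < ?\<rho> ! a" using pos[OF \<pi>(2,3)] a by simp
    \<comment> \<open>Any position in block \<open>a\<close> would do; the first one exists because
      all parts are positive.\<close>
    define i where "i = start ?\<rho> a"
    have i: "i < p" "blk ?\<rho> i = a" using blk_start[of a ?\<rho> 0] pa a \<rho> unfolding i_def by auto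
    have Ui: "U i < p" using TU(5) i by blast
    have ti: "matched_pos \<kappa> \<tau> i < p" "blk \<kappa> (matched_pos \<kappa> \<tau> i) = \<tau> (blk ?\<mu> i)"
      using matched_pos_props[OF \<kappa>(2)] \<kappa>(1) i by auto
    have "\<sigma> a = \<sigma> (blk ?\<rho> (U i))"
      using blk_preserved[OF \<rho> _ TU(4) i(1)] TU(7) rm i(2) by simp
    also have "\<dots> = blk \<pi> (T (matched_pos \<kappa> \<tau> i))"
      using matched_pos_props(2)[OF \<pi>(2)] Ui \<pi>(1) TU(8)[OF i(1)] by metis
    also have "\<dots> = blk \<pi> (matched_pos \<kappa> \<tau> i)"
      using blk_preserved[OF \<pi>(1) _ TU(3) ti(1)] TU(6) pk by simp
    also have "\<dots> = \<tau> a" using ti(2) pk i(2) rm by simp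
    finally show ?thesis .
  qed
  \<comment> \<open>Outside the block numbers both permutations are the identity.\<close>
  moreover have "\<sigma> a = \<tau> a" if "\<not> a < length \<pi>" for a
    using \<pi>(2) \<kappa>(2) that pk by (simp add: permutes_def)
  ultimately have "\<sigma> = \<tau>" by blast
  then show ?thesis using pk by simp
qed

lemma finite_P_set: "finite (P_set p)"
proof -
  have "finite (compositions p k)" for k
  proof (rule finite_subset)
    show "compositions p k \<subseteq> {xs. set xs \<subseteq> {..p} \<and> length xs = k}"
      unfolding compositions_def using member_le_sum_list by fastforce
    show "finite {xs. set xs \<subseteq> {..p} \<and> length xs = k}" by (rule finite_lists_length_eq) simp
  qed
  moreover have "finite {\<sigma>. \<sigma> permutes {..<k}}" for k :: nat by (rule finite_permutations) simp
  ultimately show ?thesis unfolding P_set_def by simp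
qed

theorem mainTheorem8:
  fixes p n :: nat
  assumes "p \<ge> 2" and "n \<ge> 2"
  shows "bij_betw (orbit_closure p n)
    (maximal_elements (P_set p) (P_le p n))
    (irreducible_components (zariski2 p n) (separating_variety p n))"
proof -
  have P: "sum_list \<pi> = p" "\<sigma> permutes {..<length \<pi>}" if "(\<pi>, \<sigma>) \<in> P_set p" for \<pi> \<sigma>
    using that unfolding P_set_def compositions_def by auto
  have le: "P_le p n = (\<lambda>x y. orbit_closure p n x \<subseteq> orbit_closure p n y)"
    by (intro ext) (simp add: P_le_def)
  show ?thesis
    unfolding le
  proof (rule bij_betw_maximal_elements_irreducible_components[OF finite_P_set])
    fix x assume "x \<in> P_set p"
    then show "closedin (zariski2 p n) (orbit_closure p n x)" "irreducible_in (zariski2 p n) (orbit_closure p n x)"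
      unfolding orbit_closure_def using irreducible_in_closure_of[OF irreducible_orbit2[OF P(2,1)]]
      by (auto split: prod.splits)
  next
    fix x y assume "x \<in> P_set p" "y \<in> P_set p" "orbit_closure p n x = orbit_closure p n y"
    then show "x = y" using orbit_closure_inj[OF _ _ assms(2)] by (cases x, cases y) blast
  next
    show "separating_variety p n = (\<Union>x\<in>P_set p. orbit_closure p n x)"
    proof (intro subset_antisym subsetI)
      fix z assume z: "z \<in> separating_variety p n"
      have "0 < p" using assms(1) by simp
      then obtain \<pi> \<sigma> where ps: "(\<pi>, \<sigma>) \<in> P_set p" "z \<in> orbit2 p (C_space p n \<pi> \<sigma>)"
        using separating_variety_subset_orbits[of p "fst z" "snd z" n] z by auto
      then have "z \<in> orbit_closure p n (\<pi>, \<sigma>)"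
        unfolding orbit_closure_def
        using closure_of_subset[of "orbit2 p (C_space p n \<pi> \<sigma>)" "zariski2 p n"] orbit2_subset_mat_tuples by auto
      then show "z \<in> (\<Union>x\<in>P_set p. orbit_closure p n x)" using ps(1) by blast
    next
      fix z assume "z \<in> (\<Union>x\<in>P_set p. orbit_closure p n x)"
      then obtain \<pi> \<sigma> where z: "(\<pi>, \<sigma>) \<in> P_set p" "z \<in> orbit_closure p n (\<pi>, \<sigma>)" by auto
      show "z \<in> separating_variety p n"
        using closure_of_minimal[OF orbit2_subset_separating_variety[OF P(2,1)[OF z(1)]] closedin_separating_variety] z(2)
        unfolding orbit_closure_def by auto
    qed
  qed
qed

end
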